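(* Let $V$ be a symplectic vector space over $\mathbb{C}$, $U\subseteq V$ a Lagrangian subspace, and $n\ge 1$. Then the natural surjection $$HP_0(\mathcal{O}_{V^n}^{S_{n+1}})\twoheadrightarrow\mathrm{gr}\,HH_0(\mathcal{D}_{U^n}^{S_{n+1}})$$ is an isomorphism, and both sides are isomorphic to $\mathbb{C}$.
   Context: $S_{n+1}$ acts on $V^n\cong\mathbb{C}^n\otimes V$ and $U^n\cong\mathbb{C}^n\otimes U$, where $\mathbb{C}^n$ is the reflection representation of $S_{n+1}$ and $V$, $U$ are regarded as trivial representations; $\mathbb{C}^n\otimes V$ carries the induced invariant symplectic form. For a Poisson algebra $A$, $HP_0(A):=A/\{A,A\}$; for an associative algebra $B$, $HH_0(B):=B/[B,B]$. $\mathcal{D}_{U^n}$ is the ring of polynomial differential operators on the vector space $U^n$ (a Weyl algebra), with the Bernstein filtration in which linear coordinates $x_i$ and derivatives $\partial_i$ all have degree $1$; $\mathrm{gr}\,\mathcal{D}_{U^n}\cong\mathcal{O}_{V^n}$ as Poisson algebras (bracket of degree $-2$), so $\mathcal{D}_{U^n}^{S_{n+1}}$ is a filtered quantization of $\mathcal{O}_{V^n}^{S_{n+1}}$. $HH_0$ inherits the filtration, and the natural surjection is induced by $\mathcal{O}_{V^n}^{S_{n+1}}=\mathrm{gr}\,\mathcal{D}_{U^n}^{S_{n+1}}\twoheadrightarrow\mathrm{gr}\,HH_0(\mathcal{D}_{U^n}^{S_{n+1}})$. *)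

theory Defs
  imports
    "HOL-Analysis.Analysis"
    "HOL-Library.Function_Algebras"
    "HOL-Algebra.AbelCoset"
    "HOL-Algebra.Module"
begin

text \<open>
  Functions carry the pointwise operations of \<^theory>\<open>HOL-Library.Function_Algebras\<close>.  Functions
  on a subset \<open>X\<close> of a type are represented by their extension by \<open>0\<close>; likewise for operators on a
  subspace of functions.
\<close>

section \<open>Linear algebra over the complex numbers\<close>

definition complex_field :: "(complex, complex) module" where
  "complex_field = \<lparr>carrier = UNIV, mult = (*), one = 1, zero = 0, add = (+), smult = (*)\<rparr>"

definition module_iso ::
    "('r, 'c) ring_scheme \<Rightarrow> ('r, 'a, 'm) module_scheme \<Rightarrow> ('r, 'b, 'n) module_scheme
      \<Rightarrow> ('a \<Rightarrow> 'b) \<Rightarrow> bool" where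
  "module_iso R M N \<phi> \<longleftrightarrow>
     bij_betw \<phi> (carrier M) (carrier N) \<and>
     (\<forall>x\<in>carrier M. \<forall>y\<in>carrier M. \<phi> (x \<oplus>\<^bsub>M\<^esub> y) = \<phi> x \<oplus>\<^bsub>N\<^esub> \<phi> y) \<and>
     (\<forall>c\<in>carrier R. \<forall>x\<in>carrier M. \<phi> (c \<odot>\<^bsub>M\<^esub> x) = c \<odot>\<^bsub>N\<^esub> \<phi> x)"

definition lin_span :: "(complex, 'a, 'm) module_scheme \<Rightarrow> 'a set \<Rightarrow> 'a set" where
  "lin_span M S = (\<lambda>N. submodule N complex_field M) hull S"

text \<open>The quotient of \<open>M\<close> by a submodule \<open>N\<close>; the ring multiplication is not meaningful here.\<close>

definition quot_module :: "('r, 'a, 'm) module_scheme \<Rightarrow> 'a set \<Rightarrow> ('r, 'a set) module" where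
  "quot_module M N =
     \<lparr>carrier = a_rcosets\<^bsub>M\<^esub> N, mult = undefined, one = undefined,
      zero = N, add = (<+>\<^bsub>M\<^esub>), smult = (\<lambda>c X. \<Union>x\<in>X. N +>\<^bsub>M\<^esub> (c \<odot>\<^bsub>M\<^esub> x))\<rparr>"

text \<open>Associated graded module \<open>\<Oplus>\<^sub>k F\<^sub>k / F\<^sub>k\<^sub>-\<^sub>1\<close> of an increasing filtration, with \<open>F\<^sub>-\<^sub>1 = 0\<close>.\<close>

definition filt_below :: "('r, 'a, 'm) module_scheme \<Rightarrow> (nat \<Rightarrow> 'a set) \<Rightarrow> nat \<Rightarrow> 'a set" where
  "filt_below M F k = (case k of 0 \<Rightarrow> {\<zero>\<^bsub>M\<^esub>} | Suc j \<Rightarrow> F j)"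

definition gr_piece ::
    "('r, 'a, 'm) module_scheme \<Rightarrow> (nat \<Rightarrow> 'a set) \<Rightarrow> nat \<Rightarrow> ('r, 'a set) module" where
  "gr_piece M F k = quot_module (M\<lparr>carrier := F k\<rparr>) (filt_below M F k)"

definition gr_module ::
    "('r, 'a, 'm) module_scheme \<Rightarrow> (nat \<Rightarrow> 'a set) \<Rightarrow> ('r, nat \<Rightarrow> 'a set) module" where
  "gr_module M F =
     \<lparr>carrier = {g. (\<forall>k. g k \<in> carrier (gr_piece M F k)) \<and>
                     finite {k. g k \<noteq> \<zero>\<^bsub>gr_piece M F k\<^esub>}},
      mult = undefined, one = undefined,
      zero = (\<lambda>k. \<zero>\<^bsub>gr_piece M F k\<^esub>),
      add = (\<lambda>g h k. g k \<oplus>\<^bsub>gr_piece M F k\<^esub> h k),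
      smult = (\<lambda>c g k. c \<odot>\<^bsub>gr_piece M F k\<^esub> g k)\<rparr>"


section \<open>Zeroth Poisson and Hochschild homology\<close>

record 'a poisson_algebra = "(complex, 'a) module" +
  bracket :: "'a \<Rightarrow> 'a \<Rightarrow> 'a"

definition poisson_commutators :: "('a, 'm) poisson_algebra_scheme \<Rightarrow> 'a set" where
  "poisson_commutators A =
     lin_span A {bracket A f g | f g. f \<in> carrier A \<and> g \<in> carrier A}"

definition HP0 :: "('a, 'm) poisson_algebra_scheme \<Rightarrow> (complex, 'a set) module" where
  "HP0 A = quot_module A (poisson_commutators A)"

definition commutators :: "(complex, 'a, 'm) module_scheme \<Rightarrow> 'a set" where
  "commutators B =
     lin_span B {(a \<otimes>\<^bsub>B\<^esub> b) \<ominus>\<^bsub>B\<^esub> (b \<otimes>\<^bsub>B\<^esub> a) | a b. a \<in> carrier B \<and> b \<in> carrier B}"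

definition HH0 :: "(complex, 'a, 'm) module_scheme \<Rightarrow> (complex, 'a set) module" where
  "HH0 B = quot_module B (commutators B)"

definition HH0_class :: "(complex, 'a, 'm) module_scheme \<Rightarrow> 'a \<Rightarrow> 'a set" where
  "HH0_class B a = commutators B +>\<^bsub>B\<^esub> a"

definition HH0_filt ::
    "(complex, 'a, 'm) module_scheme \<Rightarrow> (nat \<Rightarrow> 'a set) \<Rightarrow> nat \<Rightarrow> 'a set set" where
  "HH0_filt B F k = HH0_class B ` F k"

definition gr_HH0 ::
    "(complex, 'a, 'm) module_scheme \<Rightarrow> (nat \<Rightarrow> 'a set) \<Rightarrow> (complex, nat \<Rightarrow> 'a set set) module" where
  "gr_HH0 B F = gr_module (HH0 B) (HH0_filt B F)"

definition gr_HH0_class ::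
    "(complex, 'a, 'm) module_scheme \<Rightarrow> (nat \<Rightarrow> 'a set) \<Rightarrow> nat \<Rightarrow> 'a \<Rightarrow> 'a set set" where
  "gr_HH0_class B F k a =
     filt_below (HH0 B) (HH0_filt B F) k +>\<^bsub>HH0 B\<^esub> HH0_class B a"

text \<open>
  Let \<open>(B, F)\<close> be a filtered quantization of a graded Poisson algebra \<open>A\<close>, where \<open>component k f\<close> is the
  degree \<open>k\<close> component of \<open>f \<in> A\<close> and \<open>symb k a f\<close> says that \<open>f \<in> A\<^sub>k\<close> corresponds to
  the class of \<open>a \<in> F\<^sub>k\<close> under \<open>A\<^sub>k \<cong> F\<^sub>k / F\<^sub>k\<^sub>-\<^sub>1\<close>.  The canonical map \<open>HP\<^sub>0(A) \<rightarrow> gr HH\<^sub>0(B)\<close>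
  sends the class of \<open>f\<close> to the family, indexed by \<open>k\<close>, of the classes in \<open>gr\<^sub>k HH\<^sub>0(B)\<close> of any
  \<open>a\<close> with symbol \<open>component k f\<close>.
\<close>

definition quantization_map ::
    "(complex, 'b, 'm) module_scheme \<Rightarrow> (nat \<Rightarrow> 'b set) \<Rightarrow> (nat \<Rightarrow> 'a \<Rightarrow> 'a)
      \<Rightarrow> (nat \<Rightarrow> 'b \<Rightarrow> 'a \<Rightarrow> bool) \<Rightarrow> 'a set \<Rightarrow> nat \<Rightarrow> 'b set set" where
  "quantization_map B F component symb = (\<lambda>X k.
     THE Y. \<exists>f\<in>X. \<exists>a\<in>F k. symb k a (component k f) \<and> Y = gr_HH0_class B F k a)"


section \<open>Polynomial functions and the Poisson bracket\<close>

text \<open>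
  Throughout, \<open>s\<close> is the scalar multiplication of a complex vector space of type \<open>'x\<close> and
  \<open>X\<close> a finite-dimensional subspace.
\<close>

definition lin_funs :: "(complex \<Rightarrow> 'x \<Rightarrow> 'x) \<Rightarrow> 'x::ab_group_add set \<Rightarrow> ('x \<Rightarrow> complex) set" where
  "lin_funs s X = {l. (\<forall>x\<in>X. \<forall>y\<in>X. l (x + y) = l x + l y) \<and>
                      (\<forall>c. \<forall>x\<in>X. l (s c x) = c * l x) \<and> (\<forall>x. x \<notin> X \<longrightarrow> l x = 0)}"

definition const_fun :: "'x set \<Rightarrow> complex \<Rightarrow> 'x \<Rightarrow> complex" where
  "const_fun X c = (\<lambda>x. if x \<in> X then c else 0)"

inductive_set poly_funs :: "(complex \<Rightarrow> 'x \<Rightarrow> 'x) \<Rightarrow> 'x::ab_group_add set \<Rightarrow> ('x \<Rightarrow> complex) set"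
  for s X where
  const: "const_fun X c \<in> poly_funs s X"
| lin: "l \<in> lin_funs s X \<Longrightarrow> l \<in> poly_funs s X"
| add: "f \<in> poly_funs s X \<Longrightarrow> g \<in> poly_funs s X \<Longrightarrow> f + g \<in> poly_funs s X"
| mult: "f \<in> poly_funs s X \<Longrightarrow> g \<in> poly_funs s X \<Longrightarrow> f * g \<in> poly_funs s X"

definition dir_deriv ::
    "(complex \<Rightarrow> 'x \<Rightarrow> 'x) \<Rightarrow> 'x::ab_group_add set \<Rightarrow> 'x \<Rightarrow> ('x \<Rightarrow> complex) \<Rightarrow> 'x \<Rightarrow> complex" where
  "dir_deriv s X u f = (\<lambda>x. if x \<in> X then deriv (\<lambda>t. f (x + s t u)) 0 else 0)"

text \<open>The homogeneous component of degree \<open>k\<close>: the coefficient of \<open>t\<^sup>k\<close> in \<open>f (t x)\<close>.\<close>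

definition homog_part ::
    "(complex \<Rightarrow> 'x \<Rightarrow> 'x) \<Rightarrow> 'x set \<Rightarrow> nat \<Rightarrow> ('x \<Rightarrow> complex) \<Rightarrow> 'x \<Rightarrow> complex" where
  "homog_part s X k f = (\<lambda>x. if x \<in> X then (deriv ^^ k) (\<lambda>t. f (s t x)) 0 / fact k else 0)"

text \<open>
  For a symplectic form \<open>\<Omega>\<close> on \<open>X\<close>, let \<open>v\<^sub>f(x) \<in> X\<close> be the vector with
  \<open>df\<^sub>x = \<Omega>(v\<^sub>f(x), -)\<close>.  Then \<open>{f, g} = \<Omega>(v\<^sub>f, v\<^sub>g)\<close>; in particular
  \<open>{\<Omega>(v, -), \<Omega>(w, -)} = \<Omega>(v, w)\<close>.
\<close>

definition ham_vec ::
    "(complex \<Rightarrow> 'x \<Rightarrow> 'x) \<Rightarrow> 'x::ab_group_add set \<Rightarrow> ('x \<Rightarrow> 'x \<Rightarrow> complex)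
      \<Rightarrow> ('x \<Rightarrow> complex) \<Rightarrow> 'x \<Rightarrow> 'x" where
  "ham_vec s X \<Omega> f x = (THE v. v \<in> X \<and> (\<forall>w\<in>X. dir_deriv s X w f x = \<Omega> v w))"

definition poisson_bracket ::
    "(complex \<Rightarrow> 'x \<Rightarrow> 'x) \<Rightarrow> 'x::ab_group_add set \<Rightarrow> ('x \<Rightarrow> 'x \<Rightarrow> complex)
      \<Rightarrow> ('x \<Rightarrow> complex) \<Rightarrow> ('x \<Rightarrow> complex) \<Rightarrow> 'x \<Rightarrow> complex" where
  "poisson_bracket s X \<Omega> f g =
     (\<lambda>x. if x \<in> X then \<Omega> (ham_vec s X \<Omega> f x) (ham_vec s X \<Omega> g x) else 0)"

definition poly_algebra ::
    "(complex \<Rightarrow> 'x \<Rightarrow> 'x) \<Rightarrow> 'x::ab_group_add set \<Rightarrow> ('x \<Rightarrow> 'x \<Rightarrow> complex)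
      \<Rightarrow> ('x \<Rightarrow> complex) poisson_algebra" where
  "poly_algebra s X \<Omega> =
     \<lparr>carrier = poly_funs s X, mult = (*), one = const_fun X 1, zero = 0, add = (+),
      smult = (\<lambda>c f x. c * f x), bracket = poisson_bracket s X \<Omega>\<rparr>"


section \<open>Polynomial differential operators\<close>

type_synonym 'x fun_op = "('x \<Rightarrow> complex) \<Rightarrow> ('x \<Rightarrow> complex)"

definition mult_op ::
    "(complex \<Rightarrow> 'x \<Rightarrow> 'x) \<Rightarrow> 'x::ab_group_add set \<Rightarrow> ('x \<Rightarrow> complex) \<Rightarrow> 'x fun_op" where
  "mult_op s X l = (\<lambda>f. if f \<in> poly_funs s X then l * f else 0)"

definition deriv_op :: "(complex \<Rightarrow> 'x \<Rightarrow> 'x) \<Rightarrow> 'x::ab_group_add set \<Rightarrow> 'x \<Rightarrow> 'x fun_op" where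
  "deriv_op s X u = (\<lambda>f. if f \<in> poly_funs s X then dir_deriv s X u f else 0)"

definition op_algebra ::
    "(complex \<Rightarrow> 'x \<Rightarrow> 'x) \<Rightarrow> 'x::ab_group_add set \<Rightarrow> (complex, 'x fun_op) module" where
  "op_algebra s X =
     \<lparr>carrier = UNIV, mult = (\<circ>), one = mult_op s X (const_fun X 1), zero = 0, add = (+),
      smult = (\<lambda>c a f x. c * a f x)\<rparr>"

definition weyl_gens :: "(complex \<Rightarrow> 'x \<Rightarrow> 'x) \<Rightarrow> 'x::ab_group_add set \<Rightarrow> 'x fun_op set" where
  "weyl_gens s X = mult_op s X ` lin_funs s X \<union> deriv_op s X ` X"

text \<open>Bernstein filtration: \<open>F\<^sub>k\<close> is spanned by the products of at most \<open>k\<close> generators.\<close>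

definition bernstein ::
    "(complex \<Rightarrow> 'x \<Rightarrow> 'x) \<Rightarrow> 'x::ab_group_add set \<Rightarrow> nat \<Rightarrow> 'x fun_op set" where
  "bernstein s X k = lin_span (op_algebra s X)
     {foldr (\<circ>) gs (one (op_algebra s X)) | gs. set gs \<subseteq> weyl_gens s X \<and> length gs \<le> k}"

definition weyl_algebra ::
    "(complex \<Rightarrow> 'x \<Rightarrow> 'x) \<Rightarrow> 'x::ab_group_add set \<Rightarrow> (complex, 'x fun_op) module" where
  "weyl_algebra s X = (op_algebra s X)\<lparr>carrier := \<Union>k. bernstein s X k\<rparr>"

text \<open>
  The identification of \<open>gr D(Y)\<close> with the polynomial functions on a symplectic space \<open>(X, \<Omega>)\<close>
  in which \<open>Y\<close> is Lagrangian, given the projection \<open>\<pi> : X \<rightarrow> Y\<close> along a Lagrangian complement of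
  \<open>Y\<close>.  It is the algebra isomorphism with \<open>l \<mapsto> l \<circ> \<pi>\<close> for \<open>l \<in> Y\<^sup>*\<close> and
  \<open>\<partial>\<^sub>u \<mapsto> \<Omega>(-, u)\<close> for \<open>u \<in> Y\<close>.  It is Poisson, since \<open>{\<Omega>(-, u), l \<circ> \<pi>} = l(u) = [\<partial>\<^sub>u, l]\<close>.
  The predicate \<open>has_symbol s X \<Omega> Y \<pi> k\<close> is the graph of the symbol map from \<open>F\<^sub>k\<close>, with
  kernel \<open>F\<^sub>k\<^sub>-\<^sub>1\<close>, to the homogeneous polynomials of degree \<open>k\<close>.
\<close>

inductive has_symbol ::
    "(complex \<Rightarrow> 'x \<Rightarrow> 'x) \<Rightarrow> 'x::ab_group_add set \<Rightarrow> ('x \<Rightarrow> 'x \<Rightarrow> complex) \<Rightarrow> 'x set \<Rightarrow> ('x \<Rightarrow> 'x)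
      \<Rightarrow> nat \<Rightarrow> 'x fun_op \<Rightarrow> ('x \<Rightarrow> complex) \<Rightarrow> bool"
  for s X \<Omega> Y \<pi> where
  scalar: "has_symbol s X \<Omega> Y \<pi> 0 (mult_op s Y (const_fun Y c)) (const_fun X c)"
| add: "has_symbol s X \<Omega> Y \<pi> k a f \<Longrightarrow> has_symbol s X \<Omega> Y \<pi> k b g \<Longrightarrow>
    has_symbol s X \<Omega> Y \<pi> k (a + b) (f + g)"
| lin: "l \<in> lin_funs s Y \<Longrightarrow> has_symbol s X \<Omega> Y \<pi> k a f \<Longrightarrow>
    has_symbol s X \<Omega> Y \<pi> (Suc k) (mult_op s Y l \<circ> a) ((\<lambda>x. if x \<in> X then l (\<pi> x) else 0) * f)"
| deriv: "u \<in> Y \<Longrightarrow> has_symbol s X \<Omega> Y \<pi> k a f \<Longrightarrow>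
    has_symbol s X \<Omega> Y \<pi> (Suc k) (deriv_op s Y u \<circ> a) ((\<lambda>x. if x \<in> X then \<Omega> x u else 0) * f)"
| lower: "a \<in> bernstein s Y k \<Longrightarrow> has_symbol s X \<Omega> Y \<pi> (Suc k) a 0"


section \<open>Symplectic vector spaces and Lagrangian subspaces\<close>

definition symplectic_space ::
    "(complex \<Rightarrow> 'v \<Rightarrow> 'v) \<Rightarrow> ('v::ab_group_add \<Rightarrow> 'v \<Rightarrow> complex) \<Rightarrow> bool" where
  "symplectic_space s \<omega> \<longleftrightarrow>
     (\<exists>B. finite_dimensional_vector_space s B) \<and>
     (\<forall>v. Vector_Spaces.linear s (*) (\<lambda>w. \<omega> v w)) \<and>
     (\<forall>w. Vector_Spaces.linear s (*) (\<lambda>v. \<omega> v w)) \<and>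
     (\<forall>v. \<omega> v v = 0) \<and>
     (\<forall>v. (\<forall>w. \<omega> v w = 0) \<longrightarrow> v = 0)"

definition lagrangian ::
    "(complex \<Rightarrow> 'v \<Rightarrow> 'v) \<Rightarrow> ('v::ab_group_add \<Rightarrow> 'v \<Rightarrow> complex) \<Rightarrow> 'v set \<Rightarrow> bool" where
  "lagrangian s \<omega> U \<longleftrightarrow> Modules.module.subspace s U \<and> {v. \<forall>u\<in>U. \<omega> v u = 0} = U"

definition lagrangian_complement ::
    "(complex \<Rightarrow> 'v \<Rightarrow> 'v) \<Rightarrow> ('v::ab_group_add \<Rightarrow> 'v \<Rightarrow> complex) \<Rightarrow> 'v set \<Rightarrow> 'v set \<Rightarrow> bool" where
  "lagrangian_complement s \<omega> U W \<longleftrightarrow>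
     lagrangian s \<omega> W \<and> U \<inter> W = {0} \<and> (\<forall>v. \<exists>u\<in>U. \<exists>w\<in>W. v = u + w)"

text \<open>Every Lagrangian subspace has a Lagrangian complement.\<close>

lemma lagrangian_complement_exists:
  assumes "symplectic_space s \<omega>" and "lagrangian s \<omega> U"
  shows "\<exists>W. lagrangian_complement s \<omega> U W"
proof -
  from assms(1) obtain B where B: "finite_dimensional_vector_space s B"
    unfolding symplectic_space_def by blast
  interpret finite_dimensional_vector_space s B by (rule B)
  have lr: "Vector_Spaces.linear s (*) (\<lambda>w. \<omega> v w)" for v
    using assms(1) by (auto simp: symplectic_space_def)
  have ll: "Vector_Spaces.linear s (*) (\<lambda>v. \<omega> v w)" for w
    using assms(1) by (auto simp: symplectic_space_def)
  interpret C: vector_space_pair s "(*) :: complex \<Rightarrow> complex \<Rightarrow> complex"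
    using lr by (metis Vector_Spaces.linear_def vector_space_pair.intro)
  have vs_C: "vector_space ((*) :: complex \<Rightarrow> complex \<Rightarrow> complex)"
    using lr by (metis Vector_Spaces.linear_def)
  interpret P: vector_space_pair s s ..
  have lin_r: "\<omega> v (x + y) = \<omega> v x + \<omega> v y" "\<omega> v (x - y) = \<omega> v x - \<omega> v y"
      "\<omega> v (s c x) = c * \<omega> v x" "\<omega> v 0 = 0" for v x y c
    using C.linear_add[OF lr[of v]] C.linear_diff[OF lr[of v]] C.linear_scale[OF lr[of v]]
      C.linear_0[OF lr[of v]] by blast+
  have lin_l: "\<omega> (x + y) v = \<omega> x v + \<omega> y v" "\<omega> (x - y) v = \<omega> x v - \<omega> y v"
      "\<omega> (s c x) v = c * \<omega> x v" "\<omega> 0 v = 0" for v x y c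
    using C.linear_add[OF ll[of v]] C.linear_diff[OF ll[of v]] C.linear_scale[OF ll[of v]]
      C.linear_0[OF ll[of v]] by blast+
  have alt: "\<omega> v v = 0" for v using assms(1) by (auto simp: symplectic_space_def)
  have nondeg: "v = 0" if "\<And>w. \<omega> v w = 0" for v
    using assms(1) that by (auto simp: symplectic_space_def)
  have anti: "\<omega> v w = - \<omega> w v" for v w
    using alt[of "v + w", unfolded lin_r lin_l] by (simp add: alt eq_neg_iff_add_eq_0 add.commute)
  have U: "subspace U" and Uperp: "{v. \<forall>u\<in>U. \<omega> v u = 0} = U"
    using assms(2) by (auto simp: lagrangian_def)
  have uniq: "v = v'" if "\<And>w. \<omega> v w = \<omega> v' w" for v v'
    using nondeg[of "v - v'"] that by (simp add: lin_l)
  have riesz: "\<exists>v. \<forall>w. \<omega> v w = l w" if l: "Vector_Spaces.linear s (*) l" for l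
  proof -
    define T where "T v = (\<Sum>b\<in>B. s (\<omega> v b) b)" for v
    have eqB: "\<omega> v w = l' w" if "Vector_Spaces.linear s (*) l'" "\<And>b. b \<in> B \<Longrightarrow> \<omega> v b = l' b" for v w l'
      using C.linear_eq_on_span[OF lr that(1), of B] that(2) span_Basis by auto
    have coeff: "\<forall>b\<in>B. c b = d b" if "(\<Sum>b\<in>B. s (c b) b) = (\<Sum>b\<in>B. s (d b) b)" for c d
    proof -
      have "(\<Sum>b\<in>B. s (c b - d b) b) = 0"
        using that by (simp add: scale_left_diff_distrib sum_subtractf)
      then show ?thesis
        using independentD[OF independent_Basis finite_Basis subset_refl, of "\<lambda>b. c b - d b"]
        by auto
    qed
    have lT: "Vector_Spaces.linear s s T"
      by (simp add: Vector_Spaces.linear_iff vector_space_axioms T_def lin_l scale_left_distrib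
          sum.distrib scale_sum_right)
    have "inj T"
    proof (rule injI)
      fix v v' assume "T v = T v'"
      then have "\<forall>b\<in>B. \<omega> v b = \<omega> v' b"
        using coeff[of "\<omega> v" "\<omega> v'"] by (simp add: T_def)
      then show "v = v'" using eqB[OF lr[of v']] uniq by blast
    qed
    then have "surj T" using linear_inj_imp_surj[OF lT] by blast
    then obtain v where "T v = (\<Sum>b\<in>B. s (l b) b)" by (metis surjD)
    then have "\<forall>b\<in>B. \<omega> v b = l b" using coeff[of "\<omega> v" l] by (simp add: T_def)
    then show ?thesis using eqB[OF l] by blast
  qed
  obtain p where p: "range p \<subseteq> U" "Vector_Spaces.linear s s p" "\<forall>v\<in>U. p v = v"
    using P.linear_exists_left_inverse_on[OF linear_ident U] by auto
  define q where "q x = x - p x" for x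
  have q_add: "q (x + y) = q x + q y" and q_scale: "q (s c x) = s c (q x)" for x y c
    by (simp_all add: q_def P.linear_add[OF p(2)] P.linear_scale[OF p(2)] scale_right_diff_distrib)
  have qU: "q u = 0" if "u \<in> U" for u using p(3) that by (simp add: q_def)
  have qq: "q (q x) = q x" for x
    using p(1,3) by (simp add: q_def P.linear_diff[OF p(2)] range_subsetD)
  have "\<exists>t. \<forall>x. \<omega> t x = - (1/2) * \<omega> (q w) (q x)" for w
    by (rule riesz) (simp add: Vector_Spaces.linear_iff vector_space_axioms vs_C
        q_add q_scale lin_r algebra_simps)
  then have "\<forall>w. \<exists>t. \<forall>x. \<omega> t x = - (1/2) * \<omega> (q w) (q x)" by blast
  from choice[OF this] obtain T where T: "\<And>w x. \<omega> (T w) x = - (1/2) * \<omega> (q w) (q x)"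
    by blast
  have TU: "T w \<in> U" for w
  proof -
    have "\<forall>u\<in>U. \<omega> (T w) u = 0" by (simp add: T qU lin_r)
    then show ?thesis using Uperp by blast
  qed
  have T_add: "T (x + y) = T x + T y" and T_scale: "T (s c x) = s c (T x)" for x y c
    by (rule uniq, simp add: T lin_l q_add q_scale algebra_simps)+
  define g where "g w = q w + T w" for w
  have lg: "Vector_Spaces.linear s s g"
    by (simp add: Vector_Spaces.linear_iff vector_space_axioms g_def q_add q_scale T_add T_scale
        scale_right_distrib algebra_simps)
  have UU: "\<omega> u u' = 0" if "u \<in> U" "u' \<in> U" for u u' using Uperp that by blast
  have iso: "\<omega> (g w) (g w') = 0" for w w'
  proof -
    have "\<omega> (T w) (q w') = - (1/2) * \<omega> (q w) (q w')" by (simp add: T qq)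
    moreover have "\<omega> (q w) (T w') = - (1/2) * \<omega> (q w) (q w')"
      using anti[of "q w" "T w'"] anti[of "q w" "q w'"] by (simp add: T qq)
    ultimately show ?thesis by (simp add: g_def lin_r lin_l UU TU)
  qed
  have decomp: "v - g v \<in> U" for v
    using subspace_diff[OF U, of "p v" "T v"] p(1) TU by (auto simp: g_def q_def diff_diff_eq2)
  have W: "subspace (range g)"
    using P.linear_subspace_image[OF lg subspace_UNIV] .
  have "{v. \<forall>w\<in>range g. \<omega> v w = 0} = range g"
  proof (intro equalityI subsetI)
    fix v assume v: "v \<in> {v. \<forall>w\<in>range g. \<omega> v w = 0}"
    have "\<omega> (v - g v) x = 0" for x
    proof -
      have "\<omega> (v - g v) x = \<omega> (v - g v) (x - g x) + \<omega> (v - g v) (g x)"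
        by (simp add: lin_r)
      then show ?thesis using UU[OF decomp decomp] v iso by (simp add: lin_l)
    qed
    then have "v = g v" using nondeg[of "v - g v"] by simp
    then show "v \<in> range g" by (metis rangeI)
  qed (use iso in auto)
  then have "lagrangian s \<omega> (range g)" using W by (simp add: lagrangian_def)
  moreover have "U \<inter> range g = {0}"
  proof -
    have "g w = 0" if "g w \<in> U" for w
    proof -
      have "q w \<in> U" using subspace_diff[OF U that TU[of w]] by (simp add: g_def)
      then have "q w = 0" using qU qq by metis
      moreover from this have "T w = 0" using nondeg T lin_l by simp
      ultimately show ?thesis by (simp add: g_def)
    qed
    then show ?thesis using subspace_0[OF U] subspace_0[OF W] by auto
  qed
  moreover have "\<forall>v. \<exists>u\<in>U. \<exists>w\<in>range g. v = u + w"
    using decomp by (metis diff_add_cancel rangeI)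
  ultimately show ?thesis unfolding lagrangian_complement_def by blast
qed

definition proj_along :: "'v::ab_group_add set \<Rightarrow> 'v set \<Rightarrow> 'v \<Rightarrow> 'v" where
  "proj_along U W v = (THE u. u \<in> U \<and> v - u \<in> W)"


section \<open>The reflection representation of \<open>S\<^sub>n\<^sub>+\<^sub>1\<close>\<close>

text \<open>
  The reflection representation is \<open>{c \<in> \<complex>\<^sup>n\<^sup>+\<^sup>1. c\<^sub>0 + \<dots> + c\<^sub>n = 0}\<close>, so its tensor product with a vector
  space \<open>V\<close> is the space of \<open>(v\<^sub>0, \<dots>, v\<^sub>n) \<in> V\<^sup>n\<^sup>+\<^sup>1\<close> with sum \<open>0\<close>, which is isomorphic to \<open>V\<^sup>n\<close>.
  Tuples are sequences that vanish beyond \<open>n\<close>.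
\<close>

definition refl_tensor :: "nat \<Rightarrow> 'v::ab_group_add set \<Rightarrow> (nat \<Rightarrow> 'v) set" where
  "refl_tensor n V = {v. (\<forall>i\<le>n. v i \<in> V) \<and> (\<forall>i>n. v i = 0) \<and> (\<Sum>i\<le>n. v i) = 0}"

definition tuple_scale :: "(complex \<Rightarrow> 'v \<Rightarrow> 'v) \<Rightarrow> complex \<Rightarrow> (nat \<Rightarrow> 'v) \<Rightarrow> nat \<Rightarrow> 'v" where
  "tuple_scale s c v = (\<lambda>i. s c (v i))"

definition tuple_form ::
    "nat \<Rightarrow> ('v \<Rightarrow> 'v \<Rightarrow> complex) \<Rightarrow> (nat \<Rightarrow> 'v) \<Rightarrow> (nat \<Rightarrow> 'v) \<Rightarrow> complex" where
  "tuple_form n \<omega> v w = (\<Sum>i\<le>n. \<omega> (v i) (w i))"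

text \<open>
  A permutation \<open>p\<close> of \<open>{0, \<dots>, n}\<close> acts by \<open>v \<mapsto> v \<circ> p\<^sup>-\<^sup>1\<close> on tuples, hence by
  \<open>f \<mapsto> (v \<mapsto> f (v \<circ> p))\<close> on functions and by conjugation on operators.
\<close>

definition perm_fun :: "(nat \<Rightarrow> nat) \<Rightarrow> ((nat \<Rightarrow> 'v) \<Rightarrow> complex) \<Rightarrow> (nat \<Rightarrow> 'v) \<Rightarrow> complex" where
  "perm_fun p f = (\<lambda>v. f (v \<circ> p))"

definition perm_op :: "(nat \<Rightarrow> nat) \<Rightarrow> (nat \<Rightarrow> 'v) fun_op \<Rightarrow> (nat \<Rightarrow> 'v) fun_op" where
  "perm_op p a = (\<lambda>f. perm_fun p (a (perm_fun (inv_into UNIV p) f)))"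

definition invariants :: "nat \<Rightarrow> ((nat \<Rightarrow> nat) \<Rightarrow> 'a \<Rightarrow> 'a) \<Rightarrow> 'a set \<Rightarrow> 'a set" where
  "invariants n act A = {a \<in> A. \<forall>p. p permutes {..n} \<longrightarrow> act p a = a}"

text \<open>The Poisson algebra of invariant polynomial functions on \<open>V\<^sup>n\<close>, where \<open>V\<close> is the whole type.\<close>

definition inv_poly ::
    "(complex \<Rightarrow> 'v \<Rightarrow> 'v) \<Rightarrow> ('v::ab_group_add \<Rightarrow> 'v \<Rightarrow> complex) \<Rightarrow> nat
      \<Rightarrow> ((nat \<Rightarrow> 'v) \<Rightarrow> complex) poisson_algebra" where
  "inv_poly s \<omega> n =
    (let A = poly_algebra (tuple_scale s) (refl_tensor n UNIV) (tuple_form n \<omega>)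
     in A\<lparr>carrier := invariants n perm_fun (carrier A)\<rparr>)"

definition inv_weyl ::
    "(complex \<Rightarrow> 'v \<Rightarrow> 'v) \<Rightarrow> 'v::ab_group_add set \<Rightarrow> nat \<Rightarrow> (complex, (nat \<Rightarrow> 'v) fun_op) module" where
  "inv_weyl s U n =
    (let D = weyl_algebra (tuple_scale s) (refl_tensor n U)
     in D\<lparr>carrier := invariants n perm_op (carrier D)\<rparr>)"

definition inv_bernstein ::
    "(complex \<Rightarrow> 'v \<Rightarrow> 'v) \<Rightarrow> 'v::ab_group_add set \<Rightarrow> nat \<Rightarrow> nat \<Rightarrow> (nat \<Rightarrow> 'v) fun_op set" where
  "inv_bernstein s U n k = invariants n perm_op (bernstein (tuple_scale s) (refl_tensor n U) k)"

text \<open>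
  The natural map \<open>HP\<^sub>0(\<O>(V\<^sup>n)\<^sup>S) \<rightarrow> gr HH\<^sub>0(D(U\<^sup>n)\<^sup>S)\<close> with \<open>S = S\<^sub>n\<^sub>+\<^sub>1\<close>.  The identification of
  \<open>\<O>(V\<^sup>n)\<close> with \<open>gr D(U\<^sup>n) = \<O>(U\<^sup>n \<oplus> (U\<^sup>n)\<^sup>*)\<close> depends on a Lagrangian complement \<open>W\<close> of \<open>U\<close>.
\<close>

definition natural_map ::
    "(complex \<Rightarrow> 'v \<Rightarrow> 'v) \<Rightarrow> ('v::ab_group_add \<Rightarrow> 'v \<Rightarrow> complex) \<Rightarrow> 'v set \<Rightarrow> 'v set \<Rightarrow> nat
      \<Rightarrow> ((nat \<Rightarrow> 'v) \<Rightarrow> complex) set \<Rightarrow> nat \<Rightarrow> (nat \<Rightarrow> 'v) fun_op set set" where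
  "natural_map s \<omega> U W n =
     quantization_map (inv_weyl s U n) (inv_bernstein s U n)
       (homog_part (tuple_scale s) (refl_tensor n UNIV))
       (has_symbol (tuple_scale s) (refl_tensor n UNIV) (tuple_form n \<omega>)
          (refl_tensor n U) (\<lambda>v i. proj_along U W (v i)))"

end

theory Submission
  imports Defs "HOL-Library.Multiset" "HOL-Combinatorics.Permutations"
    "HOL-Computational_Algebra.Polynomial_FPS"
begin

text \<open>
  Polynomial functions with the Poisson bracket and the Weyl algebra with the commutator are treated
  together as a filtered algebra generated by \<open>w u i = x u i - x u 0\<close>, whose bracket is a derivation in
  each argument. Brackets with the invariant power sums \<open>\<Sum>i. (x u i) ^ p\<close>, together with the coinvariant
  relations, reduce every word of positive length to shorter ones, so by averaging every invariant is a
  scalar modulo brackets of invariants.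

  It remains that \<open>1\<close> is not in the span of these brackets. In the Poisson case brackets of invariants
  vanish at the origin, because there are no nonzero invariant linear functions. In the Weyl case let
  \<open>g\<close> be the \<open>(n+1)\<close>-cycle, which has no eigenvalue \<open>1\<close>. The series \<open>\<Sum>k. t ^ k * tr (g a)\<close>, with the trace
  taken on polynomials of degree \<open>k\<close>, is rational in \<open>t\<close> and regular at \<open>t = 1\<close>. Its value \<open>T a\<close> at \<open>1\<close>
  satisfies \<open>T (b c) = T (c (g b))\<close>, so it vanishes on commutators of invariants, but \<open>T 1 \<noteq> 0\<close>.
\<close>

text \<open>The bound by one dimension uses of the bracket only that it is a derivation in each
  argument and lowers the filtration, so identities are needed merely up to shorter words and both
  cases share one argument. The letters are \<open>w u i\<close> rather than \<open>x u i\<close>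
  because the latter add up to zero, whereas for \<open>i \<ge> 1\<close> the bracket of
  \<open>x u i\<close> with \<open>w v j\<close> is \<open>\<omega> u v\<close> if
  \<open>i = j\<close> and zero otherwise: a bracket with a power sum then contracts letters slot by
  slot, as for \<open>n\<close> independent copies of \<open>V\<close>. Passing from powers of
  \<open>x u i\<close> to powers of \<open>w u i\<close> puts factors \<open>x u 0\<close> into the
  other argument, which is therefore not invariant; this is why brackets with arbitrary elements and
  coinvariant relations are allowed until the final averaging.

  For nonzero \<open>V\<close> no ordinary trace can detect \<open>1\<close> in the Weyl algebra,
  where it is a commutator \<open>[\<partial>, x]\<close>; accordingly the untwisted series has a
  pole at \<open>t = 1\<close>. The twist removes the pole since \<open>g\<close> fixes no
  direction, while \<open>g\<close> acts trivially on invariants, so that on these the twisted trace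
  is again an ordinary one.\<close>

section \<open>Filtered algebras on a carrier set\<close>

locale carrier_algebra = vector_space sc
  for sc :: "complex \<Rightarrow> 'b::ab_group_add \<Rightarrow> 'b" +
  fixes L :: "'b set" and mul :: "'b \<Rightarrow> 'b \<Rightarrow> 'b" (infixl "\<star>" 70) and unit :: 'b
  assumes subspace_L: "subspace L"
    and mul_L [simp]: "a \<in> L \<Longrightarrow> b \<in> L \<Longrightarrow> a \<star> b \<in> L"
    and unit_L [simp]: "unit \<in> L"
    and mul_add_left: "a \<in> L \<Longrightarrow> b \<in> L \<Longrightarrow> c \<in> L \<Longrightarrow> (a + b) \<star> c = a \<star> c + b \<star> c"
    and mul_add_right: "a \<in> L \<Longrightarrow> b \<in> L \<Longrightarrow> c \<in> L \<Longrightarrow> c \<star> (a + b) = c \<star> a + c \<star> b"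
    and mul_scale_left: "a \<in> L \<Longrightarrow> b \<in> L \<Longrightarrow> sc k a \<star> b = sc k (a \<star> b)"
    and mul_scale_right: "a \<in> L \<Longrightarrow> b \<in> L \<Longrightarrow> a \<star> sc k b = sc k (a \<star> b)"
    and mul_assoc: "a \<in> L \<Longrightarrow> b \<in> L \<Longrightarrow> c \<in> L \<Longrightarrow> a \<star> b \<star> c = a \<star> (b \<star> c)"
    and unit_left [simp]: "a \<in> L \<Longrightarrow> unit \<star> a = a"
    and unit_right [simp]: "a \<in> L \<Longrightarrow> a \<star> unit = a"
begin

lemma L_closed [simp]:
  "0 \<in> L" "a \<in> L \<Longrightarrow> b \<in> L \<Longrightarrow> a + b \<in> L" "a \<in> L \<Longrightarrow> sc k a \<in> L"
  "a \<in> L \<Longrightarrow> b \<in> L \<Longrightarrow> a - b \<in> L" "a \<in> L \<Longrightarrow> - a \<in> L"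
  using subspace_L by (auto simp: subspace_0 subspace_add subspace_scale subspace_diff subspace_neg)

lemma L_sum [simp]: "(\<And>i. i \<in> A \<Longrightarrow> f i \<in> L) \<Longrightarrow> sum f A \<in> L"
  by (rule subspace_sum[OF subspace_L])

lemma mul_zero [simp]: "a \<in> L \<Longrightarrow> 0 \<star> a = 0" "a \<in> L \<Longrightarrow> a \<star> 0 = 0"
  using mul_scale_left[of 0 a 0] mul_scale_right[of a 0 0] by auto

lemma mul_minus [simp]:
  "a \<in> L \<Longrightarrow> b \<in> L \<Longrightarrow> (- a) \<star> b = - (a \<star> b)" "a \<in> L \<Longrightarrow> b \<in> L \<Longrightarrow> a \<star> (- b) = - (a \<star> b)"
  using mul_scale_left[of a b "-1"] mul_scale_right[of a b "-1"] by auto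

lemma mul_diff_left: "a \<in> L \<Longrightarrow> b \<in> L \<Longrightarrow> c \<in> L \<Longrightarrow> (a - b) \<star> c = a \<star> c - b \<star> c"
  using mul_add_left[of a "- b" c] by simp

lemma mul_diff_right: "a \<in> L \<Longrightarrow> b \<in> L \<Longrightarrow> c \<in> L \<Longrightarrow> c \<star> (a - b) = c \<star> a - c \<star> b"
  using mul_add_right[of a "- b" c] by simp

definition word :: "'b list \<Rightarrow> 'b" where
  "word gs = foldr (\<star>) gs unit"

definition word_filt :: "'b set \<Rightarrow> nat \<Rightarrow> 'b set" where
  "word_filt G k = span (word ` {gs. set gs \<subseteq> G \<and> length gs \<le> k})"

lemma word_simps [simp]: "word [] = unit" "word (g # gs) = g \<star> word gs"
  by (simp_all add: word_def)

lemma word_L [simp]: "set gs \<subseteq> L \<Longrightarrow> word gs \<in> L"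
  by (induction gs) auto

lemma word_append: "set gs \<subseteq> L \<Longrightarrow> set hs \<subseteq> L \<Longrightarrow> word (gs @ hs) = word gs \<star> word hs"
  by (induction gs) (auto simp: mul_assoc)

lemma subspace_word_filt [simp]: "subspace (word_filt G k)"
  by (simp add: word_filt_def)

lemma word_in_filt: "set gs \<subseteq> G \<Longrightarrow> length gs \<le> k \<Longrightarrow> word gs \<in> word_filt G k"
  unfolding word_filt_def by (rule span_base) auto

lemma unit_in_filt [simp]: "unit \<in> word_filt G k"
  using word_in_filt[of "[]" G k] by simp

lemma word_filt_induct [consumes 1, case_names subspace word]:
  assumes "a \<in> word_filt G k" "subspace {a. P a}"
    "\<And>gs. set gs \<subseteq> G \<Longrightarrow> length gs \<le> k \<Longrightarrow> P (word gs)"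
  shows "P a"
  using assms(1) unfolding word_filt_def
  by (rule span_induct) (use assms(2,3) in auto)

lemma word_filt_L: "G \<subseteq> L \<Longrightarrow> word_filt G k \<subseteq> L"
  unfolding word_filt_def by (rule span_minimal) (use subspace_L in \<open>auto simp: subset_iff\<close>)

lemma word_filt_mono: "j \<le> k \<Longrightarrow> word_filt G j \<subseteq> word_filt G k"
  unfolding word_filt_def by (rule span_mono) auto

lemma subspace_mul_left:
  assumes "subspace A" "a \<in> L" shows "subspace {b. b \<in> L \<and> a \<star> b \<in> A}"
  using assms by (auto simp: subspace_def mul_add_right mul_scale_right)

lemma subspace_mul_right:
  assumes "subspace A" "a \<in> L" shows "subspace {b. b \<in> L \<and> b \<star> a \<in> A}"
  using assms by (auto simp: subspace_def mul_add_left mul_scale_left)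

lemma word_filt_L_induct [consumes 2, case_names subspace word]:
  assumes "a \<in> word_filt G k" "G \<subseteq> L" "subspace {a. a \<in> L \<and> P a}"
    "\<And>gs. set gs \<subseteq> G \<Longrightarrow> length gs \<le> k \<Longrightarrow> P (word gs)"
  shows "P a"
proof -
  have "a \<in> L \<and> P a"
    using assms(1) by (induction rule: word_filt_induct) (use assms(2-4) in auto)
  then show ?thesis by simp
qed

lemma word_filt_mul:
  assumes "G \<subseteq> L" "a \<in> word_filt G i" "b \<in> word_filt G j"
  shows "a \<star> b \<in> word_filt G (i + j)"
  using assms(2,1)
proof (induction rule: word_filt_L_induct)
  case subspace
  show ?case by (rule subspace_mul_right) (use assms word_filt_L in auto)
next
  case (word gs)
  show ?case using assms(3,1)
  proof (induction rule: word_filt_L_induct)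
    case subspace
    show ?case by (rule subspace_mul_left) (use assms word in auto)
  next
    case hs: (word hs)
    then have "word gs \<star> word hs = word (gs @ hs)"
      using word assms by (subst word_append) auto
    then show ?case using word hs by (auto intro!: word_in_filt)
  qed
qed

lemma gen_in_filt: "G \<subseteq> L \<Longrightarrow> g \<in> span G \<Longrightarrow> g \<in> word_filt G 1"
proof -
  assume G: "G \<subseteq> L"
  have "G \<subseteq> word_filt G 1"
  proof
    fix g assume "g \<in> G"
    then show "g \<in> word_filt G 1" using word_in_filt[of "[g]" G 1] G by auto
  qed
  then have "span G \<subseteq> word_filt G 1" by (rule span_minimal) simp
  then show "g \<in> span G \<Longrightarrow> g \<in> word_filt G 1" by blast
qed

text \<open>Lets generators be exchanged for linear combinations: images of \<open>W\<close> under
  permutations, the Weyl generators and the eigencoordinates of the cyclic permutation all enter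
  this way.\<close>

lemma word_filt_gens:
  assumes G: "G \<subseteq> L" and H: "H \<subseteq> span G"
  shows "word_filt H k \<subseteq> word_filt G k"
proof -
  have "word gs \<in> word_filt G (length gs)" if "set gs \<subseteq> H" for gs
    using that
  proof (induction gs)
    case (Cons g gs)
    then have "g \<star> word gs \<in> word_filt G (1 + length gs)"
      using G H by (intro word_filt_mul gen_in_filt) auto
    then show ?case by simp
  qed simp
  then have "word ` {gs. set gs \<subseteq> H \<and> length gs \<le> k} \<subseteq> word_filt G k"
    using word_filt_mono by blast
  then show ?thesis unfolding word_filt_def[of H] by (rule span_minimal) simp
qed

lemma word_filt_0: "word_filt G 0 = range (\<lambda>c. sc c unit)"
proof -
  have "word ` {gs. set gs \<subseteq> G \<and> length gs \<le> 0} = {unit}" by auto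
  then show ?thesis by (simp add: word_filt_def span_singleton)
qed

lemma subspace_scale_cancel:
  assumes "subspace A" "sc k a \<in> A" "k \<noteq> 0" shows "a \<in> A"
proof -
  have "sc (inverse k) (sc k a) \<in> A" by (rule subspace_scale[OF assms(1,2)])
  then show ?thesis using assms(3) by simp
qed

text \<open>Takes the place of a Vandermonde determinant: for a polynomial \<open>p\<close> of
  degree \<open>d + 1\<close>, the polynomial \<open>p (2 t) - 2 ^ (d + 1) p (t)\<close> has degree
  at most \<open>d\<close>, and its coefficients are those of \<open>p\<close> times the nonzero
  numbers \<open>2 ^ m - 2 ^ (d + 1)\<close>.\<close>

lemma coeffs_in_subspace:
  assumes J: "subspace J" and "finite A"
    and "\<And>t. t \<notin> A \<Longrightarrow> (\<Sum>m\<le>d. sc (t ^ m) (v m)) \<in> J" and "m \<le> d"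
  shows "v m \<in> J"
  using assms(2-)
proof (induction d arbitrary: v A m)
  case 0
  obtain t where "t \<notin> A" using ex_new_if_finite[OF infinite_UNIV_char_0 0(1)] by blast
  then show ?case using 0(2)[of t] 0(3) by simp
next
  case (Suc d)
  \<comment> \<open>Values at \<open>t\<close> and at \<open>2 * t\<close> are compared, so both
    have to avoid \<open>A\<close>.\<close>
  define A' where "A' = A \<union> (\<lambda>t. 2 * t) -` A"
  have "inj (\<lambda>t::complex. 2 * t)" by (rule injI) simp
  then have A': "finite A'" using Suc.prems(1) by (simp add: A'_def finite_vimageI)
  define u where "u m = sc (2 ^ m - 2 ^ Suc d) (v m)" for m
  have "(\<Sum>m\<le>d. sc (t ^ m) (u m)) \<in> J" if "t \<notin> A'" for t
  proof -
    have "(\<Sum>m\<le>Suc d. sc ((2 * t) ^ m) (v m)) - sc (2 ^ Suc d) (\<Sum>m\<le>Suc d. sc (t ^ m) (v m)) \<in> J"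
      using that Suc.prems(2)[of t] Suc.prems(2)[of "2 * t"]
      by (intro subspace_diff[OF J] subspace_scale[OF J]) (auto simp: A'_def)
    also have "(\<Sum>m\<le>Suc d. sc ((2 * t) ^ m) (v m)) - sc (2 ^ Suc d) (\<Sum>m\<le>Suc d. sc (t ^ m) (v m))
        = (\<Sum>m\<le>Suc d. sc (t ^ m) (u m))"
      unfolding scale_sum_right sum_subtractf[symmetric] u_def
      by (rule sum.cong) (simp_all add: power_mult_distrib algebra_simps flip: scale_left_diff_distrib)
    also have "\<dots> = (\<Sum>m\<le>d. sc (t ^ m) (u m))" by (simp add: u_def)
    finally show ?thesis .
  qed
  then have u: "u m \<in> J" if "m \<le> d" for m using Suc.IH[OF A'] that by blast
  have low: "v m \<in> J" if "m \<le> d" for m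
  proof -
    have "(2::complex) ^ m \<noteq> 2 ^ Suc d"
    proof
      assume "(2::complex) ^ m = 2 ^ Suc d"
      then have "(2::nat) ^ m = 2 ^ Suc d" by (metis of_nat_eq_iff of_nat_numeral of_nat_power)
      then show False using that power_inject_exp[of "2::nat" m "Suc d"] by simp
    qed
    then have "v m = sc (inverse (2 ^ m - 2 ^ Suc d)) (u m)" by (simp add: u_def)
    then show ?thesis using u[OF that] subspace_scale[OF J] by simp
  qed
  \<comment> \<open>The top coefficient is what remains after subtracting the others;
    \<open>t\<close> is nonzero so that its power can be divided out.\<close>
  obtain t where t: "t \<notin> insert 0 A"
    using ex_new_if_finite[OF infinite_UNIV_char_0, of "insert 0 A"] Suc.prems(1) by auto
  have "(\<Sum>m\<le>Suc d. sc (t ^ m) (v m)) \<in> J" using t Suc.prems(2)[of t] by blast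
  moreover have "(\<Sum>m\<le>d. sc (t ^ m) (v m)) \<in> J"
    using low by (intro subspace_sum[OF J] subspace_scale[OF J]) auto
  ultimately have "(\<Sum>m\<le>Suc d. sc (t ^ m) (v m)) - (\<Sum>m\<le>d. sc (t ^ m) (v m)) \<in> J"
    by (rule subspace_diff[OF J])
  then have "sc (t ^ Suc d) (v (Suc d)) \<in> J" by simp
  then have "v (Suc d) \<in> J" by (rule subspace_scale_cancel[OF J]) (use t in auto)
  then show ?case using low Suc.prems(3) by (cases "m = Suc d") auto
qed

lemma subspace_congruent:
  assumes "subspace A" "a - b \<in> A" shows "a \<in> A \<longleftrightarrow> b \<in> A"
  using subspace_add[OF assms(1) assms(2), of b] subspace_diff[OF assms(1) _ assms(2), of a] by auto

lemma mul_sum_right: "(\<And>i. i \<in> A \<Longrightarrow> f i \<in> L) \<Longrightarrow> c \<in> L \<Longrightarrow> c \<star> sum f A = (\<Sum>i\<in>A. c \<star> f i)"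
  by (induction A rule: infinite_finite_induct) (auto simp: mul_add_right)

end

section \<open>Invariants modulo brackets\<close>

text \<open>
  A common model of \<open>\<O>(V\<^sup>n)\<close> with its Poisson bracket (\<open>\<epsilon> = 0\<close>) and of the Weyl algebra with the
  commutator (\<open>\<epsilon> = 1\<close>): \<open>x u i\<close> stands for the linear function \<open>v \<mapsto> \<omega> u (v i)\<close> on the tuples
  \<open>v\<close> with \<open>v 0 + \<dots> + v n = 0\<close>.
\<close>

locale biderivation_algebra = carrier_algebra sc L mul unit
  for sc :: "complex \<Rightarrow> 'b::ab_group_add \<Rightarrow> 'b" and L and mul (infixl "\<star>" 70) and unit +
  fixes \<epsilon> :: complex and br :: "'b \<Rightarrow> 'b \<Rightarrow> 'b" and n :: nat
    and s :: "complex \<Rightarrow> 'v::ab_group_add \<Rightarrow> 'v" and \<omega> :: "'v \<Rightarrow> 'v \<Rightarrow> complex"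
    and x :: "'v \<Rightarrow> nat \<Rightarrow> 'b" and act :: "(nat \<Rightarrow> nat) \<Rightarrow> 'b \<Rightarrow> 'b"
  assumes br_L [simp]: "a \<in> L \<Longrightarrow> b \<in> L \<Longrightarrow> br a b \<in> L"
    and br_antisym: "a \<in> L \<Longrightarrow> b \<in> L \<Longrightarrow> br a b = - br b a"
    and br_add_left: "a \<in> L \<Longrightarrow> b \<in> L \<Longrightarrow> c \<in> L \<Longrightarrow> br (a + b) c = br a c + br b c"
    and br_scale_left: "a \<in> L \<Longrightarrow> b \<in> L \<Longrightarrow> br (sc k a) b = sc k (br a b)"
    and br_mul_left: "a \<in> L \<Longrightarrow> b \<in> L \<Longrightarrow> c \<in> L \<Longrightarrow> br (a \<star> b) c = a \<star> br b c + br a c \<star> b"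
    and mul_commutator: "a \<in> L \<Longrightarrow> b \<in> L \<Longrightarrow> a \<star> b - b \<star> a = sc \<epsilon> (br a b)"
    and form_add: "\<omega> (u + v) w = \<omega> u w + \<omega> v w"
    and form_scale: "\<omega> (s k u) w = k * \<omega> u w"
    and form_alt: "\<omega> u u = 0"
    and form_nondeg: "u \<noteq> 0 \<Longrightarrow> \<exists>v. \<omega> v u \<noteq> 0"
    and x_L [simp]: "i \<le> n \<Longrightarrow> x u i \<in> L"
    and x_add: "i \<le> n \<Longrightarrow> x (u + v) i = x u i + x v i"
    and x_scale: "i \<le> n \<Longrightarrow> x (s k u) i = sc k (x u i)"
    and x_sum: "(\<Sum>i\<le>n. x u i) = 0"
    and br_x: "i \<le> n \<Longrightarrow> j \<le> n \<Longrightarrow>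
      br (x u i) (x v j) = sc (\<omega> u v * ((if i = j then 1 else 0) - 1 / of_nat (Suc n))) unit"
    and act_L [simp]: "p permutes {..n} \<Longrightarrow> a \<in> L \<Longrightarrow> act p a \<in> L"
    and act_add: "p permutes {..n} \<Longrightarrow> a \<in> L \<Longrightarrow> b \<in> L \<Longrightarrow> act p (a + b) = act p a + act p b"
    and act_scale: "p permutes {..n} \<Longrightarrow> a \<in> L \<Longrightarrow> act p (sc k a) = sc k (act p a)"
    and act_unit [simp]: "p permutes {..n} \<Longrightarrow> act p unit = unit"
    and act_mul: "p permutes {..n} \<Longrightarrow> a \<in> L \<Longrightarrow> b \<in> L \<Longrightarrow> act p (a \<star> b) = act p a \<star> act p b"
    and act_br: "p permutes {..n} \<Longrightarrow> a \<in> L \<Longrightarrow> b \<in> L \<Longrightarrow> act p (br a b) = br (act p a) (act p b)"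
    and act_comp: "p permutes {..n} \<Longrightarrow> q permutes {..n} \<Longrightarrow> a \<in> L \<Longrightarrow> act p (act q a) = act (p \<circ> q) a"
    and act_x: "p permutes {..n} \<Longrightarrow> i \<le> n \<Longrightarrow> act p (x u i) = x u (p i)"
begin

lemma br_add_right: "a \<in> L \<Longrightarrow> b \<in> L \<Longrightarrow> c \<in> L \<Longrightarrow> br c (a + b) = br c a + br c b"
  using br_add_left[of a b c] br_antisym[of c "a + b"] br_antisym[of c a] br_antisym[of c b] by simp

lemma br_scale_right: "a \<in> L \<Longrightarrow> b \<in> L \<Longrightarrow> br a (sc k b) = sc k (br a b)"
  using br_scale_left[of b a k] br_antisym[of a "sc k b"] br_antisym[of a b] by simp

lemma br_mul_right:
  "a \<in> L \<Longrightarrow> b \<in> L \<Longrightarrow> c \<in> L \<Longrightarrow> br c (a \<star> b) = a \<star> br c b + br c a \<star> b"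
  using br_mul_left[of a b c] br_antisym[of c "a \<star> b"] br_antisym[of c b] br_antisym[of c a] by simp

lemma br_unit [simp]: "a \<in> L \<Longrightarrow> br unit a = 0" "a \<in> L \<Longrightarrow> br a unit = 0"
  using br_mul_left[of unit unit a] br_mul_right[of unit unit a] by auto

lemma br_zero [simp]: "a \<in> L \<Longrightarrow> br 0 a = 0" "a \<in> L \<Longrightarrow> br a 0 = 0"
  using br_scale_left[of a a 0] br_scale_right[of a a 0] by auto

lemma br_minus [simp]: "a \<in> L \<Longrightarrow> b \<in> L \<Longrightarrow> br (- a) b = - br a b"
    "a \<in> L \<Longrightarrow> b \<in> L \<Longrightarrow> br a (- b) = - br a b"
  using br_scale_left[of a b "-1"] br_scale_right[of a b "-1"] by auto

lemma br_diff_left: "a \<in> L \<Longrightarrow> b \<in> L \<Longrightarrow> c \<in> L \<Longrightarrow> br (a - b) c = br a c - br b c"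
  using br_add_left[of a "-b" c] by simp

lemma br_diff_right: "a \<in> L \<Longrightarrow> b \<in> L \<Longrightarrow> c \<in> L \<Longrightarrow> br c (a - b) = br c a - br c b"
  using br_add_right[of a "-b" c] by simp

lemma br_sum_left: "(\<And>i. i \<in> A \<Longrightarrow> f i \<in> L) \<Longrightarrow> c \<in> L \<Longrightarrow> br (sum f A) c = (\<Sum>i\<in>A. br (f i) c)"
  by (induction A rule: infinite_finite_induct) (auto simp: br_add_left)

lemma br_sum_right: "(\<And>i. i \<in> A \<Longrightarrow> f i \<in> L) \<Longrightarrow> c \<in> L \<Longrightarrow> br c (sum f A) = (\<Sum>i\<in>A. br c (f i))"
  by (induction A rule: infinite_finite_induct) (auto simp: br_add_right)

lemma act_zero [simp]: "p permutes {..n} \<Longrightarrow> act p 0 = 0"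
  using act_scale[of p 0 0] by simp

lemma act_diff: "p permutes {..n} \<Longrightarrow> a \<in> L \<Longrightarrow> b \<in> L \<Longrightarrow> act p (a - b) = act p a - act p b"
  using act_add[of p a "sc (-1) b"] act_scale[of p b "-1"] by simp

lemma act_sum:
  "p permutes {..n} \<Longrightarrow> (\<And>i. i \<in> A \<Longrightarrow> f i \<in> L) \<Longrightarrow> act p (sum f A) = (\<Sum>i\<in>A. act p (f i))"
  by (induction A rule: infinite_finite_induct) (auto simp: act_add)

definition w :: "'v \<Rightarrow> nat \<Rightarrow> 'b" where "w u i = x u i - x u 0"

definition W :: "'b set" where "W = {w u i | u i. i \<in> {1..n}}"

abbreviation Fl :: "nat \<Rightarrow> 'b set" where "Fl \<equiv> word_filt W"

text \<open>The filtration shifted by one, with zero in degree \<open>-1\<close>, so that "up to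
  shorter words" has one meaning in all degrees.\<close>

definition Flow :: "nat \<Rightarrow> 'b set" where "Flow k = (case k of 0 \<Rightarrow> {0} | Suc j \<Rightarrow> Fl j)"

definition Bt :: "'b set" where "Bt = (\<Union>k. Fl k)"

lemma w_L [simp]: "i \<le> n \<Longrightarrow> w u i \<in> L"
  by (simp add: w_def)

lemma W_L: "W \<subseteq> L" by (auto simp: W_def)

lemma w_W: "i \<in> {1..n} \<Longrightarrow> w u i \<in> W" by (auto simp: W_def)

lemma Fl_L: "a \<in> Fl k \<Longrightarrow> a \<in> L" using word_filt_L[OF W_L] by blast

lemma Flow_simps [simp]: "Flow 0 = {0}" "Flow (Suc k) = Fl k" by (simp_all add: Flow_def)

lemma subspace_Flow [simp]: "subspace (Flow k)" by (cases k) auto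

lemma Flow_mono: "j \<le> k \<Longrightarrow> Flow j \<subseteq> Flow k"
  by (cases j; cases k) (auto simp: subspace_0 intro: word_filt_mono[THEN subsetD])

lemma Flow_Fl: "Flow k \<subseteq> Fl k"
  using word_filt_mono[of "k - 1" k W] by (cases k) (auto simp: subspace_0)

lemma mul_Fl_Flow: "a \<in> Fl i \<Longrightarrow> b \<in> Flow j \<Longrightarrow> a \<star> b \<in> Flow (i + j)"
  by (cases j) (auto simp: Fl_L subspace_0 intro: word_filt_mul[OF W_L])

lemma mul_Flow_Fl: "a \<in> Flow i \<Longrightarrow> b \<in> Fl j \<Longrightarrow> a \<star> b \<in> Flow (i + j)"
  by (cases i) (auto simp: Fl_L subspace_0 intro: word_filt_mul[OF W_L])

lemma subspace_br_left:
  assumes "subspace A" "a \<in> L" shows "subspace {b. b \<in> L \<and> br b a \<in> A}"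
  using assms by (auto simp: subspace_def br_add_left br_scale_left)

lemma subspace_br_right:
  assumes "subspace A" "a \<in> L" shows "subspace {b. b \<in> L \<and> br a b \<in> A}"
  using assms by (auto simp: subspace_def br_add_right br_scale_right)

text \<open>The constant \<open>1 / (n + 1)\<close>, due to projecting onto tuples of sum zero, is
  the same for \<open>x v j\<close> and \<open>x v 0\<close> and cancels. For \<open>i\<close> in
  \<open>{1..n}\<close> only letters of slot \<open>i\<close> are left.\<close>

lemma br_x_w:
  assumes "i \<le> n" "j \<le> n"
  shows "br (x u i) (w v j) =
    sc (\<omega> u v * ((if i = j then 1 else 0) - (if i = 0 then 1 else 0))) unit"
  using assms by (simp add: w_def br_diff_right br_x flip: scale_left_diff_distrib right_diff_distrib)

lemma br_w: "i \<le> n \<Longrightarrow> j \<le> n \<Longrightarrow> \<exists>c. br (w u i) (w v j) = sc c unit"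
  by (subst (1) w_def) (auto simp: br_diff_left br_x_w simp flip: scale_left_diff_distrib)

lemma br_gen_word:
  assumes "z \<in> W" "set gs \<subseteq> W"
  shows "br z (word gs) \<in> Flow (length gs)"
  using assms(2)
proof (induction gs)
  case Nil
  then show ?case using assms W_L by auto
next
  case (Cons g gs)
  from assms Cons.prems obtain u i v j where "z = w u i" "g = w v j" "i \<le> n" "j \<le> n"
    by (auto simp: W_def)
  then obtain c where c: "br z g = sc c unit" using br_w by metis
  have L: "z \<in> L" "g \<in> L" "word gs \<in> L" using assms Cons.prems W_L by auto
  have "g \<star> br z (word gs) \<in> Flow (1 + length gs)"
    using Cons assms W_L by (intro mul_Fl_Flow gen_in_filt span_base) auto
  moreover have "br z g \<star> word gs \<in> Flow (1 + length gs)"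
    using Cons.prems word_in_filt[of gs W] L
    by (simp add: c mul_scale_left subspace_scale)
  ultimately show ?case using L by (simp add: br_mul_right subspace_add)
qed

lemma br_span_Fl:
  assumes "z \<in> span W" "b \<in> Fl j" shows "br z b \<in> Flow j"
proof -
  have gen: "br z b \<in> Flow j" if "z \<in> W" for z
    using assms(2) W_L
  proof (induction rule: word_filt_L_induct)
    case subspace
    show ?case by (rule subspace_br_right) (use that W_L in auto)
  next
    case (word gs)
    then show ?case using br_gen_word[OF that, of gs] Flow_mono by blast
  qed
  have "z \<in> L \<and> br z b \<in> Flow j"
    using assms(1) by (rule span_induct) (use subspace_br_left assms(2) Fl_L gen W_L in auto)
  then show ?thesis by simp
qed

text \<open>Brackets of generators are scalars, so the true drop is two; a drop of one already makes
  products commute up to shorter words.\<close>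

lemma br_Fl:
  assumes "a \<in> Fl i" "b \<in> Fl j" shows "br a b \<in> Flow (i + j)"
  using assms(1) W_L
proof (induction rule: word_filt_L_induct)
  case subspace
  show ?case by (rule subspace_br_left) (use assms Fl_L in auto)
next
  case (word gs)
  have "br (word gs) b \<in> Flow (length gs + j)" using word(1)
  proof (induction gs)
    case Nil
    then show ?case using assms Fl_L by (simp add: subspace_0)
  next
    case (Cons g gs)
    then have L: "g \<in> L" "word gs \<in> L" "b \<in> L" using W_L Fl_L assms by auto
    have "g \<star> br (word gs) b \<in> Flow (1 + (length gs + j))"
      using Cons W_L by (intro mul_Fl_Flow gen_in_filt span_base) auto
    moreover have "br g b \<star> word gs \<in> Flow (j + length gs)"
      using Cons assms by (intro mul_Flow_Fl word_in_filt br_span_Fl span_base) auto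
    then have "br g b \<star> word gs \<in> Flow (1 + (length gs + j))"
      using Flow_mono[of "j + length gs" "1 + (length gs + j)"] by auto
    ultimately show ?case using L by (simp add: br_mul_left subspace_add)
  qed
  then show ?case using word(2) Flow_mono[of "length gs + j" "i + j"] by auto
qed

lemma mul_commute_Flow:
  assumes "a \<in> Fl i" "b \<in> Fl j" shows "a \<star> b - b \<star> a \<in> Flow (i + j)"
  using br_Fl[OF assms] assms by (simp add: mul_commutator Fl_L subspace_scale)

text \<open>Since the \<open>x u j\<close> add up to zero, summing \<open>x u 0 - x u j\<close> over
  all \<open>j\<close> gives \<open>n + 1\<close> times \<open>x u 0\<close>; hence
  \<open>x u 0\<close> is minus the mean of the \<open>w u j\<close>.\<close>

lemma x_span_W:
  assumes "i \<le> n" shows "x u i \<in> span W"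
proof -
  have "sc (of_nat (Suc n)) (x u 0) = (\<Sum>j\<le>n. x u 0 - x u j)"
    by (simp add: sum_subtractf x_sum sum_constant_scale)
  also have "\<dots> = (\<Sum>j\<in>{1..n}. x u 0 - x u j)"
    by (rule sum.mono_neutral_right) (auto simp: not_le)
  also have "\<dots> = (\<Sum>j\<in>{1..n}. - w u j)" by (simp add: w_def)
  also have "\<dots> \<in> span W" by (intro span_sum span_neg span_base w_W)
  finally have "sc (of_nat (Suc n)) (x u 0) \<in> span W" .
  then have x0: "x u 0 \<in> span W"
    by (rule subspace_scale_cancel[OF subspace_span]) (simp del: of_nat_Suc)
  show ?thesis
  proof (cases "i = 0")
    case False
    then have "w u i \<in> span W" using assms by (intro span_base w_W) auto
    then show ?thesis using x0 span_add[of "w u i" W "x u 0"] by (simp add: w_def)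
  qed (use x0 in simp)
qed

lemma w_span_W: "i \<le> n \<Longrightarrow> w u i \<in> span W"
  by (auto simp: w_def intro: span_diff x_span_W)

lemma x_Fl: "i \<le> n \<Longrightarrow> x u i \<in> Fl 1"
  using gen_in_filt[OF W_L x_span_W] .

lemma w_Fl: "i \<le> n \<Longrightarrow> w u i \<in> Fl 1"
  using gen_in_filt[OF W_L w_span_W] .

abbreviation pw :: "'b \<Rightarrow> nat \<Rightarrow> 'b" where "pw y m \<equiv> word (replicate m y)"

lemma pw_L [simp]: "y \<in> L \<Longrightarrow> pw y m \<in> L"
  by (rule word_L) (auto simp: in_set_replicate)

lemma pw_Fl: "y \<in> Fl 1 \<Longrightarrow> pw y m \<in> Fl m"
proof (induction m)
  case (Suc m)
  then show ?case using word_filt_mul[OF W_L, of y 1 "pw y m" m] by simp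
qed simp

lemma pw_Suc_right: "y \<in> L \<Longrightarrow> pw y m \<star> y = y \<star> pw y m"
  by (induction m) (auto simp: mul_assoc)

text \<open>The power rule. The Leibniz rule leaves factors \<open>br (x u i) G\<close> to the left
  of powers of \<open>x u i\<close>, and collecting them on the right costs only shorter
  words.\<close>

lemma br_pw:
  assumes "i \<le> n" "G \<in> Fl (Suc e)"
  shows "br (pw (x u i) (Suc p)) G - sc (of_nat (Suc p)) (pw (x u i) p \<star> br (x u i) G) \<in> Flow (p + e)"
proof (induction p)
  case 0
  have "br (x u i) G \<in> L" using assms by (simp add: Fl_L)
  then show ?case using assms by (simp add: subspace_0)
next
  case (Suc p)
  define y where "y = x u i"
  define z where "z = pw y (Suc p)"
  define D where "D = br y G"
  have D: "D \<in> Fl e" using br_span_Fl[OF x_span_W assms(2)] assms by (simp add: D_def y_def)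
  have L: "y \<in> L" "D \<in> L" "G \<in> L" "pw y p \<in> L" "z \<in> L"
    using assms Fl_L D by (auto simp: y_def z_def)
  have "br (pw y (Suc (Suc p))) G = y \<star> br z G + D \<star> z"
    using L by (simp add: z_def br_mul_left D_def)
  moreover have "z \<star> D = y \<star> (pw y p \<star> D)" using L by (simp add: z_def mul_assoc)
  moreover have "y \<star> (br z G - sc (of_nat (Suc p)) (pw y p \<star> D))
      = y \<star> br z G - sc (of_nat (Suc p)) (y \<star> (pw y p \<star> D))"
    using L by (simp add: mul_diff_right mul_scale_right del: of_nat_Suc)
  moreover have "sc (of_nat (Suc (Suc p))) (z \<star> D) = z \<star> D + sc (of_nat (Suc p)) (z \<star> D)"
    by (subst of_nat_Suc) (simp only: scale_left_distrib scale_one)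
  ultimately have "br (pw y (Suc (Suc p))) G - sc (of_nat (Suc (Suc p))) (z \<star> D)
     = y \<star> (br z G - sc (of_nat (Suc p)) (pw y p \<star> D)) + (D \<star> z - z \<star> D)"
    by (simp del: replicate_Suc word_simps of_nat_Suc)
  moreover have "y \<star> (br z G - sc (of_nat (Suc p)) (pw y p \<star> D)) \<in> Flow (1 + (p + e))"
    using Suc.IH x_Fl[OF assms(1)] unfolding z_def y_def D_def by (intro mul_Fl_Flow) auto
  moreover have "D \<star> z - z \<star> D \<in> Flow (e + Suc p)"
    unfolding z_def using D x_Fl[OF assms(1)] by (intro mul_commute_Flow pw_Fl) (auto simp: y_def)
  ultimately have "br (pw y (Suc (Suc p))) G - sc (of_nat (Suc (Suc p))) (z \<star> D) \<in> Flow (Suc p + e)"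
    by (simp add: subspace_add add.commute del: of_nat_Suc)
  then show ?case by (simp only: y_def z_def D_def)
qed

definition inv_elems :: "'b set" where
  "inv_elems = {a \<in> Bt. \<forall>p. p permutes {..n} \<longrightarrow> act p a = a}"

text \<open>\<open>G\<close> is arbitrary in \<open>Bt\<close> and the differences
  \<open>act p a - a\<close> are adjoined; \<open>symm\<close> later turns both into statements on
  invariants. With \<open>unit\<close> inside, the claim becomes that \<open>J\<close> contains
  every word.\<close>

definition J :: "'b set" where
  "J = span (insert unit ({br P G | P G. P \<in> inv_elems \<and> G \<in> Bt} \<union>
        {act p a - a | p a. p permutes {..n} \<and> a \<in> Bt}))"

lemma subspace_J [simp]: "subspace J" by (simp add: J_def)

lemma Fl_Bt: "a \<in> Fl k \<Longrightarrow> a \<in> Bt" by (auto simp: Bt_def)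

lemma act_word: "p permutes {..n} \<Longrightarrow> set gs \<subseteq> L \<Longrightarrow> act p (word gs) = word (map (act p) gs)"
  by (induction gs) (auto simp: act_mul)

lemma act_pw: "p permutes {..n} \<Longrightarrow> y \<in> L \<Longrightarrow> act p (pw y m) = pw (act p y) m"
  by (subst act_word) (auto simp: in_set_replicate)

lemma power_sum_inv: "(\<Sum>i\<le>n. pw (x u i) m) \<in> inv_elems"
proof -
  have "(\<Sum>i\<le>n. pw (x u i) m) \<in> Fl m"
    by (intro subspace_sum pw_Fl x_Fl) auto
  moreover have "act p (\<Sum>i\<le>n. pw (x u i) m) = (\<Sum>i\<le>n. pw (x u i) m)" if "p permutes {..n}" for p
  proof -
    have "act p (\<Sum>i\<le>n. pw (x u i) m) = (\<Sum>i\<le>n. pw (x u (p i)) m)"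
      by (subst act_sum[OF that]) (simp_all add: that act_pw act_x)
    also have "\<dots> = (\<Sum>i\<le>n. pw (x u i) m)"
      using sum.permute[OF that, of "\<lambda>i. pw (x u i) m"] by (simp add: comp_def)
    finally show ?thesis .
  qed
  ultimately show ?thesis by (auto simp: inv_elems_def Fl_Bt)
qed

lemma br_inv_J: "P \<in> inv_elems \<Longrightarrow> G \<in> Bt \<Longrightarrow> br P G \<in> J"
  unfolding J_def by (rule span_base) auto

lemma act_J: "p permutes {..n} \<Longrightarrow> a \<in> Bt \<Longrightarrow> act p a - a \<in> J"
  unfolding J_def by (rule span_base) auto

lemma x0_commutes_pw_w:
  assumes "i \<le> n" shows "x u 0 \<star> pw (w u i) q = pw (w u i) q \<star> x u 0"
proof -
  have "br (x u 0) (w u i) = 0" using assms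
    by (auto simp: w_def br_diff_right br_x form_alt)
  then have "br (x u 0) (pw (w u i) q) = 0"
    using assms by (induction q) (auto simp: br_mul_right)
  then show ?thesis using mul_commutator[of "x u 0" "pw (w u i) q"] assms by simp
qed

text \<open>
  The case \<open>q = 0\<close> is the bracket of \<open>G\<close> with an invariant power sum; the step replaces a factor \<open>w u i\<close>
  by \<open>x u i - x u 0\<close> and moves \<open>x u 0\<close>, which commutes with \<open>x u i\<close>, into \<open>G\<close>.
\<close>

lemma power_sum_bracket:
  assumes "Flow (p + q + e) \<subseteq> J" "G \<in> Fl (Suc e)"
  shows "(\<Sum>i\<le>n. pw (x u i) p \<star> (pw (w u i) q \<star> br (x u i) G)) \<in> J"
  using assms
proof (induction q arbitrary: p e G)
  case 0
  have G: "G \<in> L" using 0 Fl_L by auto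
  let ?P = "\<Sum>i\<le>n. pw (x u i) (Suc p)"
  let ?S = "\<Sum>i\<le>n. pw (x u i) p \<star> br (x u i) G"
  have "br ?P G - sc (of_nat (Suc p)) ?S =
     (\<Sum>i\<le>n. br (pw (x u i) (Suc p)) G - sc (of_nat (Suc p)) (pw (x u i) p \<star> br (x u i) G))"
    using G by (subst br_sum_left) (auto simp: sum_subtractf scale_sum_right simp del: of_nat_Suc)
  also have "\<dots> \<in> J"
    by (intro subspace_sum subspace_J) (use br_pw[OF _ 0(2)] 0(1) in auto)
  finally have "br ?P G - sc (of_nat (Suc p)) ?S \<in> J" .
  moreover have "br ?P G \<in> J" using Fl_Bt[OF 0(2)] by (rule br_inv_J[OF power_sum_inv])
  ultimately have "br ?P G - (br ?P G - sc (of_nat (Suc p)) ?S) \<in> J"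
    using subspace_diff[OF subspace_J] by blast
  then have "sc (of_nat (Suc p)) ?S \<in> J" by (simp only: diff_diff_eq2 add_diff_cancel_left')
  then have "?S \<in> J" by (rule subspace_scale_cancel[OF subspace_J]) (simp del: of_nat_Suc)
  then show ?case using G by simp
next
  case (Suc q)
  have G: "G \<in> L" using Suc Fl_L by auto
  have "pw (x u i) p \<star> (pw (w u i) (Suc q) \<star> br (x u i) G) =
      pw (x u i) (Suc p) \<star> (pw (w u i) q \<star> br (x u i) G) -
      pw (x u i) p \<star> (pw (w u i) q \<star> br (x u i) (x u 0 \<star> G))" if i: "i \<le> n" for i
  proof -
    have L: "x u i \<in> L" "x u 0 \<in> L" "pw (x u i) p \<in> L" "pw (w u i) q \<in> L" "br (x u i) G \<in> L"
      using i G by auto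
    have "br (x u i) (x u 0 \<star> G) = x u 0 \<star> br (x u i) G"
      using L G i by (simp add: br_mul_right br_x form_alt)
    moreover have "pw (w u i) (Suc q) = x u i \<star> pw (w u i) q - pw (w u i) q \<star> x u 0"
      using L i x0_commutes_pw_w[OF i, of u q] mul_diff_left[of "x u i" "x u 0" "pw (w u i) q"]
      by (simp flip: w_def)
    moreover have "pw (x u i) (Suc p) = pw (x u i) p \<star> x u i"
      using L by (simp add: pw_Suc_right)
    ultimately show ?thesis using L by (simp add: mul_diff_left mul_diff_right mul_assoc)
  qed
  then have "(\<Sum>i\<le>n. pw (x u i) p \<star> (pw (w u i) (Suc q) \<star> br (x u i) G)) =
      (\<Sum>i\<le>n. pw (x u i) (Suc p) \<star> (pw (w u i) q \<star> br (x u i) G)) -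
      (\<Sum>i\<le>n. pw (x u i) p \<star> (pw (w u i) q \<star> br (x u i) (x u 0 \<star> G)))"
    by (simp add: sum_subtractf[symmetric] del: replicate_Suc word_simps)
  \<comment> \<open>Both uses of the induction hypothesis keep \<open>p + q + e\<close>: the factor
    taken from \<open>q\<close> goes to \<open>p\<close> here and into \<open>G\<close>, hence to
    \<open>e\<close>, below.\<close>
  moreover have "(\<Sum>i\<le>n. pw (x u i) (Suc p) \<star> (pw (w u i) q \<star> br (x u i) G)) \<in> J"
    by (rule Suc.IH) (use Suc.prems in \<open>simp_all\<close>)
  moreover have "x u 0 \<star> G \<in> Fl (Suc (Suc e))"
    using word_filt_mul[OF W_L x_Fl[of 0] Suc.prems(2)] by simp
  then have "(\<Sum>i\<le>n. pw (x u i) p \<star> (pw (w u i) q \<star> br (x u i) (x u 0 \<star> G))) \<in> J"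
    by (rule Suc.IH[rotated]) (use Suc.prems in \<open>simp_all\<close>)
  ultimately show ?case by (simp only: subspace_diff[OF subspace_J])
qed

section \<open>Words in labelled letters and their contraction\<close>

text \<open>The label \<open>(u, i)\<close> is kept because the element \<open>w u i\<close> need
  not determine it, while rearranging, contracting and permuting all act on labels.\<close>

definition letter :: "'v \<times> nat \<Rightarrow> 'b" where "letter z = w (fst z) (snd z)"

abbreviation wd :: "('v \<times> nat) list \<Rightarrow> 'b" where "wd zs \<equiv> word (map letter zs)"

abbreviation good :: "('v \<times> nat) list \<Rightarrow> bool" where "good zs \<equiv> snd ` set zs \<subseteq> {1..n}"

lemma letter_W: "snd z \<in> {1..n} \<Longrightarrow> letter z \<in> W"
  by (simp add: letter_def w_W)

lemma good_W: "good zs \<Longrightarrow> set (map letter zs) \<subseteq> W"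
  using letter_W by auto

lemma wd_Fl: "good zs \<Longrightarrow> wd zs \<in> Fl (length zs)"
  using good_W by (intro word_in_filt) auto

lemma wd_L [simp]: "good zs \<Longrightarrow> wd zs \<in> L"
  using wd_Fl Fl_L by blast

lemma letter_L [simp]: "snd z \<in> {1..n} \<Longrightarrow> letter z \<in> L"
  using letter_W W_L by blast

lemma letter_Fl: "snd z \<in> {1..n} \<Longrightarrow> letter z \<in> Fl 1"
  using w_Fl[of "snd z"] by (simp add: letter_def)

lemma wd_append: "good zs \<Longrightarrow> good zs' \<Longrightarrow> wd (zs @ zs') = wd zs \<star> wd zs'"
  using good_W[of zs] good_W[of zs'] W_L by (simp add: word_append)

text \<open>A derivation whose values on letters are scalars deletes the letters of slot
  \<open>i\<close> one at a time. Nothing has to be commuted, so the formula is exact.\<close>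

lemma bracket_wd:
  assumes "i \<in> {1..n}" "good zs"
  shows "br (x u i) (wd zs) = (\<Sum>j<length zs. sc (if snd (zs ! j) = i then \<omega> u (fst (zs ! j)) else 0)
           (wd (take j zs @ drop (Suc j) zs)))"
  using assms(2)
proof (induction zs)
  case Nil
  then show ?case using assms by simp
next
  case (Cons z zs)
  have L: "x u i \<in> L" "letter z \<in> L" "wd zs \<in> L" using assms Cons.prems by auto
  have good: "good (take j zs @ drop (Suc j) zs)" for j
    using Cons.prems set_take_subset[of j zs] set_drop_subset[of "Suc j" zs] by auto
  have "br (x u i) (letter z) = sc (if snd z = i then \<omega> u (fst z) else 0) unit"
    using assms Cons.prems by (auto simp: letter_def br_x_w)
  then have "br (x u i) (wd (z # zs)) = letter z \<star> br (x u i) (wd zs) +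
      sc (if snd z = i then \<omega> u (fst z) else 0) (wd zs)"
    using L by (simp add: br_mul_right mul_scale_left)
  also have "letter z \<star> br (x u i) (wd zs) = (\<Sum>j<length zs.
     sc (if snd (zs ! j) = i then \<omega> u (fst (zs ! j)) else 0) (letter z \<star> wd (take j zs @ drop (Suc j) zs)))"
    using Cons L wd_L[OF good] by (simp add: mul_sum_right mul_scale_right del: map_append)
  finally show ?case by (simp add: sum.lessThan_Suc_shift add.commute del: sum.lessThan_Suc cong: if_cong)
qed

text \<open>The case \<open>p = 0\<close> of \<open>power_sum_bracket\<close> for
  \<open>G = wd zs\<close>, with brackets replaced by deletions. Slot \<open>0\<close>, where
  letters of all slots would be contracted, drops out because \<open>w u 0 = 0\<close> and
  \<open>1 \<le> r\<close>.\<close>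

lemma contraction_relation:
  assumes "1 \<le> r" "Flow (r + e) \<subseteq> J" "good zs" "length zs = Suc e"
  shows "(\<Sum>j<length zs. sc (\<omega> u (fst (zs ! j)))
     (wd (replicate r (u, snd (zs ! j)) @ take j zs @ drop (Suc j) zs))) \<in> J"
proof -
  have zL: "wd zs \<in> L" using assms(3) by simp
  have good: "good (take j zs @ drop (Suc j) zs)" for j
    using assms(3) set_take_subset[of j zs] set_drop_subset[of "Suc j" zs] by auto
  have "(\<Sum>i\<le>n. pw (w u i) r \<star> br (x u i) (wd zs)) \<in> J"
    using power_sum_bracket[of 0 r e "wd zs" u] assms wd_Fl[of zs] zL by simp
  also have "(\<Sum>i\<le>n. pw (w u i) r \<star> br (x u i) (wd zs)) =
      (\<Sum>i\<in>{1..n}. pw (w u i) r \<star> br (x u i) (wd zs))"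
  proof (rule sum.mono_neutral_right)
    have "pw (w u 0) r \<star> br (x u 0) (wd zs) = 0"
      using assms(1) zL by (cases r) (auto simp: w_def)
    then show "\<forall>i\<in>{..n} - {1..n}. pw (w u i) r \<star> br (x u i) (wd zs) = 0"
      by (auto simp: not_le)
  qed auto
  also have "\<dots> = (\<Sum>i\<in>{1..n}. \<Sum>j<length zs. if snd (zs ! j) = i then
      sc (\<omega> u (fst (zs ! j))) (wd (replicate r (u, i) @ take j zs @ drop (Suc j) zs)) else 0)"
  proof (rule sum.cong[OF refl])
    fix i assume i: "i \<in> {1..n}"
    have "wd (replicate r (u, i) @ zs') = pw (w u i) r \<star> wd zs'" if "good zs'" for zs'
      using that i by (subst wd_append) (auto simp: letter_def)
    then show "pw (w u i) r \<star> br (x u i) (wd zs) = (\<Sum>j<length zs. if snd (zs ! j) = i then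
      sc (\<omega> u (fst (zs ! j))) (wd (replicate r (u, i) @ take j zs @ drop (Suc j) zs)) else 0)"
      using i assms(3) good wd_L[OF good]
      by (subst bracket_wd) (auto simp: mul_sum_right mul_scale_right simp del: map_append intro!: sum.cong)
  qed
  also have "\<dots> = (\<Sum>j<length zs. \<Sum>i\<in>{1..n}. if snd (zs ! j) = i then
      sc (\<omega> u (fst (zs ! j))) (wd (replicate r (u, i) @ take j zs @ drop (Suc j) zs)) else 0)"
    by (rule sum.swap)
  also have "\<dots> = (\<Sum>j<length zs. sc (\<omega> u (fst (zs ! j)))
     (wd (replicate r (u, snd (zs ! j)) @ take j zs @ drop (Suc j) zs)))"
  proof (rule sum.cong[OF refl])
    fix j assume "j \<in> {..<length zs}"
    then have "snd (zs ! j) \<in> {1..n}" using assms(3) by (auto simp: image_subset_iff)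
    then show "(\<Sum>i\<in>{1..n}. if snd (zs ! j) = i then
      sc (\<omega> u (fst (zs ! j))) (wd (replicate r (u, i) @ take j zs @ drop (Suc j) zs)) else 0) =
      sc (\<omega> u (fst (zs ! j))) (wd (replicate r (u, snd (zs ! j)) @ take j zs @ drop (Suc j) zs))"
      by (subst sum.delta') auto
  qed
  finally show ?thesis .
qed

text \<open>The associated graded algebra is commutative. As soon as shorter words lie in
  \<open>J\<close>, a word may thus be treated as the multiset of its labels.\<close>

lemma wd_perm:
  "mset zs = mset zs' \<Longrightarrow> good zs \<Longrightarrow> wd zs - wd zs' \<in> Flow (length zs)"
proof (induction zs arbitrary: zs')
  case Nil
  then show ?case by simp
next
  case (Cons z zs)
  have "z \<in> set zs'" using Cons.prems(1) by (metis list.set_intros(1) mset_eq_setD)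
  then obtain as bs where zs': "zs' = as @ z # bs" by (meson split_list)
  then have m: "mset zs = mset (as @ bs)" using Cons.prems(1) by simp
  then have s: "set zs = set (as @ bs)" by (rule mset_eq_setD)
  have g: "snd z \<in> {1..n}" "good zs" "good as" "good bs" using Cons.prems(2) s by auto
  have L: "letter z \<in> L" "wd zs \<in> L" "wd as \<in> L" "wd bs \<in> L" using g by auto
  have "letter z \<star> (wd zs - wd (as @ bs)) \<in> Flow (1 + length zs)"
    using Cons.IH[OF m g(2)] letter_Fl[OF g(1)] by (intro mul_Fl_Flow)
  moreover have "(letter z \<star> wd as - wd as \<star> letter z) \<star> wd bs \<in> Flow (1 + length as + length bs)"
    using g by (intro mul_Flow_Fl mul_commute_Flow wd_Fl letter_Fl) auto
  moreover have "length zs = length as + length bs" using mset_eq_length[OF m] by simp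
  ultimately have "letter z \<star> (wd zs - wd (as @ bs)) +
      (letter z \<star> wd as - wd as \<star> letter z) \<star> wd bs \<in> Flow (length (z # zs))"
    by (simp add: subspace_add add.commute)
  also have "letter z \<star> (wd zs - wd (as @ bs)) +
      (letter z \<star> wd as - wd as \<star> letter z) \<star> wd bs = wd (z # zs) - wd zs'"
    using L g unfolding zs' by (simp add: wd_append mul_diff_left mul_diff_right mul_assoc del: map_append)
  finally show ?case .
qed

lemma wd_perm_J:
  assumes "mset zs = mset zs'" "good zs" "Flow (length zs) \<subseteq> J"
  shows "wd zs \<in> J \<longleftrightarrow> wd zs' \<in> J"
  using wd_perm[OF assms(1,2)] assms(3) by (intro subspace_congruent[OF subspace_J]) auto

lemma w_add: "i \<le> n \<Longrightarrow> w (u + v) i = w u i + w v i"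
  by (simp add: w_def x_add)

lemma w_scale: "i \<le> n \<Longrightarrow> w (s k u) i = sc k (w u i)"
  by (simp add: w_def x_scale scale_right_diff_distrib)

text \<open>The expansion of \<open>(u + t v) ^ r\<close> in slot \<open>i\<close>. As
  \<open>w u i\<close> and \<open>w v i\<close> need not commute, the coefficient of
  \<open>t\<close> is a sum of \<open>r\<close> words with the letter \<open>v\<close> in varying
  places, which agree up to shorter words; the higher coefficients only have to exist.\<close>

lemma wd_expand:
  assumes "i \<in> {1..n}" "good R"
  shows "\<exists>V. (\<forall>t. wd (replicate r (u + s t v, i) @ R) = (\<Sum>m\<le>r. sc (t ^ m) (V m))) \<and>
    V 0 = wd (replicate r (u, i) @ R) \<and> (\<forall>m. V m \<in> L) \<and> (\<forall>m>r. V m = 0) \<and>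
    V 1 - sc (of_nat r) (wd ((v, i) # replicate (r - 1) (u, i) @ R)) \<in> Flow (r + length R)"
proof (induction r)
  case 0
  show ?case using assms by (intro exI[of _ "\<lambda>m. if m = 0 then wd R else 0"]) (auto simp: subspace_0)
next
  case (Suc r)
  then obtain V where V: "\<And>t. wd (replicate r (u + s t v, i) @ R) = (\<Sum>m\<le>r. sc (t ^ m) (V m))"
    "V 0 = wd (replicate r (u, i) @ R)" "\<And>m. V m \<in> L" "\<And>m. m > r \<Longrightarrow> V m = 0"
    "V 1 - sc (of_nat r) (wd ((v, i) # replicate (r - 1) (u, i) @ R)) \<in> Flow (r + length R)"
    by blast
  have iL: "w y i \<in> L" for y using assms by simp
  define V' where "V' m = w u i \<star> V m + (if m = 0 then 0 else w v i \<star> V (m - 1))" for m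
  have "wd (replicate (Suc r) (u + s t v, i) @ R) = (\<Sum>m\<le>Suc r. sc (t ^ m) (V' m))" for t
  proof -
    have "wd (replicate (Suc r) (u + s t v, i) @ R) =
        (w u i + sc t (w v i)) \<star> (\<Sum>m\<le>r. sc (t ^ m) (V m))"
      using assms V(1)[of t] by (simp add: letter_def w_add w_scale)
    also have "\<dots> = w u i \<star> (\<Sum>m\<le>r. sc (t ^ m) (V m)) + sc t (w v i \<star> (\<Sum>m\<le>r. sc (t ^ m) (V m)))"
      using V(3) iL by (simp add: mul_add_left mul_scale_left)
    also have "w u i \<star> (\<Sum>m\<le>r. sc (t ^ m) (V m)) = (\<Sum>m\<le>Suc r. sc (t ^ m) (w u i \<star> V m))"
      using V(3,4) iL by (simp add: mul_sum_right mul_scale_right)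
    also have "sc t (w v i \<star> (\<Sum>m\<le>r. sc (t ^ m) (V m))) = (\<Sum>m\<le>r. sc (t ^ Suc m) (w v i \<star> V m))"
      using V(3) iL by (simp add: mul_sum_right mul_scale_right scale_sum_right)
    also have "\<dots> = (\<Sum>m\<le>Suc r. sc (t ^ m) (if m = 0 then 0 else w v i \<star> V (m - 1)))"
      by (subst sum.atMost_Suc_shift) simp
    finally show ?thesis by (simp add: V'_def scale_right_distrib sum.distrib del: sum.atMost_Suc)
  qed
  moreover have "V' 0 = wd (replicate (Suc r) (u, i) @ R)"
    using V(2) by (simp add: V'_def letter_def)
  moreover have "V' m \<in> L" for m using V(3) iL by (simp add: V'_def)
  moreover have "V' m = 0" if "m > Suc r" for m using that V(4) iL by (simp add: V'_def)
  moreover have "V' 1 - sc (of_nat (Suc r)) (wd ((v, i) # replicate (Suc r - 1) (u, i) @ R))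
      \<in> Flow (Suc r + length R)"
  proof -
    let ?A = "wd ((v, i) # replicate (r - 1) (u, i) @ R)"
    let ?B = "wd ((v, i) # replicate r (u, i) @ R)"
    have g: "good ((v, i) # replicate m (u, i) @ R)" for m using assms by (auto simp: in_set_replicate)
    have AL: "?A \<in> L" using wd_L[OF g[of "r - 1"]] .
    have "w u i \<star> (V 1 - sc (of_nat r) ?A) \<in> Flow (1 + (r + length R))"
      using V(5) assms by (intro mul_Fl_Flow w_Fl) auto
    \<comment> \<open>For \<open>r = 0\<close> the truncated \<open>r - 1\<close> leaves
      \<open>?A\<close> one letter too long, but the scalar is zero.\<close>
    moreover have "sc (of_nat r) (w u i \<star> ?A - ?B) \<in> Flow (1 + (r + length R))"
    proof (cases "r = 0")
      case True
      then show ?thesis by (simp add: subspace_0)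
    next
      case False
      then have "wd ((u, i) # (v, i) # replicate (r - 1) (u, i) @ R) - ?B
          \<in> Flow (length ((u, i) # (v, i) # replicate (r - 1) (u, i) @ R))"
        using assms by (intro wd_perm) (cases r, auto simp: in_set_replicate)
      then show ?thesis using False
        by (intro subspace_scale[OF subspace_Flow]) (simp add: letter_def)
    qed
    ultimately have "w u i \<star> (V 1 - sc (of_nat r) ?A) + sc (of_nat r) (w u i \<star> ?A - ?B)
        \<in> Flow (1 + (r + length R))" by (rule subspace_add[OF subspace_Flow])
    also have "w u i \<star> (V 1 - sc (of_nat r) ?A) + sc (of_nat r) (w u i \<star> ?A - ?B) =
       V' 1 - sc (of_nat (Suc r)) ?B"
      using V(2,3) iL AL by (simp add: V'_def mul_diff_right mul_scale_right scale_right_diff_distrib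
        scale_left_distrib letter_def)
    finally show ?thesis by simp
  qed
  ultimately show ?case by blast
qed

text \<open>Words with powers of \<open>u + t c\<close> lie in \<open>J\<close> for all but at most
  one \<open>t\<close>, hence so does the coefficient of \<open>t\<close>, which yields one letter
  \<open>c\<close>. As \<open>\<omega> u l \<noteq> 0\<close> only excludes a hyperplane, the
  letters \<open>bs\<close> obtained in this way are arbitrary.\<close>

lemma polarization:
  assumes i: "i \<in> {1..n}" and R: "good R" and J: "Flow (r + length R) \<subseteq> J"
    and pow: "\<And>u. \<omega> u l \<noteq> 0 \<Longrightarrow> wd (replicate r (u, i) @ R) \<in> J"
    and u: "\<omega> u l \<noteq> 0" and "r' + length bs = r"
  shows "wd (replicate r' (u, i) @ map (\<lambda>b. (b, i)) bs @ R) \<in> J"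
  using u assms(6)
proof (induction bs arbitrary: r' u)
  case Nil
  then show ?case using pow by simp
next
  case (Cons c bs)
  let ?R = "map (\<lambda>b. (b, i)) bs @ R"
  have gR: "good ?R" using i R by auto
  obtain V where V: "\<And>t. wd (replicate (Suc r') (u + s t c, i) @ ?R) = (\<Sum>m\<le>Suc r'. sc (t ^ m) (V m))"
    "V 1 - sc (of_nat (Suc r')) (wd ((c, i) # replicate r' (u, i) @ ?R)) \<in> Flow (Suc r' + length ?R)"
    using wd_expand[OF i gR, of "Suc r'" u c] by auto
  \<comment> \<open>If \<open>\<omega> c l = 0\<close>, the excluded value is \<open>0\<close> by
    the convention on division, and leaving out that \<open>t\<close> does no harm.\<close>
  have "(\<Sum>m\<le>Suc r'. sc (t ^ m) (V m)) \<in> J" if "t \<notin> {- \<omega> u l / \<omega> c l}" for t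
  proof -
    have "\<omega> (u + s t c) l \<noteq> 0"
    proof
      assume 0: "\<omega> (u + s t c) l = 0"
      then have "\<omega> c l \<noteq> 0" using Cons.prems(1) by (auto simp: form_add form_scale)
      then show False using 0 that by (auto simp: form_add form_scale field_simps add_eq_0_iff)
    qed
    then show ?thesis using Cons.IH[of "u + s t c" "Suc r'"] Cons.prems V(1)[of t] by simp
  qed
  then have "V 1 \<in> J"
    using coeffs_in_subspace[OF subspace_J, of "{- \<omega> u l / \<omega> c l}" V "Suc r'" 1] by auto
  moreover have "Flow (Suc r' + length ?R) \<subseteq> J" using J unfolding Cons.prems(2)[symmetric] by (simp add: add.assoc)
  ultimately have "sc (of_nat (Suc r')) (wd ((c, i) # replicate r' (u, i) @ ?R)) \<in> J"
    using V(2) subspace_congruent[OF subspace_J] by blast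
  then have "wd ((c, i) # replicate r' (u, i) @ ?R) \<in> J"
    by (rule subspace_scale_cancel[OF subspace_J]) (simp del: of_nat_Suc)
  then show ?case
  proof (subst wd_perm_J[where zs' = "(c, i) # replicate r' (u, i) @ ?R"])
    show "Flow (length (replicate r' (u, i) @ map (\<lambda>b. (b, i)) (c # bs) @ R)) \<subseteq> J"
      using J unfolding Cons.prems(2)[symmetric] by (simp add: add.assoc)
  qed (use i R in \<open>auto simp: in_set_replicate\<close>)
qed

text \<open>
  Fix \<open>l \<noteq> 0\<close>. After polarization a word carries in slot \<open>i0\<close> a power of some \<open>u\<close> with \<open>\<omega> u l \<noteq> 0\<close>. Adding a
  letter \<open>(l, i0)\<close> and contracting with powers of \<open>u\<close> gives a positive multiple of the word: contracting
  the single letter \<open>l\<close> of a slot \<open>i\<close> only interchanges \<open>i\<close> and \<open>i0\<close>, while any other contraction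
  moves the power to \<open>i\<close> and leaves just \<open>l\<close> in slot \<open>i0\<close>, so it has fewer slots in \<open>mixed\<close>.
\<close>

definition mixed :: "'v \<Rightarrow> ('v \<times> nat) multiset \<Rightarrow> nat \<Rightarrow> nat set" where
  "mixed l M i0 = {i \<in> {1..n} - {i0}. filter_mset (\<lambda>z. snd z = i) M \<noteq> {#(l, i)#}}"

lemma finite_mixed [simp]: "finite (mixed l M i0)" by (simp add: mixed_def)

lemma act_w: "p permutes {..n} \<Longrightarrow> p 0 = 0 \<Longrightarrow> i \<le> n \<Longrightarrow> act p (w u i) = w u (p i)"
  by (simp add: w_def act_diff act_x)

lemma act_wd:
  assumes "p permutes {..n}" "p 0 = 0" "good zs"
  shows "act p (wd zs) = wd (map (map_prod id p) zs)"
proof -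
  have "act p (wd zs) = word (map (act p) (map letter zs))"
    using assms good_W W_L by (intro act_word) blast+
  also have "map (act p) (map letter zs) = map letter (map (map_prod id p) zs)"
    using assms by (auto simp: letter_def act_w map_prod_def split_beta image_subset_iff)
  finally show ?thesis .
qed

text \<open>The transposition of \<open>i0\<close> and \<open>i\<close> fixes slot \<open>0\<close>
  and therefore maps letters to letters; modulo \<open>J\<close> an element and its image under a
  permutation agree.\<close>

lemma wd_swap_J:
  assumes i: "i \<in> {1..n}" "i0 \<in> {1..n}" "i \<noteq> i0" and M: "\<And>z. z \<in> set zs \<Longrightarrow> snd z \<noteq> i \<and> snd z \<noteq> i0"
    and good: "good zs"
    and m1: "mset z1 = replicate_mset r (u, i) + {#(l, i0)#} + mset zs"
    and m2: "mset z2 = replicate_mset r (u, i0) + {#(l, i)#} + mset zs"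
    and J: "Flow (length z2) \<subseteq> J"
  shows "wd z1 - wd z2 \<in> J"
proof -
  let ?p = "Transposition.transpose i0 i"
  have p: "?p permutes {..n}" using i by (intro permutes_swap_id) auto
  have p0: "?p 0 = 0" using i by (simp add: transpose_apply_other)
  have "set z1 \<subseteq> {(u, i), (l, i0)} \<union> set zs" "set z2 \<subseteq> {(u, i0), (l, i)} \<union> set zs"
    using arg_cong[OF m1, of set_mset] arg_cong[OF m2, of set_mset] by (auto split: if_splits)
  then have "snd ` set z1 \<subseteq> snd ` ({(u, i), (l, i0)} \<union> set zs)"
    "snd ` set z2 \<subseteq> snd ` ({(u, i0), (l, i)} \<union> set zs)" by (blast intro: image_mono)+
  moreover have "snd ` ({(u, i), (l, i0)} \<union> set zs) \<subseteq> {1..n}"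
    "snd ` ({(u, i0), (l, i)} \<union> set zs) \<subseteq> {1..n}" using good i by auto
  ultimately have good': "good z1" "good z2" by blast+
  have "map (map_prod id ?p) zs = zs"
    using M by (intro map_idI) (auto simp: map_prod_def split_beta transpose_apply_other)
  then have "image_mset (map_prod id ?p) (mset zs) = mset zs" by (metis mset_map)
  then have "mset (map (map_prod id ?p) z1) = mset z2"
    by (simp add: m1 m2 transpose_def)
  then have "mset z2 = mset (map (map_prod id ?p) z1)" by simp
  then have "wd z2 - act ?p (wd z1) \<in> J"
    using wd_perm[of z2 "map (map_prod id ?p) z1"] J good' p p0 by (auto simp: act_wd)
  moreover have "act ?p (wd z1) - wd z1 \<in> J"
    using wd_Fl[OF good'(1)] Fl_Bt by (intro act_J p) auto
  ultimately have "wd z2 - act ?p (wd z1) + (act ?p (wd z1) - wd z1) \<in> J"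
    by (rule subspace_add[OF subspace_J])
  then have "- (wd z2 - wd z1) \<in> J" by (intro subspace_neg[OF subspace_J]) simp
  then show ?thesis by simp
qed

lemma wd_in_J:
  assumes l: "\<omega> u0 l \<noteq> 0" and J: "Flow k \<subseteq> J"
  shows "good Z \<Longrightarrow> length Z = k \<Longrightarrow> i0 \<in> snd ` set Z \<Longrightarrow> wd Z \<in> J"
proof (induction "card (mixed l (mset Z) i0)" arbitrary: Z i0 rule: less_induct)
  case less
  define bs where "bs = map fst (filter (\<lambda>z. snd z = i0) Z)"
  define R where "R = filter (\<lambda>z. snd z \<noteq> i0) Z"
  define r where "r = length bs"
  have "filter (\<lambda>z. snd z = i0) Z \<noteq> []" using less.prems(3) by (auto simp: filter_empty_conv)
  then have r: "1 \<le> r" by (simp add: r_def bs_def Suc_le_eq)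
  have i0: "i0 \<in> {1..n}" using less.prems by auto
  have goodR: "good R" using less.prems(1) by (auto simp: R_def)
  have R_i0: "snd z \<noteq> i0" if "z \<in> set R" for z using that by (simp add: R_def)
  have "map (\<lambda>b. (b, i0)) bs = filter (\<lambda>z. snd z = i0) Z"
    by (auto simp: bs_def intro!: map_idI)
  then have mZ: "mset Z = mset (map (\<lambda>b. (b, i0)) bs @ R)"
    by (simp add: R_def)
  have len: "r + length R = k"
    using mset_eq_length[OF mZ] less.prems(2) by (simp add: r_def)
  have filter_Z: "filter_mset (\<lambda>z. snd z = i) (mset Z) = filter_mset (\<lambda>z. snd z = i) (mset R)"
    if "i \<noteq> i0" for i
    using that unfolding mZ by auto
  have powers: "wd (replicate r (u, i0) @ R) \<in> J" if u: "\<omega> u l \<noteq> 0" for u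
  proof -
    let ?Z = "replicate r (u, i0) @ R"
    let ?zs = "(l, i0) # R"
    let ?c = "\<lambda>j. \<omega> u (fst (?zs ! j))"
    let ?z1 = "\<lambda>j. replicate r (u, snd (?zs ! j)) @ take j ?zs @ drop (Suc j) ?zs"
    \<comment> \<open>Modulo \<open>J\<close>, every contraction is \<open>0\<close> or
      \<open>1\<close> times \<open>\<omega> u l\<close> times the word. Recording the multiplicity
      as a natural number rules out cancellation in the sum.\<close>
    have "\<exists>c::nat. sc (?c j) (wd (?z1 j)) - sc (of_nat c * \<omega> u l) (wd ?Z) \<in> J \<and> (j = 0 \<longrightarrow> c = 1)"
      if j: "j < length ?zs" for j
    proof (cases j)
      case 0
      \<comment> \<open>Contracting the added letter \<open>(l, i0)\<close> restores the word
        itself.\<close>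
      then show ?thesis by (intro exI[of _ 1]) (simp add: subspace_0)
    next
      case (Suc j')
      then have j': "j' < length R" using j by simp
      obtain b i where bi: "R ! j' = (b, i)" by fastforce
      have in_R: "(b, i) \<in> set R" using j' bi by (metis nth_mem)
      then have i: "i \<in> {1..n}" "i \<noteq> i0" using goodR R_i0[OF in_R] by auto
      define R' where "R' = take j' R @ drop (Suc j') R"
      have "R = take j' R @ (b, i) # drop (Suc j') R" using id_take_nth_drop[OF j'] bi by simp
      then have mR: "mset R = {#(b, i)#} + mset R'"
        unfolding R'_def by (metis add_mset_add_single mset.simps(2) mset_append union_commute union_mset_add_mset_right)
      then have sR': "set R' \<subseteq> set R" by (metis set_mset_mset set_mset_mono mset_subset_eq_add_right)
      then have R'_i0: "\<And>z. z \<in> set R' \<Longrightarrow> snd z \<noteq> i0" using R_i0 by blast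
      have z1: "mset (?z1 j) = replicate_mset r (u, i) + {#(l, i0)#} + mset R'"
        by (simp add: Suc bi R'_def)
      have len1: "length (?z1 j) = k"
        using len j' by (simp add: Suc)
      have good1: "good (?z1 j)"
        using i i0 goodR sR' unfolding R'_def by (auto simp: Suc bi dest: in_set_takeD in_set_dropD)
      show ?thesis
      proof (cases "filter_mset (\<lambda>z. snd z = i) (mset R) = {#(l, i)#}")
        case True
        then have "b = l" and "filter_mset (\<lambda>z. snd z = i) (mset R') = {#}"
          by (auto simp: mR)
        then have R'_i: "\<forall>z\<in>set R'. snd z \<noteq> i"
          by (simp only: filter_mset_eq_mempty_iff set_mset_mset Ball_def simp_thms)
        have "wd (?z1 j) - wd ?Z \<in> J"
        proof (rule wd_swap_J[where zs = R' and i = i and i0 = i0 and r = r and u = u and l = l])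
          show "snd z \<noteq> i \<and> snd z \<noteq> i0" if "z \<in> set R'" for z
            using that R'_i sR' R_i0 by blast
          show "mset ?Z = replicate_mset r (u, i0) + {#(l, i)#} + mset R'"
            by (simp add: mR \<open>b = l\<close>)
          show "Flow (length ?Z) \<subseteq> J" using J len by simp
        qed (use i i0 z1 sR' goodR in auto)
        then have "sc (\<omega> u l) (wd (?z1 j) - wd ?Z) \<in> J" by (rule subspace_scale[OF subspace_J])
        then show ?thesis by (intro exI[of _ 1]) (simp add: Suc bi \<open>b = l\<close> scale_right_diff_distrib)
      next
        case False
        have "mixed l (mset (?z1 j)) i \<subseteq> mixed l (mset Z) i0 - {i}"
        proof
          fix i' assume i': "i' \<in> mixed l (mset (?z1 j)) i"
          have "filter_mset (\<lambda>z. snd z = i0) (mset R') = {#}"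
            using R'_i0 by simp
          then have "filter_mset (\<lambda>z. snd z = i0) (mset (?z1 j)) = {#(l, i0)#}"
            unfolding z1 using i by simp
          then have "i' \<noteq> i0" using i' by (auto simp: mixed_def)
          moreover have "i' \<noteq> i" using i' by (auto simp: mixed_def)
          ultimately have "filter_mset (\<lambda>z. snd z = i') (mset (?z1 j)) =
              filter_mset (\<lambda>z. snd z = i') (mset Z)"
            unfolding z1 by (simp add: filter_Z mR)
          then show "i' \<in> mixed l (mset Z) i0 - {i}"
            using i' \<open>i' \<noteq> i0\<close> \<open>i' \<noteq> i\<close> by (auto simp: mixed_def)
        qed
        moreover have "i \<in> mixed l (mset Z) i0"
          using False i by (simp add: mixed_def filter_Z)
        ultimately have "mixed l (mset (?z1 j)) i \<subset> mixed l (mset Z) i0" by blast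
        then have "card (mixed l (mset (?z1 j)) i) < card (mixed l (mset Z) i0)"
          by (intro psubset_card_mono) auto
        moreover have "i \<in> snd ` set (?z1 j)"
          using r by (force simp: Suc bi)
        ultimately have "wd (?z1 j) \<in> J" using less.hyps good1 len1 by blast
        then show ?thesis
          by (intro exI[of _ 0]) (simp add: Suc subspace_scale del: map_append)
      qed
    qed
    then have "\<forall>j. \<exists>c::nat. j < length ?zs \<longrightarrow>
        sc (?c j) (wd (?z1 j)) - sc (of_nat c * \<omega> u l) (wd ?Z) \<in> J \<and> (j = 0 \<longrightarrow> c = 1)" by blast
    from choice[OF this] obtain c :: "nat \<Rightarrow> nat" where ch: "\<forall>j. j < length ?zs \<longrightarrow>
        sc (?c j) (wd (?z1 j)) - sc (of_nat (c j) * \<omega> u l) (wd ?Z) \<in> J \<and> (j = 0 \<longrightarrow> c j = 1)"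
      by blast
    then have c: "\<And>j. j < length ?zs \<Longrightarrow>
        sc (?c j) (wd (?z1 j)) - sc (of_nat (c j) * \<omega> u l) (wd ?Z) \<in> J" by blast
    have "c 0 = 1" using ch[rule_format, of 0] by simp
    have "(\<Sum>j<length ?zs. sc (?c j) (wd (?z1 j))) \<in> J"
    proof (rule contraction_relation[OF r])
      show "Flow (r + length R) \<subseteq> J" using J len by simp
    qed (use goodR i0 in auto)
    moreover have "(\<Sum>j<length ?zs. sc (?c j) (wd (?z1 j)) - sc (of_nat (c j) * \<omega> u l) (wd ?Z)) \<in> J"
      using c by (intro subspace_sum[OF subspace_J]) blast
    then have "(\<Sum>j<length ?zs. sc (?c j) (wd (?z1 j))) -
        (\<Sum>j<length ?zs. sc (of_nat (c j) * \<omega> u l) (wd ?Z)) \<in> J"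
      by (simp only: sum_subtractf)
    ultimately have "(\<Sum>j<length ?zs. sc (of_nat (c j) * \<omega> u l) (wd ?Z)) \<in> J"
      using subspace_congruent[OF subspace_J] by blast
    then have "sc (of_nat (\<Sum>j<length ?zs. c j) * \<omega> u l) (wd ?Z) \<in> J"
      by (simp only: of_nat_sum sum_distrib_right scale_sum_left)
    moreover have "c 0 \<le> (\<Sum>j<length ?zs. c j)" by (rule member_le_sum) auto
    then have "(\<Sum>j<length ?zs. c j) \<noteq> 0" using \<open>c 0 = 1\<close> by linarith
    then have "of_nat (\<Sum>j<length ?zs. c j) * \<omega> u l \<noteq> 0"
      using u by (simp only: mult_eq_0_iff of_nat_eq_0_iff simp_thms)
    ultimately show ?thesis by (rule subspace_scale_cancel[OF subspace_J])
  qed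
  \<comment> \<open>\<open>u0\<close> is only the starting point of the polarization; no copy of it
    remains.\<close>
  have "wd (replicate 0 (u0, i0) @ map (\<lambda>b. (b, i0)) bs @ R) \<in> J"
    using J len r_def l by (intro polarization[OF i0 goodR _ powers]) auto
  then have "wd (map (\<lambda>b. (b, i0)) bs @ R) \<in> J" by simp
  then show ?case using wd_perm_J[OF mZ less.prems(1)] J less.prems(2) by blast
qed

text \<open>Since \<open>Flow (Suc k)\<close> is \<open>Fl k\<close>, the induction hypothesis
  supplies exactly the shorter words modulo which the words of length \<open>Suc k\<close> are
  reduced.\<close>

lemma Fl_J: "Fl k \<subseteq> J"
proof (induction k)
  case 0
  have "unit \<in> J" unfolding J_def by (rule span_base) simp
  then show ?case by (auto simp: word_filt_0 subspace_scale)
next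
  case (Suc k)
  have "word gs \<in> J" if gs: "set gs \<subseteq> W" "length gs \<le> Suc k" for gs
  proof (cases "length gs \<le> k")
    case True
    then show ?thesis using Suc gs word_in_filt by blast
  next
    case False
    then have len: "length gs = Suc k" using gs by simp
    have "\<exists>zs. good zs \<and> map letter zs = gs" using gs(1)
    proof (induction gs)
      case (Cons g gs)
      then obtain zs u i where "good zs" "map letter zs = gs" "g = letter (u, i)" "i \<in> {1..n}"
        by (auto simp: W_def letter_def)
      then show ?case by (intro exI[of _ "(u, i) # zs"]) auto
    qed simp
    then obtain zs where zs: "good zs" "map letter zs = gs" by blast
    show ?thesis
    proof (cases "\<exists>l::'v. l \<noteq> 0")
      case True
      then obtain l u0 where "\<omega> u0 l \<noteq> 0" using form_nondeg by blast
      moreover obtain z where "z \<in> set zs" using zs len by (cases zs) auto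
      ultimately have "wd zs \<in> J"
        using wd_in_J[of u0 l "Suc k" zs "snd z"] Suc zs len by auto
      then show ?thesis using zs by simp
    next
      \<comment> \<open>If \<open>V\<close> is zero, every letter vanishes, because \<open>w\<close>
        is additive in \<open>u\<close>, and with it every word of positive length.\<close>
      case False
      obtain g gs' where g: "gs = g # gs'" using len by (cases gs) auto
      then obtain u i where ui: "g = w u i" "i \<le> n" using gs by (auto simp: W_def)
      have "u = 0" using False by blast
      then have "w u i = w u i + w u i" using w_add[of i u u] ui by simp
      then have "g = 0" using ui by (metis add_cancel_left_left)
      then show ?thesis using g gs W_L by (simp add: subspace_0 subset_iff)
    qed
  qed
  then have "word ` {gs. set gs \<subseteq> W \<and> length gs \<le> Suc k} \<subseteq> J" by blast
  then show ?case unfolding word_filt_def by (rule span_minimal) simp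
qed

section \<open>Averaging over the symmetric group\<close>

lemma act_Fl:
  assumes p: "p permutes {..n}" and "a \<in> Fl k"
  shows "act p a \<in> Fl k"
  using assms(2) W_L
proof (induction rule: word_filt_L_induct)
  case subspace
  show ?case
    by (rule subspaceI) (auto simp: p act_add act_scale subspace_0
        intro: subspace_add[OF subspace_word_filt] subspace_scale[OF subspace_word_filt])
next
  case (word gs)
  \<comment> \<open>A permutation may move slot \<open>0\<close>, so the image of a letter is in
    general only a combination of letters.\<close>
  have "act p (w u i) \<in> span W" if "i \<in> {1..n}" for u i
  proof -
    have "p i \<le> n" "p 0 \<le> n" using permutes_in_image[OF p, of i] permutes_in_image[OF p, of 0] that by auto
    then show ?thesis using that p by (auto simp: w_def act_diff act_x intro!: span_diff x_span_W)
  qed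
  then have "act p ` W \<subseteq> span W" by (auto simp: W_def)
  then have "word_filt (act p ` W) k \<subseteq> Fl k" by (rule word_filt_gens[OF W_L])
  moreover have "word (map (act p) gs) \<in> word_filt (act p ` W) k"
    using word by (intro word_in_filt) auto
  moreover have "act p (word gs) = word (map (act p) gs)" using p word W_L by (intro act_word) auto
  ultimately show ?case by auto
qed

lemma subspace_Bt: "subspace Bt"
proof (rule subspaceI)
  fix a b assume "a \<in> Bt" "b \<in> Bt"
  then obtain i j where "a \<in> Fl i" "b \<in> Fl j" by (auto simp: Bt_def)
  then have "a \<in> Fl (max i j)" "b \<in> Fl (max i j)"
    using word_filt_mono[of i "max i j"] word_filt_mono[of j "max i j"] by auto
  then show "a + b \<in> Bt" using subspace_add[OF subspace_word_filt] Fl_Bt by blast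
qed (auto simp: Bt_def subspace_0 intro: subspace_scale[OF subspace_word_filt])

lemma Bt_L: "a \<in> Bt \<Longrightarrow> a \<in> L"
  by (auto simp: Bt_def Fl_L)

lemma act_Bt: "p permutes {..n} \<Longrightarrow> a \<in> Bt \<Longrightarrow> act p a \<in> Bt"
  using act_Fl by (auto simp: Bt_def)

lemma br_Bt: "a \<in> Bt \<Longrightarrow> b \<in> Bt \<Longrightarrow> br a b \<in> Bt"
  using br_Fl Flow_Fl by (fastforce simp: Bt_def)

definition symm :: "'b \<Rightarrow> 'b" where "symm a = (\<Sum>p | p permutes {..n}. act p a)"

lemma symm_inv: "a \<in> Bt \<Longrightarrow> symm a \<in> inv_elems"
proof -
  assume a: "a \<in> Bt"
  have "act q (symm a) = symm a" if q: "q permutes {..n}" for q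
  proof -
    have "act q (symm a) = (\<Sum>p | p permutes {..n}. act (q \<circ> p) a)"
      unfolding symm_def using q a by (subst act_sum) (auto simp: act_comp Bt_L)
    also have "\<dots> = symm a"
      unfolding symm_def by (rule setum_permutations_compose_left[OF q, symmetric])
    finally show ?thesis .
  qed
  moreover have "symm a \<in> Bt"
    unfolding symm_def using a by (intro subspace_sum[OF subspace_Bt] act_Bt) auto
  ultimately show ?thesis by (simp add: inv_elems_def)
qed

lemma symm_act: "p permutes {..n} \<Longrightarrow> a \<in> Bt \<Longrightarrow> symm (act p a) = symm a"
  unfolding symm_def
  by (subst sum_permutations_compose_right[of p "{..n}" "\<lambda>q. act q a"]) (simp_all add: act_comp Bt_L)

definition inv_brackets :: "'b set" where
  "inv_brackets = span {br a b | a b. a \<in> inv_elems \<and> b \<in> inv_elems}"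

text \<open>\<open>symm\<close> carries \<open>J\<close> into the span of \<open>unit\<close> and
  the brackets of invariants: it passes through the bracket with an invariant \<open>P\<close> to
  the other argument, and it kills \<open>act p a - a\<close>. On invariants it is multiplication by
  the order of the group.\<close>

theorem inv_elems_mod_brackets:
  assumes "a \<in> inv_elems"
  shows "\<exists>c. a - sc c unit \<in> inv_brackets"
proof -
  let ?K = "span (insert unit {br a b | a b. a \<in> inv_elems \<and> b \<in> inv_elems})"
  let ?N = "of_nat (card {p. p permutes {..n}}) :: complex"
  have N: "?N \<noteq> 0" using card_permutations[OF refl, of "{..n}"] by (simp del: fact_Suc)
  have inv: "symm b = sc ?N b" if "b \<in> L" "\<And>p. p permutes {..n} \<Longrightarrow> act p b = b" for b
    using that by (simp add: symm_def sum_constant_scale)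
  have "subspace {a. a \<in> L \<and> symm a \<in> ?K}"
    using subspace_span[of "insert unit {br a b | a b. a \<in> inv_elems \<and> b \<in> inv_elems}"]
    by (auto simp: subspace_def symm_def act_add act_scale sum.distrib scale_sum_right[symmetric])
  moreover have gens: "b \<in> L \<and> symm b \<in> ?K" if "b \<in> insert unit ({br P G | P G. P \<in> inv_elems \<and> G \<in> Bt} \<union>
        {act p a - a | p a. p permutes {..n} \<and> a \<in> Bt})" for b
    using that
  proof (elim insertE UnE CollectE exE conjE)
    assume "b = unit"
    then show ?thesis using inv[of unit] by (simp add: span_scale span_base)
  next
    fix P G assume b: "b = br P G" "P \<in> inv_elems" "G \<in> Bt"
    then have L: "P \<in> L" "G \<in> L" by (auto simp: Bt_L inv_elems_def)
    have "symm b = (\<Sum>p | p permutes {..n}. br P (act p G))"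
      unfolding symm_def using b L by (intro sum.cong) (auto simp: act_br inv_elems_def)
    also have "\<dots> = br P (symm G)"
      unfolding symm_def using L by (subst br_sum_right) auto
    finally show ?thesis using b L symm_inv by (auto intro!: span_base)
  next
    fix p a assume b: "b = act p a - a" "p permutes {..n}" "a \<in> Bt"
    have "symm b = symm (act p a) - symm a"
      using b Bt_L by (simp add: symm_def act_diff sum_subtractf)
    then show ?thesis using b symm_act Bt_L by (simp add: span_zero)
  qed
  ultimately have "J \<subseteq> {a. a \<in> L \<and> symm a \<in> ?K}"
    unfolding J_def by (intro span_minimal subsetI CollectI gens)
  moreover have "a \<in> J" using assms Fl_J by (auto simp: inv_elems_def Bt_def)
  ultimately have "symm a \<in> ?K" by blast
  then have "sc ?N a \<in> ?K" using inv[of a] assms by (auto simp: inv_elems_def Bt_L)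
  then have "a \<in> ?K" using N by (rule subspace_scale_cancel[OF subspace_span])
  then show ?thesis unfolding span_insert inv_brackets_def by blast
qed

lemma subspace_inv: "subspace inv_elems"
  using subspace_Bt by (auto simp: subspace_def inv_elems_def act_add act_scale Bt_L)

lemma br_inv: "a \<in> inv_elems \<Longrightarrow> b \<in> inv_elems \<Longrightarrow> br a b \<in> inv_elems"
  by (auto simp: inv_elems_def br_Bt act_br Bt_L)

lemma mul_inv: "a \<in> inv_elems \<Longrightarrow> b \<in> inv_elems \<Longrightarrow> a \<star> b \<in> inv_elems"
proof -
  assume ab: "a \<in> inv_elems" "b \<in> inv_elems"
  then obtain i j where "a \<in> Fl i" "b \<in> Fl j" by (auto simp: inv_elems_def Bt_def)
  then have "a \<star> b \<in> Bt" using Fl_Bt[OF word_filt_mul[OF W_L]] by blast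
  then show ?thesis using ab by (simp add: inv_elems_def act_mul Bt_L)
qed

lemma inv_brackets_inv: "inv_brackets \<subseteq> inv_elems"
  unfolding inv_brackets_def by (rule span_minimal[OF _ subspace_inv]) (auto intro: br_inv)

lemma unit_inv: "unit \<in> inv_elems"
  using Fl_Bt[OF unit_in_filt[of W 0]] by (simp add: inv_elems_def)

end

section \<open>Polynomial functions\<close>

definition fun_scale :: "complex \<Rightarrow> ('x \<Rightarrow> complex) \<Rightarrow> 'x \<Rightarrow> complex" where
  "fun_scale c f = (\<lambda>x. c * f x)"

lemma fun_scale_apply [simp]: "fun_scale c f x = c * f x"
  by (simp add: fun_scale_def)

lemma vector_space_fun_scale: "vector_space fun_scale"
  by unfold_locales (auto simp: fun_eq_iff algebra_simps)

locale fun_space = vector_space s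
  for s :: "complex \<Rightarrow> 'x::ab_group_add \<Rightarrow> 'x" +
  fixes X :: "'x set"
  assumes subspace_X: "subspace X"
begin

lemma X_closed [simp]:
  "0 \<in> X" "a \<in> X \<Longrightarrow> b \<in> X \<Longrightarrow> a + b \<in> X" "a \<in> X \<Longrightarrow> s k a \<in> X"
  "a \<in> X \<Longrightarrow> b \<in> X \<Longrightarrow> a - b \<in> X" "a \<in> X \<Longrightarrow> - a \<in> X"
  using subspace_X by (auto simp: subspace_0 subspace_add subspace_scale subspace_diff subspace_neg)

abbreviation PF :: "('x \<Rightarrow> complex) set" where "PF \<equiv> poly_funs s X"
abbreviation LF :: "('x \<Rightarrow> complex) set" where "LF \<equiv> lin_funs s X"
abbreviation cst :: "complex \<Rightarrow> 'x \<Rightarrow> complex" where "cst \<equiv> const_fun X"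
abbreviation der :: "'x \<Rightarrow> ('x \<Rightarrow> complex) \<Rightarrow> 'x \<Rightarrow> complex" where "der \<equiv> dir_deriv s X"

lemma PF_outside: "f \<in> PF \<Longrightarrow> x \<notin> X \<Longrightarrow> f x = 0"
  by (induction rule: poly_funs.induct) (auto simp: const_fun_def lin_funs_def)

lemma fun_scale_PF: "f \<in> PF \<Longrightarrow> fun_scale c f = cst c * f"
  using PF_outside by (auto simp: fun_eq_iff const_fun_def)

lemma PF_cst [simp]: "cst c \<in> PF" by (rule poly_funs.const)

lemma PF_zero [simp]: "0 \<in> PF"
  using poly_funs.const[of X 0 s] by (simp add: const_fun_def zero_fun_def)

lemma PF_zero' [simp]: "(\<lambda>x. 0) \<in> PF"
  using PF_zero by (simp add: zero_fun_def)

lemma PF_add [simp]: "f \<in> PF \<Longrightarrow> g \<in> PF \<Longrightarrow> f + g \<in> PF" by (rule poly_funs.add)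

lemma PF_mult [simp]: "f \<in> PF \<Longrightarrow> g \<in> PF \<Longrightarrow> f * g \<in> PF" by (rule poly_funs.mult)

lemma PF_scale [simp]: "f \<in> PF \<Longrightarrow> fun_scale c f \<in> PF"
  by (simp add: fun_scale_PF)

lemma PF_lin: "l \<in> LF \<Longrightarrow> l \<in> PF" by (rule poly_funs.lin)

lemma subspace_PF: "module.subspace fun_scale PF"
proof -
  interpret F: vector_space fun_scale by (rule vector_space_fun_scale)
  show ?thesis by (rule F.subspaceI) auto
qed

lemma PF_uminus [simp]: "f \<in> PF \<Longrightarrow> - f \<in> PF"
proof -
  interpret F: vector_space fun_scale by (rule vector_space_fun_scale)
  show "f \<in> PF \<Longrightarrow> - f \<in> PF" by (rule F.subspace_neg[OF subspace_PF])
qed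

lemma cst_one_mult [simp]: "f \<in> PF \<Longrightarrow> cst 1 * f = f"
  using PF_outside by (auto simp: fun_eq_iff const_fun_def)

lemma mult_cst_one [simp]: "f \<in> PF \<Longrightarrow> f * cst 1 = f"
  using PF_outside by (auto simp: fun_eq_iff const_fun_def)

text \<open>\<open>dir_deriv\<close> is defined by \<open>deriv\<close>, whose sum and product rules
  require differentiability; membership in \<open>PF\<close> supplies it along every line.\<close>

lemma line_differentiable:
  "f \<in> PF \<Longrightarrow> x \<in> X \<Longrightarrow> u \<in> X \<Longrightarrow> (\<lambda>t. f (x + s t u)) field_differentiable (at t)"
proof (induction rule: poly_funs.induct)
  case (lin l)
  then have "(\<lambda>t. l (x + s t u)) = (\<lambda>t. l x + t * l u)" by (auto simp: lin_funs_def)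
  then show ?case by (auto intro!: derivative_intros)
qed (auto simp: const_fun_def intro!: derivative_intros)

lemma der_cst [simp]: "u \<in> X \<Longrightarrow> der u (cst c) = 0"
  by (auto simp: dir_deriv_def fun_eq_iff const_fun_def)

lemma der_lin: "u \<in> X \<Longrightarrow> l \<in> LF \<Longrightarrow> der u l = cst (l u)"
proof
  fix x assume ul: "u \<in> X" "l \<in> LF"
  show "der u l x = cst (l u) x"
  proof (cases "x \<in> X")
    case True
    then have "(\<lambda>t. l (x + s t u)) = (\<lambda>t. l x + t * l u)" using ul by (auto simp: lin_funs_def)
    moreover have "deriv (\<lambda>t. l x + t * l u) 0 = l u"
      by (rule DERIV_imp_deriv) (auto intro!: derivative_eq_intros)
    ultimately show ?thesis using True by (simp add: dir_deriv_def const_fun_def)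
  qed (auto simp: dir_deriv_def const_fun_def)
qed

lemma der_add: "u \<in> X \<Longrightarrow> f \<in> PF \<Longrightarrow> g \<in> PF \<Longrightarrow> der u (f + g) = der u f + der u g"
  using line_differentiable by (auto simp: dir_deriv_def fun_eq_iff)

lemma der_mult: "u \<in> X \<Longrightarrow> f \<in> PF \<Longrightarrow> g \<in> PF \<Longrightarrow> der u (f * g) = f * der u g + der u f * g"
  using line_differentiable by (auto simp: dir_deriv_def fun_eq_iff)

lemma der_zero [simp]: "u \<in> X \<Longrightarrow> der u 0 = 0"
  by (auto simp: dir_deriv_def fun_eq_iff)

lemma der_PF [simp]: "f \<in> PF \<Longrightarrow> u \<in> X \<Longrightarrow> der u f \<in> PF"
  by (induction rule: poly_funs.induct) (auto simp: der_lin der_add der_mult)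

lemma der_add_dir:
  "f \<in> PF \<Longrightarrow> u \<in> X \<Longrightarrow> v \<in> X \<Longrightarrow> der (u + v) f = der u f + der v f"
proof (induction rule: poly_funs.induct)
  case (lin l)
  then show ?case by (auto simp: der_lin lin_funs_def const_fun_def fun_eq_iff)
qed (auto simp: der_add der_mult algebra_simps)

lemma der_scale_dir: "f \<in> PF \<Longrightarrow> u \<in> X \<Longrightarrow> der (s c u) f = fun_scale c (der u f)"
proof (induction rule: poly_funs.induct)
  case (lin l)
  then show ?case by (auto simp: der_lin lin_funs_def const_fun_def fun_eq_iff)
qed (auto simp: der_add der_mult fun_eq_iff algebra_simps)

lemma der_commute: "f \<in> PF \<Longrightarrow> u \<in> X \<Longrightarrow> v \<in> X \<Longrightarrow> der u (der v f) = der v (der u f)"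
  by (induction rule: poly_funs.induct) (auto simp: der_lin der_add der_mult algebra_simps)

lemma der_scale: "f \<in> PF \<Longrightarrow> u \<in> X \<Longrightarrow> der u (fun_scale c f) = fun_scale c (der u f)"
  by (simp add: fun_scale_PF der_mult)

lemma der_outside: "x \<notin> X \<Longrightarrow> der u f x = 0"
  by (simp add: dir_deriv_def)

end

text \<open>\<open>Om_riesz\<close> stands in for finite dimension: it gives every polynomial
  function a Hamiltonian vector at each point.\<close>

locale symplectic_fun_space = fun_space s X
  for s :: "complex \<Rightarrow> 'x::ab_group_add \<Rightarrow> 'x" and X +
  fixes \<Omega> :: "'x \<Rightarrow> 'x \<Rightarrow> complex"
  assumes Om_add_left: "a \<in> X \<Longrightarrow> b \<in> X \<Longrightarrow> c \<in> X \<Longrightarrow> \<Omega> (a + b) c = \<Omega> a c + \<Omega> b c"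
    and Om_scale_left: "a \<in> X \<Longrightarrow> b \<in> X \<Longrightarrow> \<Omega> (s k a) b = k * \<Omega> a b"
    and Om_antisym: "a \<in> X \<Longrightarrow> b \<in> X \<Longrightarrow> \<Omega> a b = - \<Omega> b a"
    and Om_nondeg: "a \<in> X \<Longrightarrow> (\<And>b. b \<in> X \<Longrightarrow> \<Omega> a b = 0) \<Longrightarrow> a = 0"
    and Om_riesz: "l \<in> LF \<Longrightarrow> \<exists>a\<in>X. \<forall>b\<in>X. l b = \<Omega> a b"
begin

abbreviation ham :: "('x \<Rightarrow> complex) \<Rightarrow> 'x \<Rightarrow> 'x" where "ham \<equiv> ham_vec s X \<Omega>"
abbreviation pb :: "('x \<Rightarrow> complex) \<Rightarrow> ('x \<Rightarrow> complex) \<Rightarrow> 'x \<Rightarrow> complex" where "pb \<equiv> poisson_bracket s X \<Omega>"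

lemma Om_unique:
  assumes "a \<in> X" "b \<in> X" "\<And>c. c \<in> X \<Longrightarrow> \<Omega> a c = \<Omega> b c" shows "a = b"
proof -
  have "\<Omega> (a - b) c = 0" if "c \<in> X" for c
    using Om_add_left[of a "s (-1) b" c] Om_scale_left[of b c "-1"] assms that by simp
  then show ?thesis using Om_nondeg[of "a - b"] assms by auto
qed

lemma ham_eq:
  assumes "v \<in> X" "\<And>w. w \<in> X \<Longrightarrow> der w f x = \<Omega> v w" shows "ham f x = v"
  unfolding ham_vec_def
proof (rule the_equality)
  show "v' = v" if "v' \<in> X \<and> (\<forall>w\<in>X. der w f x = \<Omega> v' w)" for v'
    using that assms by (intro Om_unique) auto
qed (use assms in auto)

lemma ham:
  assumes "f \<in> PF" "x \<in> X"
  shows "ham f x \<in> X" "w \<in> X \<Longrightarrow> der w f x = \<Omega> (ham f x) w"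
proof -
  have "(\<lambda>w. if w \<in> X then der w f x else 0) \<in> LF"
    using assms by (auto simp: lin_funs_def der_add_dir der_scale_dir)
  from Om_riesz[OF this] obtain v where v: "v \<in> X" "\<forall>w\<in>X. der w f x = \<Omega> v w" by auto
  then have "ham f x = v" by (intro ham_eq) auto
  then show "ham f x \<in> X" "w \<in> X \<Longrightarrow> der w f x = \<Omega> (ham f x) w" using v by auto
qed

text \<open>At a fixed point the bracket with \<open>g\<close> is a directional derivative of the
  first argument, so linearity and the Leibniz rule in that argument are inherited from
  \<open>der\<close>.\<close>

lemma pb_eq: "f \<in> PF \<Longrightarrow> g \<in> PF \<Longrightarrow> pb f g x = (if x \<in> X then der (ham g x) f x else 0)"
  by (simp add: poisson_bracket_def ham)

lemma pb_antisym: "f \<in> PF \<Longrightarrow> g \<in> PF \<Longrightarrow> pb f g = - pb g f"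
proof
  fix x assume "f \<in> PF" "g \<in> PF"
  then show "pb f g x = (- pb g f) x"
    using Om_antisym[of "ham f x" "ham g x"] ham(1) by (simp add: poisson_bracket_def)
qed

lemma pb_add_left: "f \<in> PF \<Longrightarrow> g \<in> PF \<Longrightarrow> h \<in> PF \<Longrightarrow> pb (f + g) h = pb f h + pb g h"
  by (auto simp: fun_eq_iff pb_eq der_add ham)

lemma pb_scale_left: "f \<in> PF \<Longrightarrow> g \<in> PF \<Longrightarrow> pb (fun_scale k f) g = fun_scale k (pb f g)"
  by (auto simp: fun_eq_iff pb_eq der_scale ham)

lemma pb_mult_left: "f \<in> PF \<Longrightarrow> g \<in> PF \<Longrightarrow> h \<in> PF \<Longrightarrow> pb (f * g) h = f * pb g h + pb f h * g"
  by (auto simp: fun_eq_iff pb_eq der_mult ham)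

lemma pb_lin:
  assumes "l \<in> LF" "v \<in> X" "\<And>w. w \<in> X \<Longrightarrow> l w = \<Omega> v w" "g \<in> PF"
  shows "pb g l = der v g"
proof
  fix x
  have "ham l x = v" if "x \<in> X"
    using assms that by (intro ham_eq) (auto simp: der_lin const_fun_def)
  then show "pb g l x = der v g x" using assms PF_lin by (simp add: pb_eq der_outside)
qed

lemma pb_PF [simp]:
  assumes "f \<in> PF" "g \<in> PF" shows "pb f g \<in> PF"
  using assms(1)
proof (induction rule: poly_funs.induct)
  case (const c)
  have "pb (cst c) g = 0" using assms ham by (auto simp: fun_eq_iff pb_eq)
  then show ?case by simp
next
  case (lin l)
  obtain v where "v \<in> X" "\<forall>w\<in>X. l w = \<Omega> v w" using Om_riesz[OF lin] by blast
  then have "pb g l = der v g" using lin assms by (intro pb_lin) auto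
  then have "- pb g l \<in> PF" using assms \<open>v \<in> X\<close> by (metis PF_uminus der_PF)
  then show ?case using assms lin PF_lin by (metis pb_antisym)
next
  case (add f1 f2)
  then show ?case using assms by (subst pb_add_left) (simp_all only: PF_add)
next
  case (mult f1 f2)
  then show ?case using assms by (subst pb_mult_left) (simp_all only: PF_add PF_mult)
qed

text \<open>A linear symplectic map carries the Hamiltonian vectors of the pulled back functions to
  those of the original ones; surjectivity provides a preimage of each test vector.\<close>

lemma pb_pullback:
  assumes f: "f \<in> PF" "(\<lambda>x. f (P x)) \<in> PF" and g: "g \<in> PF" "(\<lambda>x. g (P x)) \<in> PF"
    and P: "\<And>x. P x \<in> X \<longleftrightarrow> x \<in> X" "P ` X = X" "\<And>x y. P (x + y) = P x + P y" "\<And>c x. P (s c x) = s c (P x)"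
      "\<And>x y. x \<in> X \<Longrightarrow> y \<in> X \<Longrightarrow> \<Omega> (P x) (P y) = \<Omega> x y"
  shows "pb (\<lambda>x. f (P x)) (\<lambda>x. g (P x)) = (\<lambda>x. pb f g (P x))"
proof
  fix x
  have der: "der w (\<lambda>x. f (P x)) x = der (P w) f (P x)" if "x \<in> X" for w f
    using that P by (simp add: dir_deriv_def)
  have P_ham: "ham f (P x) = P (ham (\<lambda>x. f (P x)) x)"
    if x: "x \<in> X" and f: "f \<in> PF" "(\<lambda>x. f (P x)) \<in> PF" for f
  proof (rule ham_eq)
    show "P (ham (\<lambda>x. f (P x)) x) \<in> X" using P(1) x f ham by blast
    fix w assume "w \<in> X"
    then obtain w' where w': "w = P w'" "w' \<in> X" using P(2) by blast
    have "der w f (P x) = der w' (\<lambda>x. f (P x)) x" using w' x by (simp add: der)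
    also have "\<dots> = \<Omega> (ham (\<lambda>x. f (P x)) x) w'" using ham(2) f x w' by blast
    also have "\<dots> = \<Omega> (P (ham (\<lambda>x. f (P x)) x)) w" using P(5) w' ham f x by simp
    finally show "der w f (P x) = \<Omega> (P (ham (\<lambda>x. f (P x)) x)) w" .
  qed
  show "pb (\<lambda>x. f (P x)) (\<lambda>x. g (P x)) x = pb f g (P x)"
  proof (cases "x \<in> X")
    case True
    then show ?thesis using f g P ham by (simp add: poisson_bracket_def P_ham)
  next
    case False
    then show ?thesis using P(1) by (simp add: poisson_bracket_def)
  qed
qed

end

section \<open>Tuples\<close>

locale symplectic_vs =
  fixes s :: "complex \<Rightarrow> 'v::ab_group_add \<Rightarrow> 'v" and \<omega> :: "'v \<Rightarrow> 'v \<Rightarrow> complex" and n :: nat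
  assumes sympl: "symplectic_space s \<omega>"
begin

sublocale V: vector_space s
  using sympl unfolding symplectic_space_def finite_dimensional_vector_space_def by blast

lemma om_lin:
  "\<omega> v (x + y) = \<omega> v x + \<omega> v y" "\<omega> v (s c x) = c * \<omega> v x"
  "\<omega> (x + y) v = \<omega> x v + \<omega> y v" "\<omega> (s c x) v = c * \<omega> x v"
  using sympl by (simp_all add: symplectic_space_def Vector_Spaces.linear_iff)

lemma om_zero [simp]: "\<omega> v 0 = 0" "\<omega> 0 v = 0"
  using om_lin(2)[of v 0 0] om_lin(4)[of 0 0 v] by auto

lemma om_diff: "\<omega> v (x - y) = \<omega> v x - \<omega> v y" "\<omega> (x - y) v = \<omega> x v - \<omega> y v"
  using om_lin(1)[of v "x - y" y] om_lin(3)[of "x - y" y v] by simp_all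

lemma om_sum: "\<omega> v (sum f A) = (\<Sum>i\<in>A. \<omega> v (f i))" "\<omega> (sum f A) v = (\<Sum>i\<in>A. \<omega> (f i) v)"
  by (induction A rule: infinite_finite_induct) (auto simp: om_lin)

lemma om_alt [simp]: "\<omega> v v = 0" using sympl by (simp add: symplectic_space_def)

lemma om_antisym: "\<omega> v w = - \<omega> w v"
  using om_alt[of "v + w", unfolded om_lin] by (simp add: eq_neg_iff_add_eq_0 add.commute)

lemma om_nondeg: "(\<And>w. \<omega> v w = 0) \<Longrightarrow> v = 0" using sympl by (auto simp: symplectic_space_def)

text \<open>Sending \<open>v\<close> to the vector with coordinates \<open>\<omega> v b\<close> is
  an injective endomorphism by nondegeneracy, hence surjective by finite dimension. A preimage of
  the vector with coordinates \<open>l b\<close> represents \<open>l\<close>.\<close>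

lemma om_riesz:
  assumes add: "\<And>x y. l (x + y) = l x + l y" and scale: "\<And>c x. l (s c x) = c * l x"
  shows "\<exists>v. \<forall>w. l w = \<omega> v w"
proof -
  obtain B where "finite_dimensional_vector_space s B" using sympl by (auto simp: symplectic_space_def)
  then interpret F: finite_dimensional_vector_space s B .
  have rep: "w = (\<Sum>b\<in>B. s (V.representation B w b) b)" for w
    using V.sum_representation_eq[OF F.independent_Basis, of w B] F.span_Basis F.finite_Basis by simp
  define T where "T v = (\<Sum>b\<in>B. s (\<omega> v b) b)" for v
  have coord: "V.representation B (T v) b = \<omega> v b" if "b \<in> B" for v b
  proof -
    have "V.representation B (T v) b = (\<Sum>b'\<in>B. \<omega> v b' * V.representation B b' b)"
      unfolding T_def using F.span_Basis
      by (subst V.representation_sum) (auto simp: F.independent_Basis V.representation_scale)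
    also have "\<dots> = (\<Sum>b'\<in>B. if b' = b then \<omega> v b' else 0)"
      by (intro sum.cong) (auto simp: V.representation_basis[OF F.independent_Basis])
    also have "\<dots> = \<omega> v b" using that F.finite_Basis by simp
    finally show ?thesis .
  qed
  have linT: "Vector_Spaces.linear s s T"
    by (simp add: Vector_Spaces.linear_iff V.vector_space_axioms T_def om_lin V.scale_left_distrib
        sum.distrib V.scale_sum_right)
  have "inj T"
  proof (rule injI)
    fix v v' assume "T v = T v'"
    then have eq: "\<omega> v b = \<omega> v' b" if "b \<in> B" for b using coord[of b] that by metis
    have "\<omega> (v - v') w = 0" for w
      by (subst rep[of w]) (simp add: om_sum om_lin om_diff eq)
    then show "v = v'" using om_nondeg[of "v - v'"] by simp
  qed
  then have "surj T" using F.linear_inj_imp_surj[OF linT] by blast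
  then obtain v where v: "T v = (\<Sum>b\<in>B. s (l b) b)" by (metis surjD)
  have coord_l: "V.representation B (T v) b = l b" if "b \<in> B" for b
  proof -
    have "V.representation B (T v) b = (\<Sum>b'\<in>B. l b' * V.representation B b' b)"
      unfolding v using F.span_Basis
      by (subst V.representation_sum) (auto simp: F.independent_Basis V.representation_scale)
    also have "\<dots> = (\<Sum>b'\<in>B. if b' = b then l b' else 0)"
      by (intro sum.cong) (auto simp: V.representation_basis[OF F.independent_Basis])
    also have "\<dots> = l b" using that F.finite_Basis by simp
    finally show ?thesis .
  qed
  have l0: "l 0 = 0" using scale[of 0 0] by simp
  have l_sum: "l (sum f A) = (\<Sum>i\<in>A. l (f i))" for f and A :: "'v set"
    by (induction A rule: infinite_finite_induct) (auto simp: add l0)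
  have "l w = \<omega> v w" for w
    by (subst (1 2) rep[of w]) (simp add: om_sum om_lin l_sum scale flip: coord[of _ v] coord_l)
  then show ?thesis by blast
qed

abbreviation ts :: "complex \<Rightarrow> (nat \<Rightarrow> 'v) \<Rightarrow> nat \<Rightarrow> 'v" where "ts \<equiv> tuple_scale s"

lemma vector_space_ts: "vector_space ts"
  by unfold_locales (auto simp: tuple_scale_def fun_eq_iff V.scale_right_distrib V.scale_left_distrib)

text \<open>The projection of \<open>e_i \<otimes> u\<close> to the tuples of sum zero: the mean
  \<open>u / (n + 1)\<close> is subtracted in every slot.\<close>

definition etup :: "nat \<Rightarrow> 'v \<Rightarrow> nat \<Rightarrow> 'v" where
  "etup i u = (\<lambda>j. if j \<le> n then s ((if i = j then 1 else 0) - 1 / of_nat (Suc n)) u else 0)"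

lemma subspace_refl:
  assumes "V.subspace S" shows "module.subspace ts (refl_tensor n S)"
proof -
  interpret T: vector_space ts by (rule vector_space_ts)
  show ?thesis
  proof (rule T.subspaceI)
    show "0 \<in> refl_tensor n S" using V.subspace_0[OF assms] by (simp add: refl_tensor_def)
  next
    fix x y assume "x \<in> refl_tensor n S" "y \<in> refl_tensor n S"
    then show "x + y \<in> refl_tensor n S"
      using V.subspace_add[OF assms] by (simp add: refl_tensor_def sum.distrib)
  next
    fix c x assume "x \<in> refl_tensor n S"
    moreover from this have "(\<Sum>i\<le>n. s c (x i)) = 0"
      by (simp add: refl_tensor_def flip: V.scale_sum_right)
    ultimately show "ts c x \<in> refl_tensor n S"
      using V.subspace_scale[OF assms] by (simp add: refl_tensor_def tuple_scale_def)
  qed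
qed

lemma sum_delta_mean: "i \<le> n \<Longrightarrow> (\<Sum>j\<le>n. (if i = j then 1 else 0) - 1 / of_nat (Suc n) :: complex) = 0"
  by (simp add: sum_subtractf sum.delta' del: of_nat_Suc sum.atMost_Suc)

lemma etup_refl: "V.subspace S \<Longrightarrow> u \<in> S \<Longrightarrow> i \<le> n \<Longrightarrow> etup i u \<in> refl_tensor n S"
  using sum_delta_mean[of i]
  by (simp add: refl_tensor_def etup_def V.subspace_scale V.scale_sum_left[symmetric])

lemma etup_add: "etup i (u + v) = etup i u + etup i v"
  by (auto simp: etup_def fun_eq_iff V.scale_right_distrib)

lemma etup_scale: "etup i (s c u) = ts c (etup i u)"
  by (auto simp: etup_def fun_eq_iff tuple_scale_def mult.commute)

lemma sum_fun_apply: "(sum f A) x = (\<Sum>i\<in>A. f i x)"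
  by (induction A rule: infinite_finite_induct) auto

lemma refl_expand:
  assumes "v \<in> refl_tensor n S" shows "v = (\<Sum>i\<le>n. etup i (v i))"
proof
  fix j
  show "v j = (\<Sum>i\<le>n. etup i (v i)) j"
  proof (cases "j \<le> n")
    case True
    have "(\<Sum>i\<le>n. etup i (v i)) j = (\<Sum>i\<le>n. (if i = j then v i else 0) - s (1 / of_nat (Suc n)) (v i))"
      unfolding sum_fun_apply using True
      by (intro sum.cong) (auto simp: etup_def V.scale_left_diff_distrib simp del: of_nat_Suc)
    also have "\<dots> = v j - s (1 / of_nat (Suc n)) (\<Sum>i\<le>n. v i)"
      using True by (simp add: sum_subtractf V.scale_sum_right del: of_nat_Suc)
    also have "\<dots> = v j" using assms by (simp add: refl_tensor_def)
    finally show ?thesis by simp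
  qed (use assms in \<open>auto simp: sum_fun_apply etup_def refl_tensor_def\<close>)
qed

end

lemma (in fun_space) der_sum_dir:
  "f \<in> PF \<Longrightarrow> (\<And>i. i \<in> A \<Longrightarrow> v i \<in> X) \<Longrightarrow> der (sum v A) f x = (\<Sum>i\<in>A. der (v i) f x)"
proof (induction A rule: infinite_finite_induct)
  case (insert i A)
  have "sum v A \<in> X" using insert by (intro subspace_sum[OF subspace_X]) auto
  then show ?case using insert by (simp add: der_add_dir)
qed (auto simp: dir_deriv_def)

lemma refl_comp_perm:
  assumes "p permutes {..n}" shows "v \<circ> p \<in> refl_tensor n S \<longleftrightarrow> v \<in> refl_tensor n S"
proof -
  have 1: "(\<Sum>i\<le>n. v (p i)) = (\<Sum>i\<le>n. v i)"
    using sum.permute[OF assms, of v] by (simp add: comp_def)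
  have 2: "(\<forall>i\<le>n. v (p i) \<in> S) \<longleftrightarrow> (\<forall>i\<le>n. v i \<in> S)"
  proof -
    have "(\<forall>i\<in>{..n}. v i \<in> S) \<longleftrightarrow> (\<forall>i\<in>p ` {..n}. v i \<in> S)"
      using permutes_image[OF assms] by simp
    then show ?thesis by auto
  qed
  have 3: "p i = i" if "i > n" for i using assms that by (simp add: permutes_not_in)
  show ?thesis unfolding refl_tensor_def comp_def using 1 2 3 by auto
qed

lemma refl_comp_image:
  assumes "p permutes {..n}" shows "(\<lambda>v. v \<circ> p) ` refl_tensor n S = refl_tensor n S"
proof -
  have "v \<in> (\<lambda>v. v \<circ> p) ` refl_tensor n S" if "v \<in> refl_tensor n S" for v
  proof (rule image_eqI)
    show "v = (v \<circ> inv_into UNIV p) \<circ> p" using permutes_inv_o(2)[OF assms] by (simp add: comp_assoc)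
    show "v \<circ> inv_into UNIV p \<in> refl_tensor n S" using that refl_comp_perm[OF permutes_inv[OF assms]] by blast
  qed
  then show ?thesis using refl_comp_perm[OF assms] by blast
qed

lemma perm_fun_add: "perm_fun p (f + g) = perm_fun p f + perm_fun p g"
  and perm_fun_mult: "perm_fun p (f * g) = perm_fun p f * perm_fun p g"
  and perm_fun_scale: "perm_fun p (fun_scale c f) = fun_scale c (perm_fun p f)"
  and perm_fun_comp: "perm_fun p (perm_fun q f) = perm_fun (p \<circ> q) f"
  by (auto simp: perm_fun_def fun_eq_iff comp_assoc)

lemma perm_fun_const: "p permutes {..n} \<Longrightarrow>
    perm_fun p (const_fun (refl_tensor n S) c) = const_fun (refl_tensor n S) c"
  by (simp add: perm_fun_def const_fun_def refl_comp_perm)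

lemma perm_fun_lin: "p permutes {..n} \<Longrightarrow> l \<in> lin_funs (tuple_scale s) (refl_tensor n S) \<Longrightarrow>
    perm_fun p l \<in> lin_funs (tuple_scale s) (refl_tensor n S)"
proof -
  assume p: "p permutes {..n}" and l: "l \<in> lin_funs (tuple_scale s) (refl_tensor n S)"
  have "(x + y) \<circ> p = (x \<circ> p) + (y \<circ> p)" "tuple_scale s c x \<circ> p = tuple_scale s c (x \<circ> p)" for x y c
    by (auto simp: tuple_scale_def)
  then show ?thesis
    using l refl_comp_perm[OF p, of _ S] by (simp add: lin_funs_def perm_fun_def)
qed

lemma perm_fun_poly:
  assumes p: "p permutes {..n}" and f: "f \<in> poly_funs (tuple_scale s) (refl_tensor n S)"
  shows "perm_fun p f \<in> poly_funs (tuple_scale s) (refl_tensor n S)"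
  using f
proof (induction rule: poly_funs.induct)
  case (lin l)
  then show ?case using perm_fun_lin[OF p] poly_funs.lin by blast
qed (auto simp: perm_fun_const[OF p] perm_fun_add perm_fun_mult
    simp del: plus_fun_apply times_fun_apply intro: poly_funs.intros)

section \<open>The Poisson algebra on tuples of sum zero\<close>

context symplectic_vs
begin

abbreviation VX :: "(nat \<Rightarrow> 'v) set" where "VX \<equiv> refl_tensor n UNIV"
abbreviation Om :: "(nat \<Rightarrow> 'v) \<Rightarrow> (nat \<Rightarrow> 'v) \<Rightarrow> complex" where "Om \<equiv> tuple_form n \<omega>"

text \<open>The mean subtracted in \<open>etup\<close> is paired with the sum of the tuple and
  disappears, so \<open>etup i u\<close> represents the functional
  \<open>v \<mapsto> \<omega> u (v i)\<close>.\<close>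

lemma om_etup_sum:
  assumes "v \<in> refl_tensor n S" "i \<le> n"
  shows "(\<Sum>j\<le>n. \<omega> (etup i u j) (v j)) = \<omega> u (v i)"
proof -
  have "(\<Sum>j\<le>n. \<omega> (etup i u j) (v j)) =
      (\<Sum>j\<le>n. (if i = j then \<omega> u (v j) else 0) - 1 / of_nat (Suc n) * \<omega> u (v j))"
    by (intro sum.cong) (auto simp: etup_def om_lin left_diff_distrib simp del: of_nat_Suc)
  also have "\<dots> = \<omega> u (v i) - 1 / of_nat (Suc n) * \<omega> u (\<Sum>j\<le>n. v j)"
    using assms(2) by (simp add: sum_subtractf om_sum sum_distrib_left del: of_nat_Suc)
  also have "\<dots> = \<omega> u (v i)" using assms(1) by (simp add: refl_tensor_def)
  finally show ?thesis .
qed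

lemma Om_etup: "v \<in> VX \<Longrightarrow> i \<le> n \<Longrightarrow> Om (etup i u) v = \<omega> u (v i)"
  using om_etup_sum by (simp add: tuple_form_def)

lemma etup_VX: "i \<le> n \<Longrightarrow> etup i u \<in> VX"
  by (rule etup_refl) auto

lemma lin_fun_sum:
  assumes "l \<in> lin_funs ts (refl_tensor n S)" "V.subspace S" "\<And>i. i \<in> A \<Longrightarrow> v i \<in> refl_tensor n S"
  shows "l (sum v A) = (\<Sum>i\<in>A. l (v i))"
proof -
  interpret T: vector_space ts by (rule vector_space_ts)
  have sub: "T.subspace (refl_tensor n S)" by (rule subspace_refl[OF assms(2)])
  have "l (ts 0 0) = 0 * l 0" using assms(1) T.subspace_0[OF sub] unfolding lin_funs_def by blast
  then have l0: "l 0 = 0" by simp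
  show ?thesis using assms(3)
  proof (induction A rule: infinite_finite_induct)
    case (insert i A)
    then have "v i \<in> refl_tensor n S" "sum v A \<in> refl_tensor n S"
      by (auto intro: T.subspace_sum[OF sub])
    then show ?case using insert assms(1) by (simp add: lin_funs_def del: plus_fun_apply)
  qed (use l0 in auto)
qed

lemma tuple_riesz:
  assumes "l \<in> lin_funs ts VX"
  shows "\<exists>u. \<forall>v\<in>VX. l v = (\<Sum>i\<le>n. \<omega> (u i) (v i))"
proof -
  have "\<exists>u. \<forall>a. l (etup i a) = \<omega> u a" if "i \<le> n" for i
    using assms etup_VX[OF that] by (intro om_riesz) (auto simp: lin_funs_def etup_add etup_scale)
  then have "\<forall>i. \<exists>u. i \<le> n \<longrightarrow> (\<forall>a. l (etup i a) = \<omega> u a)" by blast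
  from choice[OF this] obtain u where u: "\<And>i a. i \<le> n \<Longrightarrow> l (etup i a) = \<omega> (u i) a" by blast
  have "l v = (\<Sum>i\<le>n. \<omega> (u i) (v i))" if v: "v \<in> VX" for v
  proof -
    have "l v = l (\<Sum>i\<le>n. etup i (v i))" using refl_expand[OF v] by simp
    also have "\<dots> = (\<Sum>i\<le>n. l (etup i (v i)))"
      using assms etup_VX by (intro lin_fun_sum) auto
    finally show ?thesis using u by simp
  qed
  then show ?thesis by blast
qed

sublocale X: symplectic_fun_space ts VX Om
proof -
  interpret T: vector_space ts by (rule vector_space_ts)
  show "symplectic_fun_space ts VX Om"
  proof
    show "T.subspace VX" by (rule subspace_refl) simp
  next
    fix a b c :: "nat \<Rightarrow> 'v"
    show "Om (a + b) c = Om a c + Om b c" by (simp add: tuple_form_def om_lin sum.distrib)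
  next
    fix a b :: "nat \<Rightarrow> 'v" and k
    show "Om (ts k a) b = k * Om a b"
      by (simp add: tuple_form_def tuple_scale_def om_lin sum_distrib_left)
  next
    fix a b :: "nat \<Rightarrow> 'v"
    show "Om a b = - Om b a"
      unfolding tuple_form_def sum_negf[symmetric] by (rule sum.cong[OF refl om_antisym])
  next
    fix a assume a: "a \<in> VX" "\<And>b. b \<in> VX \<Longrightarrow> Om a b = 0"
    show "a = 0"
    proof
      fix i
      show "a i = 0 i"
      proof (cases "i \<le> n")
        case True
        have "\<omega> (a i) u = 0" for u
        proof -
          have "Om a (etup i u) = - Om (etup i u) a"
            unfolding tuple_form_def sum_negf[symmetric] by (rule sum.cong[OF refl om_antisym])
          then show ?thesis
            using a etup_VX[OF True] Om_etup[OF a(1) True, of u] om_antisym[of "a i" u] by simp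
        qed
        then show ?thesis using om_nondeg by simp
      qed (use a in \<open>auto simp: refl_tensor_def\<close>)
    qed
  next
    fix l assume "l \<in> lin_funs ts VX"
    then obtain u where u: "\<forall>v\<in>VX. l v = (\<Sum>i\<le>n. \<omega> (u i) (v i))" using tuple_riesz by blast
    have "l v = Om (\<Sum>i\<le>n. etup i (u i)) v" if v: "v \<in> VX" for v
    proof -
      have "Om (\<Sum>i\<le>n. etup i (u i)) v = (\<Sum>i\<le>n. \<Sum>j\<le>n. \<omega> (etup j (u j) i) (v i))"
        by (simp add: tuple_form_def sum_fun_apply om_sum)
      also have "\<dots> = (\<Sum>j\<le>n. \<omega> (u j) (v j))"
        by (subst sum.swap) (simp add: om_etup_sum[OF v])
      finally show ?thesis using u v by simp
    qed
    moreover have "(\<Sum>i\<le>n. etup i (u i)) \<in> VX"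
      using etup_VX by (intro T.subspace_sum subspace_refl) auto
    ultimately show "\<exists>a\<in>VX. \<forall>b\<in>VX. l b = Om a b" by blast
  qed
qed

definition xg :: "'v \<Rightarrow> nat \<Rightarrow> (nat \<Rightarrow> 'v) \<Rightarrow> complex" where
  "xg u i = (\<lambda>v. if v \<in> VX then \<omega> u (v i) else 0)"

lemma xg_lin: "xg u i \<in> X.LF"
proof -
  have "\<omega> u (ts c x i) = c * \<omega> u (x i)" for c x by (simp add: tuple_scale_def om_lin)
  then show ?thesis by (auto simp: xg_def lin_funs_def om_lin)
qed

lemma pb_xg: "f \<in> X.PF \<Longrightarrow> i \<le> n \<Longrightarrow> X.pb f (xg u i) = X.der (etup i u) f"
  by (rule X.pb_lin[OF xg_lin etup_VX]) (auto simp: xg_def Om_etup)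

lemma perm_fun_pb:
  assumes p: "p permutes {..n}" and "f \<in> X.PF" "g \<in> X.PF"
  shows "perm_fun p (X.pb f g) = X.pb (perm_fun p f) (perm_fun p g)"
proof -
  have "X.pb (\<lambda>v. f (v \<circ> p)) (\<lambda>v. g (v \<circ> p)) = (\<lambda>v. X.pb f g (v \<circ> p))"
  proof (rule X.pb_pullback[where P = "\<lambda>v. v \<circ> p"])
    show "(\<lambda>v. f (v \<circ> p)) \<in> X.PF" "(\<lambda>v. g (v \<circ> p)) \<in> X.PF"
      using perm_fun_poly[OF p] assms by (auto simp: perm_fun_def)
    show "(\<lambda>v. v \<circ> p) ` VX = VX" by (rule refl_comp_image[OF p])
    show "Om (x \<circ> p) (y \<circ> p) = Om x y" for x y
      using sum.permute[OF p, of "\<lambda>i. \<omega> (x i) (y i)"] by (simp add: tuple_form_def comp_def)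
  qed (use assms refl_comp_perm[OF p] in \<open>auto simp: tuple_scale_def\<close>)
  then show ?thesis by (simp add: perm_fun_def)
qed

sublocale P: biderivation_algebra fun_scale X.PF "(*)" "X.cst 1" 0 X.pb n s \<omega> xg perm_fun
proof -
  interpret F: vector_space fun_scale by (rule vector_space_fun_scale)
  show "biderivation_algebra fun_scale X.PF (*) (X.cst 1) 0 X.pb n s \<omega> xg perm_fun"
  proof (unfold_locales, goal_cases)
    case 1 show ?case by (rule X.subspace_PF)
  next
    case (12 a b) then show ?case by (rule X.pb_antisym)
  next
    case 13 then show ?case by (rule X.pb_add_left)
  next
    case 14 then show ?case by (rule X.pb_scale_left)
  next
    case 15 then show ?case by (rule X.pb_mult_left)
  next
    case 20 then show ?case using om_nondeg om_antisym by (metis neg_equal_0_iff_equal)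
  next
    case 21 show ?case by (rule X.PF_lin[OF xg_lin])
  next
    case (24 u)
    have "(\<Sum>i\<le>n. xg u i) v = 0" for v
    proof (cases "v \<in> VX")
      case True
      then have "(\<Sum>i\<le>n. xg u i) v = \<omega> u (\<Sum>i\<le>n. v i)"
        by (simp add: sum_fun_apply xg_def om_sum)
      then show ?thesis using True by (simp add: refl_tensor_def)
    qed (simp add: sum_fun_apply xg_def)
    then show ?case by (simp add: fun_eq_iff)
  next
    case (25 i j u v)
    have "X.pb (xg u i) (xg v j) = X.cst (xg u i (etup j v))"
      using 25 X.PF_lin[OF xg_lin] xg_lin etup_VX by (simp add: pb_xg X.der_lin)
    also have "xg u i (etup j v) = \<omega> u v * ((if i = j then 1 else 0) - 1 / of_nat (Suc n))"
      using 25 etup_VX[OF 25(2), of v] by (simp add: xg_def etup_def om_lin eq_commute[of j i])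
    finally show ?case by (auto simp: const_fun_def fun_eq_iff)
  next
    case 26 then show ?case by (rule perm_fun_poly)
  next
    case 27 show ?case by (rule perm_fun_add)
  next
    case 28 show ?case by (rule perm_fun_scale)
  next
    case 29 then show ?case by (rule perm_fun_const)
  next
    case 30 show ?case by (rule perm_fun_mult)
  next
    case 31 then show ?case by (rule perm_fun_pb)
  next
    case 32 show ?case by (rule perm_fun_comp)
  next
    case (33 p i u) then show ?case by (auto simp: perm_fun_def xg_def refl_comp_perm)
  qed (auto simp: fun_eq_iff algebra_simps om_lin xg_def)
qed

lemma poly_generated: "P.Bt = X.PF"
proof
  show "P.Bt \<subseteq> X.PF" using P.Bt_L by blast
  have W: "P.W \<subseteq> X.PF" by (rule P.W_L)
  have Fl_max: "\<exists>k. f \<in> P.Fl k \<and> g \<in> P.Fl k" if fg: "f \<in> P.Bt" "g \<in> P.Bt" for f g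
  proof -
    obtain i j where "f \<in> P.Fl i" "g \<in> P.Fl j" using fg by (auto simp: P.Bt_def)
    then have "f \<in> P.Fl (max i j)" "g \<in> P.Fl (max i j)"
      using P.word_filt_mono[of i "max i j"] P.word_filt_mono[of j "max i j"] by auto
    then show ?thesis by blast
  qed
  have "f \<in> P.Bt" if "f \<in> X.PF" for f
    using that
  proof (induction rule: poly_funs.induct)
    case (const c)
    have "fun_scale c (X.cst 1) \<in> P.Bt"
      by (intro P.subspace_scale[OF P.subspace_Bt] P.Fl_Bt[of _ 0] P.unit_in_filt)
    also have "fun_scale c (X.cst 1) = X.cst c" by (auto simp: const_fun_def fun_eq_iff)
    finally show ?case .
  next
    case (lin l)
    obtain u where u: "\<forall>v\<in>VX. l v = (\<Sum>i\<le>n. \<omega> (u i) (v i))" using tuple_riesz[OF lin] by blast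
    have "l = (\<Sum>i\<le>n. xg (u i) i)"
    proof
      fix v show "l v = (\<Sum>i\<le>n. xg (u i) i) v"
        using u lin by (cases "v \<in> VX") (auto simp: sum_fun_apply xg_def lin_funs_def)
    qed
    also have "\<dots> \<in> P.Fl 1" by (intro P.subspace_sum P.subspace_word_filt P.x_Fl) auto
    finally show ?case by (rule P.Fl_Bt)
  next
    case (add f g)
    show ?case by (rule P.subspace_add[OF P.subspace_Bt add.IH])
  next
    case (mult f g)
    then obtain k where "f \<in> P.Fl k" "g \<in> P.Fl k" using Fl_max by blast
    then show ?case by (intro P.Fl_Bt[of _ "k + k"] P.word_filt_mul[OF W])
  qed
  then show "X.PF \<subseteq> P.Bt" by blast
qed

lemma inv_poly_elems: "invariants n perm_fun X.PF = P.inv_elems"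
  by (simp add: invariants_def P.inv_elems_def poly_generated)

lemma etup_comp:
  assumes "i \<le> n" "j \<le> n" shows "etup i u \<circ> Transposition.transpose i j = etup j u"
proof
  fix k show "(etup i u \<circ> Transposition.transpose i j) k = etup j u k"
    using assms by (auto simp: etup_def Transposition.transpose_def)
qed

lemma sum_etup_const: "(\<Sum>i\<le>n. etup i u) = 0"
proof
  fix j
  have "s (\<Sum>i\<le>n. (if i = j then 1 else 0) - 1 / of_nat (Suc n)) u = 0" if "j \<le> n"
    using that by (simp add: sum_subtractf del: of_nat_Suc sum.atMost_Suc)
  then show "(\<Sum>i\<le>n. etup i u) j = 0 j"
    by (cases "j \<le> n") (simp_all add: sum_fun_apply etup_def V.scale_sum_left[symmetric] del: of_nat_Suc sum.atMost_Suc V.scale_eq_0_iff)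
qed

text \<open>The derivatives at the origin along \<open>etup i u\<close> agree for all
  \<open>i\<close>, since transpositions exchange these vectors, and they add up to the derivative
  along \<open>0\<close>.\<close>

lemma inv_derivative_zero:
  assumes f: "f \<in> P.inv_elems" and v: "v \<in> VX"
  shows "X.der v f 0 = 0"
proof -
  have fP: "f \<in> X.PF" using f poly_generated by (auto simp: P.inv_elems_def)
  have eq: "X.der (etup i u) f 0 = X.der (etup j u) f 0" if ij: "i \<le> n" "j \<le> n" for i j u
  proof -
    let ?p = "Transposition.transpose i j"
    have "?p permutes {..n}" using ij by (intro permutes_swap_id) auto
    then have "perm_fun ?p f = f" using f by (simp add: P.inv_elems_def)
    then have "f (ts t (etup i u)) = perm_fun ?p f (ts t (etup i u))" for t by simp
    moreover have "perm_fun ?p f (ts t (etup i u)) = f (ts t (etup i u \<circ> ?p))" for t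
      by (simp add: perm_fun_def tuple_scale_def comp_def)
    ultimately have "f (ts t (etup i u)) = f (ts t (etup i u \<circ> ?p))" for t by simp
    then have "f (0 + ts t (etup i u)) = f (0 + ts t (etup j u))" for t
      by (simp add: etup_comp[OF ij])
    then show ?thesis by (simp add: dir_deriv_def)
  qed
  have "X.der (etup i u) f 0 = 0" if i: "i \<le> n" for i u
  proof -
    have "of_nat (Suc n) * X.der (etup i u) f 0 = (\<Sum>j\<le>n. X.der (etup i u) f 0)" by simp
    also have "\<dots> = (\<Sum>j\<le>n. X.der (etup j u) f 0)"
      by (intro sum.cong refl eq) (use i in auto)
    also have "\<dots> = X.der (\<Sum>j\<le>n. etup j u) f 0"
      using etup_VX by (intro X.der_sum_dir[OF fP, symmetric]) auto
    also have "\<dots> = 0" by (simp add: sum_etup_const dir_deriv_def)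
    finally show ?thesis by (simp del: of_nat_Suc)
  qed
  then have "X.der (\<Sum>i\<le>n. etup i (v i)) f 0 = 0"
    using etup_VX by (subst X.der_sum_dir[OF fP]) auto
  then show ?thesis using refl_expand[OF v] by simp
qed

lemma inv_brackets_vanish: "f \<in> P.inv_brackets \<Longrightarrow> f 0 = 0"
proof -
  have "P.subspace {f. f 0 = 0}" by (rule P.subspaceI) auto
  moreover have "X.pb f g 0 = 0" if "f \<in> P.inv_elems" "g \<in> P.inv_elems" for f g
  proof -
    have "f \<in> X.PF" "g \<in> X.PF" using that poly_generated by (auto simp: P.inv_elems_def)
    then show ?thesis using inv_derivative_zero[OF that(1)] X.ham(1)[of g 0] by (simp add: X.pb_eq)
  qed
  ultimately have "P.inv_brackets \<subseteq> {f. f 0 = 0}"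
    unfolding P.inv_brackets_def by (intro P.span_minimal) auto
  then show "f \<in> P.inv_brackets \<Longrightarrow> f 0 = 0" by blast
qed

end

section \<open>Spans in modules with explicit carrier, and algebras of operators\<close>

lemma (in vector_space) a_inv_eq:
  assumes "subspace (carrier M)" "add M = (+)" "zero M = 0" "a \<in> carrier M"
  shows "m_inv (add_monoid M) a = - a"
  unfolding m_inv_def
proof (rule the_equality)
  show "- a \<in> carrier (add_monoid M) \<and> a \<otimes>\<^bsub>add_monoid M\<^esub> - a = \<one>\<^bsub>add_monoid M\<^esub> \<and>
      - a \<otimes>\<^bsub>add_monoid M\<^esub> a = \<one>\<^bsub>add_monoid M\<^esub>"
    using assms by (simp add: subspace_neg)
qed (use assms in \<open>auto simp: eq_neg_iff_add_eq_0 add.commute\<close>)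

text \<open>Submodules of a module whose carrier is a subspace are the subspaces contained in it;
  closure under inverses is closure under negation by \<open>a_inv_eq\<close>. So the two hulls
  agree.\<close>

lemma lin_span_eq:
  fixes M :: "(complex, 'b::ab_group_add, 'm) module_scheme"
  assumes vs: "vector_space sc"
    and M: "module.subspace sc (carrier M)" "add M = (+)" "zero M = 0" "smult M = sc"
    and S: "S \<subseteq> carrier M"
  shows "lin_span M S = module.span sc S"
proof -
  interpret vector_space sc by (rule vs)
  have sub: "submodule N complex_field M \<longleftrightarrow> N \<subseteq> carrier M \<and> subspace N" for N
  proof
    assume N: "submodule N complex_field M"
    then have "subgroup N (add_monoid M)" by (simp add: submodule_def)
    then have "N \<subseteq> carrier M" "0 \<in> N" "\<And>x y. x \<in> N \<Longrightarrow> y \<in> N \<Longrightarrow> x + y \<in> N"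
      using M by (auto simp: subgroup_def)
    moreover have "sc c x \<in> N" if "x \<in> N" for c x
      using N that M(4) by (auto simp: submodule_def submodule_axioms_def complex_field_def)
    ultimately show "N \<subseteq> carrier M \<and> subspace N" by (simp add: subspace_def)
  next
    assume N: "N \<subseteq> carrier M \<and> subspace N"
    then have "m_inv (add_monoid M) x \<in> N" if "x \<in> N" for x
      using that a_inv_eq[OF M(1-3), of x] subspace_neg[of N x] by auto
    then have "subgroup N (add_monoid M)"
      using N M by (auto simp: subgroup_def subspace_def)
    then show "submodule N complex_field M"
      using N M by (auto simp: submodule_def submodule_axioms_def subspace_def)
  qed
  show ?thesis
  proof
    show "lin_span M S \<subseteq> span S"
      unfolding lin_span_def using S M(1) span_superset[of S]
      by (intro hull_minimal) (auto simp: sub span_minimal[THEN subsetD])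
    show "span S \<subseteq> lin_span M S"
      unfolding lin_span_def hull_def
      by (rule Inter_greatest) (auto simp: sub intro: span_minimal[THEN subsetD])
  qed
qed

definition op_scale :: "complex \<Rightarrow> 'x fun_op \<Rightarrow> 'x fun_op" where
  "op_scale c a = (\<lambda>f. fun_scale c (a f))"

lemma op_scale_apply [simp]: "op_scale c a f = fun_scale c (a f)"
  by (simp add: op_scale_def)

lemma vector_space_op_scale: "vector_space op_scale"
  by unfold_locales (auto simp: fun_eq_iff algebra_simps)

lemma (in carrier_algebra) commutator_mul_left:
  assumes "a \<in> L" "b \<in> L" "c \<in> L"
  shows "a \<star> b \<star> c - c \<star> (a \<star> b) = a \<star> (b \<star> c - c \<star> b) + (a \<star> c - c \<star> a) \<star> b"
  using assms by (simp add: mul_diff_left mul_diff_right mul_assoc)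

context fun_space
begin

text \<open>Composition distributes over sums on the right only for additive operators, so the
  algebra has to be carved out of the full type. The value \<open>0\<close> off \<open>PF\<close> is
  what makes \<open>id_op\<close> a unit.\<close>

definition Lops :: "'x fun_op set" where
  "Lops = {a. (\<forall>f\<in>PF. a f \<in> PF) \<and> (\<forall>f. f \<notin> PF \<longrightarrow> a f = 0) \<and>
     (\<forall>f\<in>PF. \<forall>g\<in>PF. a (f + g) = a f + a g) \<and> (\<forall>c. \<forall>f\<in>PF. a (fun_scale c f) = fun_scale c (a f))}"

abbreviation id_op :: "'x fun_op" where "id_op \<equiv> mult_op s X (cst 1)"

lemma LopsD:
  assumes "a \<in> Lops"
  shows "f \<in> PF \<Longrightarrow> a f \<in> PF" "f \<notin> PF \<Longrightarrow> a f = 0"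
    "f \<in> PF \<Longrightarrow> g \<in> PF \<Longrightarrow> a (f + g) = a f + a g" "f \<in> PF \<Longrightarrow> a (fun_scale c f) = fun_scale c (a f)"
  using assms unfolding Lops_def by blast+

lemma LopsI:
  assumes "\<And>f. f \<in> PF \<Longrightarrow> a f \<in> PF" "\<And>f. f \<notin> PF \<Longrightarrow> a f = 0"
    "\<And>f g. f \<in> PF \<Longrightarrow> g \<in> PF \<Longrightarrow> a (f + g) = a f + a g"
    "\<And>c f. f \<in> PF \<Longrightarrow> a (fun_scale c f) = fun_scale c (a f)"
  shows "a \<in> Lops"
  using assms unfolding Lops_def by blast

lemma Lops_PF: "a \<in> Lops \<Longrightarrow> a f \<in> PF"
  using LopsD(1,2)[of a f] by (cases "f \<in> PF") auto

lemma Lops_zero [simp]: "a \<in> Lops \<Longrightarrow> a 0 = 0"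
proof -
  have "fun_scale 0 0 = (0 :: 'x \<Rightarrow> complex)" by (simp add: fun_eq_iff)
  moreover have "fun_scale 0 (a 0) = 0" by (simp add: fun_eq_iff)
  ultimately show "a \<in> Lops \<Longrightarrow> a 0 = 0" using LopsD(4)[of a 0 0] by simp
qed

lemma mult_op_Lops: "l \<in> PF \<Longrightarrow> mult_op s X l \<in> Lops"
proof -
  have "l * fun_scale c f = fun_scale c (l * f)" for c f by (simp add: fun_eq_iff)
  then show "l \<in> PF \<Longrightarrow> mult_op s X l \<in> Lops"
    by (intro LopsI) (simp_all add: mult_op_def distrib_left)
qed

lemma deriv_op_Lops: "u \<in> X \<Longrightarrow> deriv_op s X u \<in> Lops"
  by (rule LopsI) (simp_all add: deriv_op_def der_add der_scale)

lemma id_op_apply: "f \<in> PF \<Longrightarrow> id_op f = f"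
  by (simp add: mult_op_def)

lemma subspace_Lops: "module.subspace op_scale Lops"
proof -
  interpret O: vector_space op_scale by (rule vector_space_op_scale)
  show ?thesis
  proof (rule O.subspaceI)
    show "0 \<in> Lops" by (rule LopsI) (auto simp: fun_eq_iff)
  next
    fix a b assume ab: "a \<in> Lops" "b \<in> Lops"
    show "a + b \<in> Lops"
      by (rule LopsI) (use ab in \<open>auto simp: LopsD fun_eq_iff algebra_simps\<close>)
  next
    fix c a assume a: "a \<in> Lops"
    show "op_scale c a \<in> Lops"
      by (rule LopsI) (use a in \<open>auto simp: LopsD fun_eq_iff algebra_simps\<close>)
  qed
qed

lemma comp_Lops: "a \<in> Lops \<Longrightarrow> b \<in> Lops \<Longrightarrow> a \<circ> b \<in> Lops"
proof (rule LopsI)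
  fix f g assume "a \<in> Lops" "b \<in> Lops" "f \<in> PF" "g \<in> PF"
  then show "(a \<circ> b) (f + g) = (a \<circ> b) f + (a \<circ> b) g"
    by (simp only: comp_apply LopsD)
next
  fix c f assume "a \<in> Lops" "b \<in> Lops" "f \<in> PF"
  then show "(a \<circ> b) (fun_scale c f) = fun_scale c ((a \<circ> b) f)"
    by (simp only: comp_apply LopsD)
next
  fix f assume "a \<in> Lops" "b \<in> Lops" "f \<notin> PF"
  then have "b f = 0" by (intro LopsD(2))
  moreover have "a 0 = 0" by (rule Lops_zero[OF \<open>a \<in> Lops\<close>])
  ultimately show "(a \<circ> b) f = 0" by (simp only: comp_apply)
qed (simp add: LopsD)

lemma ops_algebra: "carrier_algebra op_scale Lops (\<circ>) id_op"
proof -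
  interpret O: vector_space op_scale by (rule vector_space_op_scale)
  show ?thesis
  proof (unfold_locales, goal_cases)
    case 1 show ?case by (rule subspace_Lops)
  next
    case 2 then show ?case by (rule comp_Lops)
  next
    case 3 show ?case by (simp add: mult_op_Lops)
  next
    case 4 show ?case by (simp add: fun_eq_iff)
  next
    case (5 a b c)
    then have "c (a f + b f) = c (a f) + c (b f)" for f by (intro LopsD(3) Lops_PF)
    moreover have "(c \<circ> (a + b)) f = c (a f + b f)" "((c \<circ> a) + (c \<circ> b)) f = c (a f) + c (b f)" for f
      by (simp_all only: comp_apply plus_fun_apply)
    ultimately show ?case by (intro ext) metis
  next
    case 6 show ?case by (simp add: fun_eq_iff)
  next
    case (7 a b k)
    then show ?case by (intro ext) (simp add: LopsD(4) Lops_PF)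
  next
    case 8 show ?case by (simp add: comp_assoc)
  next
    case (9 a)
    then show ?case by (intro ext) (simp add: id_op_apply Lops_PF)
  next
    case (10 a)
    have "a (id_op f) = a f" for f
    proof (cases "f \<in> PF")
      case False
      then have "id_op f = 0" by (simp add: mult_op_def)
      then show ?thesis using 10 False by (simp add: LopsD(2))
    qed (simp add: id_op_apply)
    then show ?case by (simp add: fun_eq_iff)
  qed
qed

lemma mult_op_add: "mult_op s X (f + g) = mult_op s X f + mult_op s X g"
  by (auto simp: mult_op_def fun_eq_iff algebra_simps)

lemma mult_op_scale: "mult_op s X (fun_scale c f) = op_scale c (mult_op s X f)"
  by (auto simp: mult_op_def fun_eq_iff)

lemma mult_op_zero: "mult_op s X 0 = 0"
  by (auto simp: mult_op_def fun_eq_iff)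

lemma deriv_op_add: "u \<in> X \<Longrightarrow> v \<in> X \<Longrightarrow> deriv_op s X (u + v) = deriv_op s X u + deriv_op s X v"
  by (rule ext) (simp add: deriv_op_def der_add_dir)

lemma deriv_op_scale: "u \<in> X \<Longrightarrow> deriv_op s X (s c u) = op_scale c (deriv_op s X u)"
  by (rule ext) (auto simp: deriv_op_def der_scale_dir fun_eq_iff)

lemma deriv_op_zero: "deriv_op s X 0 = 0"
  by (auto simp: deriv_op_def dir_deriv_def fun_eq_iff)

lemma mult_op_commute: "f \<in> PF \<Longrightarrow> g \<in> PF \<Longrightarrow> mult_op s X f \<circ> mult_op s X g = mult_op s X g \<circ> mult_op s X f"
  by (rule ext) (simp add: mult_op_def mult.left_commute)

lemma deriv_op_commute: "u \<in> X \<Longrightarrow> v \<in> X \<Longrightarrow> deriv_op s X u \<circ> deriv_op s X v = deriv_op s X v \<circ> deriv_op s X u"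
  by (rule ext) (simp add: deriv_op_def der_commute)

lemma deriv_mult_commutator:
  assumes "u \<in> X" "l \<in> LF"
  shows "(deriv_op s X u \<circ> mult_op s X l) - (mult_op s X l \<circ> deriv_op s X u) = op_scale (l u) id_op"
proof
  fix f
  have l: "l \<in> PF" using PF_lin[OF assms(2)] .
  show "((deriv_op s X u \<circ> mult_op s X l) - (mult_op s X l \<circ> deriv_op s X u)) f = op_scale (l u) id_op f"
  proof (cases "f \<in> PF")
    case True
    have "((deriv_op s X u \<circ> mult_op s X l) - (mult_op s X l \<circ> deriv_op s X u)) f =
        der u (l * f) - l * der u f"
    proof -
      have "(deriv_op s X u \<circ> mult_op s X l) f = der u (l * f)"
        "(mult_op s X l \<circ> deriv_op s X u) f = l * der u f"
        using True l assms by (simp_all add: deriv_op_def mult_op_def)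
      then show ?thesis by (simp only: minus_apply)
    qed
    also have "\<dots> = cst (l u) * f"
      by (subst der_mult[OF assms(1) l True], subst der_lin[OF assms]) (simp add: algebra_simps)
    finally show ?thesis using True by (simp add: id_op_apply fun_scale_PF)
  next
    case False
    then show ?thesis using l assms by (auto simp: deriv_op_def mult_op_def fun_eq_iff)
  qed
qed

lemma lin_span_ops: "lin_span (op_algebra s X) S = module.span op_scale S"
proof -
  interpret O: vector_space op_scale by (rule vector_space_op_scale)
  show ?thesis
    by (rule lin_span_eq[OF O.vector_space_axioms]) (auto simp: op_algebra_def op_scale_def fun_scale_def fun_eq_iff)
qed

lemma weyl_gens_Lops: "weyl_gens s X \<subseteq> Lops"
  by (auto simp: weyl_gens_def mult_op_Lops deriv_op_Lops PF_lin)

lemma bernstein_eq: "bernstein s X k = carrier_algebra.word_filt op_scale (\<circ>) id_op (weyl_gens s X) k"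
proof -
  interpret A: carrier_algebra op_scale Lops "(\<circ>)" id_op by (rule ops_algebra)
  have "{foldr (\<circ>) gs (one (op_algebra s X)) |gs. set gs \<subseteq> weyl_gens s X \<and> length gs \<le> k} =
      A.word ` {gs. set gs \<subseteq> weyl_gens s X \<and> length gs \<le> k}"
    by (auto simp: A.word_def op_algebra_def)
  then show ?thesis by (simp add: bernstein_def A.word_filt_def lin_span_ops)
qed

end

section \<open>Permutations acting on operators\<close>

lemma perm_op_add: "perm_op p (a + b) = perm_op p a + perm_op p b"
  by (simp add: perm_op_def perm_fun_add fun_eq_iff)

lemma perm_op_scale: "perm_op p (op_scale c a) = op_scale c (perm_op p a)"
  by (simp add: perm_op_def perm_fun_scale fun_eq_iff)

lemma perm_fun_inv:
  assumes "p permutes {..n}"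
  shows "perm_fun (inv_into UNIV p) (perm_fun p f) = f" "perm_fun p (perm_fun (inv_into UNIV p) f) = f"
  using permutes_inv_o[OF assms] by (simp_all add: perm_fun_comp) (simp_all add: perm_fun_def)

lemma perm_op_mul:
  assumes "p permutes {..n}" shows "perm_op p (a \<circ> b) = perm_op p a \<circ> perm_op p b"
  by (simp add: perm_op_def fun_eq_iff perm_fun_inv[OF assms])

lemma perm_op_diff: "perm_op p (a - b) = perm_op p a - perm_op p b"
  by (auto simp: perm_op_def perm_fun_def fun_eq_iff)

lemma perm_op_comp:
  assumes "p permutes {..n}" "q permutes {..n}" shows "perm_op p (perm_op q a) = perm_op (p \<circ> q) a"
proof -
  have "inv_into UNIV (p \<circ> q) = inv_into UNIV q \<circ> inv_into UNIV p"
    using assms permutes_bij by (intro o_inv_distrib) auto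
  then show ?thesis by (intro ext) (simp only: perm_op_def perm_fun_comp)
qed

lemma perm_fun_poly_iff:
  assumes "p permutes {..n}"
  shows "perm_fun p f \<in> poly_funs (tuple_scale s) (refl_tensor n S) \<longleftrightarrow>
    f \<in> poly_funs (tuple_scale s) (refl_tensor n S)"
  using perm_fun_poly[OF assms, of f s S] perm_fun_poly[OF permutes_inv[OF assms], of "perm_fun p f" s S]
    perm_fun_inv[OF assms] by metis

lemma perm_op_mult_op:
  assumes "p permutes {..n}"
  shows "perm_op p (mult_op (tuple_scale s) (refl_tensor n S) l) =
    mult_op (tuple_scale s) (refl_tensor n S) (perm_fun p l)"
proof
  fix f
  show "perm_op p (mult_op (tuple_scale s) (refl_tensor n S) l) f =
    mult_op (tuple_scale s) (refl_tensor n S) (perm_fun p l) f"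
    using perm_fun_poly_iff[OF permutes_inv[OF assms], of f s S] perm_fun_inv(2)[OF assms, of f]
    by (auto simp: perm_op_def mult_op_def perm_fun_mult) (auto simp: perm_fun_def)
qed

lemma perm_op_deriv_op:
  assumes p: "p permutes {..n}"
  shows "perm_op p (deriv_op (tuple_scale s) (refl_tensor n S) u) =
    deriv_op (tuple_scale s) (refl_tensor n S) (u \<circ> inv_into UNIV p)"
proof
  fix f
  let ?p' = "inv_into UNIV p"
  have "((v \<circ> p) + tuple_scale s t u) \<circ> ?p' = v + tuple_scale s t (u \<circ> ?p')" for v t
  proof
    fix i
    have "p (?p' i) = i" using permutes_inverses(1)[OF p] .
    then show "(((v \<circ> p) + tuple_scale s t u) \<circ> ?p') i = (v + tuple_scale s t (u \<circ> ?p')) i"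
      by (simp add: tuple_scale_def)
  qed
  then have "perm_fun p (dir_deriv (tuple_scale s) (refl_tensor n S) u (perm_fun ?p' f)) =
      dir_deriv (tuple_scale s) (refl_tensor n S) (u \<circ> ?p') f"
    by (intro ext) (simp only: perm_fun_def dir_deriv_def refl_comp_perm[OF p])
  then show "perm_op p (deriv_op (tuple_scale s) (refl_tensor n S) u) f =
    deriv_op (tuple_scale s) (refl_tensor n S) (u \<circ> ?p') f"
    using perm_fun_poly_iff[OF permutes_inv[OF p], of f s S]
    by (auto simp: perm_op_def deriv_op_def) (auto simp: perm_fun_def)
qed

section \<open>The Weyl algebra and its linear generators\<close>

locale weyl_setup = symplectic_vs s \<omega> n
  for s :: "complex \<Rightarrow> 'v::ab_group_add \<Rightarrow> 'v" and \<omega> n +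
  fixes U W :: "'v set"
  assumes lagU: "lagrangian s \<omega> U" and complW: "lagrangian_complement s \<omega> U W"
begin

lemma subspace_U: "V.subspace U" using lagU by (simp add: lagrangian_def)
lemma subspace_W: "V.subspace W"
  using complW by (simp add: lagrangian_complement_def lagrangian_def)

lemma om_UU: "u \<in> U \<Longrightarrow> u' \<in> U \<Longrightarrow> \<omega> u u' = 0" using lagU by (auto simp: lagrangian_def)
lemma om_WW: "u \<in> W \<Longrightarrow> u' \<in> W \<Longrightarrow> \<omega> u u' = 0"
  using complW by (auto simp: lagrangian_complement_def lagrangian_def)
lemma W_perp: "(\<And>w. w \<in> W \<Longrightarrow> \<omega> u w = 0) \<Longrightarrow> u \<in> W"
  using complW by (auto simp: lagrangian_complement_def lagrangian_def)

abbreviation \<pi> :: "'v \<Rightarrow> 'v" where "\<pi> \<equiv> proj_along U W"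

lemma proj_eq: "u \<in> U \<Longrightarrow> v - u \<in> W \<Longrightarrow> \<pi> v = u"
  unfolding proj_along_def
proof (rule the_equality)
  fix u' assume u: "u \<in> U" "v - u \<in> W" and u': "u' \<in> U \<and> v - u' \<in> W"
  have "u' - u \<in> U" using u u' V.subspace_diff[OF subspace_U] by blast
  moreover have "(v - u) - (v - u') \<in> W" using u u' V.subspace_diff[OF subspace_W] by blast
  ultimately have "u' - u \<in> U \<inter> W" by simp
  then have "u' - u \<in> {0}" using complW unfolding lagrangian_complement_def by blast
  then show "u' = u" by simp
qed simp

lemma proj: "\<pi> v \<in> U" "v - \<pi> v \<in> W"
proof -
  obtain u w where "u \<in> U" "w \<in> W" "v = u + w"
    using complW unfolding lagrangian_complement_def by meson
  moreover from this have "\<pi> v = u" by (intro proj_eq) auto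
  ultimately show "\<pi> v \<in> U" "v - \<pi> v \<in> W" by auto
qed

lemma proj_add: "\<pi> (u + v) = \<pi> u + \<pi> v"
proof (rule proj_eq)
  have "(u - \<pi> u) + (v - \<pi> v) \<in> W" by (intro V.subspace_add[OF subspace_W] proj)
  then show "u + v - (\<pi> u + \<pi> v) \<in> W" by (simp add: algebra_simps)
qed (intro V.subspace_add[OF subspace_U] proj)

lemma proj_scale: "\<pi> (s c u) = s c (\<pi> u)"
proof (rule proj_eq)
  have "s c (u - \<pi> u) \<in> W" by (intro V.subspace_scale[OF subspace_W] proj)
  then show "s c u - s c (\<pi> u) \<in> W" by (simp add: V.scale_right_diff_distrib)
qed (intro V.subspace_scale[OF subspace_U] proj)

lemma proj_U: "u \<in> U \<Longrightarrow> \<pi> u = u"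
  using V.subspace_0[OF subspace_W] by (intro proj_eq) auto

lemma proj_W: "w \<in> W \<Longrightarrow> \<pi> w = 0"
  using V.subspace_0[OF subspace_U] by (intro proj_eq) auto

abbreviation YX :: "(nat \<Rightarrow> 'v) set" where "YX \<equiv> refl_tensor n U"

sublocale Y: fun_space ts YX
proof -
  interpret T: vector_space ts by (rule vector_space_ts)
  show "fun_space ts YX" by unfold_locales (rule subspace_refl[OF subspace_U])
qed

sublocale A: carrier_algebra op_scale Y.Lops "(\<circ>)" Y.id_op
  by (rule Y.ops_algebra)

definition \<xi> :: "'v \<Rightarrow> nat \<Rightarrow> (nat \<Rightarrow> 'v) \<Rightarrow> complex" where
  "\<xi> u i = (\<lambda>v. if v \<in> YX then \<omega> u (v i) else 0)"

abbreviation M :: "((nat \<Rightarrow> 'v) \<Rightarrow> complex) \<Rightarrow> (nat \<Rightarrow> 'v) fun_op" where "M \<equiv> mult_op ts YX"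
abbreviation D :: "(nat \<Rightarrow> 'v) \<Rightarrow> (nat \<Rightarrow> 'v) fun_op" where "D \<equiv> deriv_op ts YX"

lemma xi_lin: "\<xi> u i \<in> Y.LF"
proof -
  have "\<omega> u (ts c x i) = c * \<omega> u (x i)" for c x by (simp add: tuple_scale_def om_lin)
  then show ?thesis by (auto simp: \<xi>_def lin_funs_def om_lin)
qed

lemma xi_PF: "\<xi> u i \<in> Y.PF" by (rule Y.PF_lin[OF xi_lin])

lemma etup_YX: "i \<le> n \<Longrightarrow> u \<in> U \<Longrightarrow> etup i u \<in> YX"
  by (rule etup_refl[OF subspace_U])

text \<open>The sign makes the commutators of the \<open>xw u i\<close> agree with the Poisson brackets of the \<open>x u i\<close>.\<close>

definition xw :: "'v \<Rightarrow> nat \<Rightarrow> (nat \<Rightarrow> 'v) fun_op" where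
  "xw u i = M (\<xi> (u - \<pi> u) i) - D (etup i (\<pi> u))"

definition cm :: "(nat \<Rightarrow> 'v) fun_op \<Rightarrow> (nat \<Rightarrow> 'v) fun_op \<Rightarrow> (nat \<Rightarrow> 'v) fun_op" where
  "cm a b = (a \<circ> b) - (b \<circ> a)"

lemma M_Lops [simp]: "M (\<xi> u i) \<in> Y.Lops" by (rule Y.mult_op_Lops[OF xi_PF])

lemma D_Lops [simp]: "i \<le> n \<Longrightarrow> D (etup i (\<pi> u)) \<in> Y.Lops"
  by (rule Y.deriv_op_Lops[OF etup_YX[OF _ proj(1)]])

lemma M_xi_add: "M (\<xi> (u + v) i) = M (\<xi> u i) + M (\<xi> v i)"
proof -
  have "\<xi> (u + v) i = \<xi> u i + \<xi> v i" by (auto simp: \<xi>_def om_lin fun_eq_iff)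
  then show ?thesis by (simp only: Y.mult_op_add)
qed

lemma M_xi_scale: "M (\<xi> (s c u) i) = op_scale c (M (\<xi> u i))"
proof -
  have "\<xi> (s c u) i = fun_scale c (\<xi> u i)" by (auto simp: \<xi>_def om_lin fun_eq_iff)
  then show ?thesis by (simp only: Y.mult_op_scale)
qed

lemma cm_add_left: "a \<in> Y.Lops \<Longrightarrow> b \<in> Y.Lops \<Longrightarrow> c \<in> Y.Lops \<Longrightarrow> cm (a + b) c = cm a c + cm b c"
  by (simp add: cm_def A.mul_add_left A.mul_add_right)

lemma cm_scale_left: "a \<in> Y.Lops \<Longrightarrow> b \<in> Y.Lops \<Longrightarrow> cm (op_scale k a) b = op_scale k (cm a b)"
  by (simp add: cm_def A.mul_scale_left A.mul_scale_right A.scale_right_diff_distrib)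

lemma cm_diff:
  assumes "a \<in> Y.Lops" "b \<in> Y.Lops" "c \<in> Y.Lops" "d \<in> Y.Lops"
  shows "cm (a - b) (c - d) = cm a c - cm a d - cm b c + cm b d"
  using assms by (simp add: cm_def A.mul_diff_left A.mul_diff_right)

text \<open>Multiplications commute with each other, and so do derivatives. The two mixed terms add
  up to \<open>\<omega> u v\<close>, because \<open>\<omega>\<close> vanishes on \<open>U\<close>
  and on \<open>W\<close> and so sees only the cross terms of \<open>u\<close> and
  \<open>v\<close>.\<close>

lemma cm_xw:
  assumes "i \<le> n" "j \<le> n"
  shows "cm (xw u i) (xw v j) =
    op_scale (\<omega> u v * ((if i = j then 1 else 0) - 1 / of_nat (Suc n))) Y.id_op"
proof -
  define d :: "nat \<Rightarrow> nat \<Rightarrow> complex"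
    where "d i j = (if i = j then 1 else 0) - 1 / of_nat (Suc n)" for i j
  have MM: "cm (M (\<xi> a i)) (M (\<xi> b j)) = 0" for a b
    unfolding cm_def using Y.mult_op_commute[OF xi_PF xi_PF] by simp
  have DD: "cm (D (etup i (\<pi> a))) (D (etup j (\<pi> b))) = 0" for a b
    unfolding cm_def using Y.deriv_op_commute etup_YX assms proj by simp
  have DM: "cm (D (etup i (\<pi> a))) (M (\<xi> b j)) = op_scale (\<omega> b (\<pi> a) * d i j) Y.id_op"
    if ij: "i \<le> n" "j \<le> n" for a b i j
  proof -
    have "cm (D (etup i (\<pi> a))) (M (\<xi> b j)) = op_scale (\<xi> b j (etup i (\<pi> a))) Y.id_op"
      unfolding cm_def using ij proj by (intro Y.deriv_mult_commutator etup_YX xi_lin)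
    also have "\<xi> b j (etup i (\<pi> a)) = \<omega> b (\<pi> a) * d i j"
      using ij etup_YX[OF ij(1) proj(1), of a] by (simp add: \<xi>_def etup_def om_lin d_def)
    finally show ?thesis .
  qed
  have MD: "cm (M (\<xi> a i)) (D (etup j (\<pi> b))) = - op_scale (\<omega> a (\<pi> b) * d i j) Y.id_op" for a b
    using DM[OF assms(2,1), of b a] by (simp add: cm_def d_def eq_commute[of j i] algebra_simps)
  have "cm (xw u i) (xw v j) = op_scale (\<omega> (u - \<pi> u) (\<pi> v) * d i j) Y.id_op
      - op_scale (\<omega> (v - \<pi> v) (\<pi> u) * d i j) Y.id_op"
    unfolding xw_def using assms
    by (subst cm_diff) (simp_all add: MM DD MD DM[OF assms])
  also have "\<dots> = op_scale ((\<omega> (u - \<pi> u) (\<pi> v) - \<omega> (v - \<pi> v) (\<pi> u)) * d i j) Y.id_op"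
    by (simp only: A.scale_left_diff_distrib left_diff_distrib)
  also have "\<omega> (u - \<pi> u) (\<pi> v) - \<omega> (v - \<pi> v) (\<pi> u) = \<omega> u v"
  proof -
    have "\<omega> (\<pi> u + (u - \<pi> u)) (\<pi> v + (v - \<pi> v)) = \<omega> (\<pi> u) (v - \<pi> v) + \<omega> (u - \<pi> u) (\<pi> v)"
      by (simp only: om_lin om_UU[OF proj(1) proj(1)] om_WW[OF proj(2) proj(2)]) simp
    then show ?thesis using om_antisym[of "\<pi> u" "v - \<pi> v"] by simp
  qed
  finally show ?thesis by (simp only: d_def)
qed

lemma xw_Lops: "i \<le> n \<Longrightarrow> xw u i \<in> Y.Lops"
  by (simp add: xw_def)

lemma sum_M: "finite S \<Longrightarrow> (\<Sum>i\<in>S. M (f i)) = M (\<Sum>i\<in>S. f i)"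
  by (induction S rule: finite_induct) (simp_all add: Y.mult_op_add Y.mult_op_zero
      del: plus_fun_apply zero_fun_apply)

lemma sum_D: "finite S \<Longrightarrow> (\<And>i. i \<in> S \<Longrightarrow> f i \<in> YX) \<Longrightarrow> (\<Sum>i\<in>S. D (f i)) = D (\<Sum>i\<in>S. f i)"
proof (induction S rule: finite_induct)
  case (insert i S)
  then have "sum f S \<in> YX" by (intro X.subspace_sum[OF Y.subspace_X]) auto
  then show ?case using insert by (simp add: Y.deriv_op_add del: plus_fun_apply)
qed (simp add: Y.deriv_op_zero)

lemma xw_sum: "(\<Sum>i\<le>n. xw u i) = 0"
proof -
  have "(\<Sum>i\<le>n. \<xi> w i) = 0" for w
  proof
    fix v show "(\<Sum>i\<le>n. \<xi> w i) v = 0 v"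
    proof (cases "v \<in> YX")
      case True
      then have "(\<Sum>i\<le>n. \<xi> w i) v = \<omega> w (\<Sum>i\<le>n. v i)"
        by (simp add: sum_fun_apply \<xi>_def om_sum)
      then show ?thesis using True by (simp add: refl_tensor_def)
    qed (simp add: sum_fun_apply \<xi>_def)
  qed
  then have "(\<Sum>i\<le>n. M (\<xi> w i)) = 0" for w by (simp add: sum_M Y.mult_op_zero)
  moreover have "(\<Sum>i\<le>n. D (etup i (\<pi> u))) = 0"
    using etup_YX proj by (subst sum_D) (auto simp: sum_etup_const Y.deriv_op_zero)
  ultimately show ?thesis by (simp add: xw_def sum_subtractf)
qed

lemma etup_comp_inv:
  assumes "p permutes {..n}" "i \<le> n" shows "etup i u \<circ> inv_into UNIV p = etup (p i) u"
proof
  fix j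
  have "inv_into UNIV p j \<le> n \<longleftrightarrow> j \<le> n"
    using permutes_in_image[OF permutes_inv[OF assms(1)], of j] by simp
  moreover have "i = inv_into UNIV p j \<longleftrightarrow> p i = j"
    using permutes_inverses[OF assms(1)] by metis
  ultimately show "(etup i u \<circ> inv_into UNIV p) j = etup (p i) u j"
    by (simp add: etup_def)
qed

lemma perm_xw:
  assumes p: "p permutes {..n}" and i: "i \<le> n" shows "perm_op p (xw u i) = xw u (p i)"
proof -
  have "perm_fun p (\<xi> w i) = \<xi> w (p i)" for w
    by (auto simp: perm_fun_def \<xi>_def refl_comp_perm[OF p])
  then show ?thesis
    by (simp only: xw_def perm_op_diff perm_op_mult_op[OF p] perm_op_deriv_op[OF p] etup_comp_inv[OF p i])
qed

lemma perm_Lops: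
  assumes p: "p permutes {..n}" and a: "a \<in> Y.Lops" shows "perm_op p a \<in> Y.Lops"
proof -
  let ?p' = "inv_into UNIV p"
  have PF: "perm_fun ?p' f \<in> Y.PF \<longleftrightarrow> f \<in> Y.PF" for f
    by (rule perm_fun_poly_iff[OF permutes_inv[OF p]])
  have z: "perm_fun p 0 = 0" by (simp add: perm_fun_def zero_fun_def)
  show ?thesis
  proof (rule Y.LopsI)
    fix f g assume "f \<in> Y.PF" "g \<in> Y.PF"
    then show "perm_op p a (f + g) = perm_op p a f + perm_op p a g"
      using PF by (simp only: perm_op_def perm_fun_add Y.LopsD(3)[OF a])
  next
    fix f c assume "f \<in> Y.PF"
    then show "perm_op p a (fun_scale c f) = fun_scale c (perm_op p a f)"
      using PF by (simp only: perm_op_def perm_fun_scale Y.LopsD(4)[OF a])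
  next
    fix f assume "f \<notin> Y.PF"
    then have "a (perm_fun ?p' f) = 0" using PF Y.LopsD(2)[OF a] by blast
    then show "perm_op p a f = 0" by (simp only: perm_op_def z)
  next
    fix f show "perm_op p a f \<in> Y.PF"
      unfolding perm_op_def by (intro perm_fun_poly[OF p] Y.Lops_PF[OF a])
  qed
qed

sublocale Q: biderivation_algebra op_scale Y.Lops "(\<circ>)" Y.id_op 1 cm n s \<omega> xw perm_op
proof (unfold_locales, goal_cases)
  case 1 then show ?case by (simp add: cm_def)
next
  case (2 a b) show ?case by (simp add: cm_def)
next
  case 3 then show ?case by (rule cm_add_left)
next
  case 4 then show ?case by (rule cm_scale_left)
next
  case 5 then show ?case unfolding cm_def by (rule A.commutator_mul_left)
next
  case 6 show ?case by (simp add: cm_def)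
next
  case 7 show ?case by (rule om_lin)
next
  case 8 show ?case by (rule om_lin)
next
  case 9 show ?case by simp
next
  case 10 then show ?case using om_nondeg om_antisym by (metis neg_equal_0_iff_equal)
next
  case 11 then show ?case by (rule xw_Lops)
next
  case (12 i u v)
  have "u + v - \<pi> (u + v) = (u - \<pi> u) + (v - \<pi> v)" by (simp add: proj_add)
  then show ?case using 12 etup_YX proj
    by (simp only: xw_def M_xi_add) (simp add: proj_add etup_add Y.deriv_op_add)
next
  case (13 i k u)
  have "s k u - \<pi> (s k u) = s k (u - \<pi> u)" by (simp add: proj_scale V.scale_right_diff_distrib)
  then show ?case using 13 etup_YX proj
    by (simp only: xw_def M_xi_scale) (simp add: proj_scale etup_scale Y.deriv_op_scale A.scale_right_diff_distrib)
next
  case 14 show ?case by (rule xw_sum)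
next
  case 15 then show ?case by (rule cm_xw)
next
  case 16 then show ?case by (rule perm_Lops)
next
  case 17 show ?case by (rule perm_op_add)
next
  case 18 show ?case by (rule perm_op_scale)
next
  case 19 then show ?case by (simp add: perm_op_mult_op perm_fun_const)
next
  case 20 then show ?case by (intro perm_op_mul)
next
  case 21 then show ?case by (simp add: cm_def perm_op_diff perm_op_mul)
next
  case 22 then show ?case by (intro perm_op_comp)
next
  case 23 then show ?case by (rule perm_xw)
qed

text \<open>Extending \<open>l\<close> by \<open>\<pi>\<close> gives functionals on \<open>V\<close>
  that vanish on \<open>W\<close>; their representing vectors lie in the symplectic complement of
  \<open>W\<close>, which is \<open>W\<close> itself. For such vectors \<open>xw\<close> has no
  derivative part.\<close>

lemma lin_fun_expand:
  assumes "l \<in> Y.LF"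
  shows "\<exists>w. (\<forall>i\<le>n. w i \<in> W) \<and> l = (\<Sum>i\<le>n. \<xi> (w i) i)"
proof -
  have "\<exists>w. \<forall>a. l (etup i (\<pi> a)) = \<omega> w a" if "i \<le> n" for i
    using assms etup_YX[OF that proj(1)]
    by (intro om_riesz) (auto simp: lin_funs_def etup_add etup_scale proj_add proj_scale)
  then have "\<forall>i. \<exists>w. i \<le> n \<longrightarrow> (\<forall>a. l (etup i (\<pi> a)) = \<omega> w a)" by blast
  from choice[OF this] obtain w where w: "\<And>i a. i \<le> n \<Longrightarrow> l (etup i (\<pi> a)) = \<omega> (w i) a" by blast
  have "etup i 0 = 0" for i by (simp add: etup_def fun_eq_iff)
  moreover have "l 0 = 0" using lin_fun_sum[OF assms subspace_U, of "{}"] by simp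
  ultimately have "\<omega> (w i) a = 0" if "i \<le> n" "a \<in> W" for i a
    using w[OF that(1), of a] proj_W[OF that(2)] by simp
  then have "w i \<in> W" if "i \<le> n" for i using W_perp that by blast
  moreover have "l = (\<Sum>i\<le>n. \<xi> (w i) i)"
  proof
    fix v
    show "l v = (\<Sum>i\<le>n. \<xi> (w i) i) v"
    proof (cases "v \<in> YX")
      case True
      then have vU: "v i \<in> U" if "i \<le> n" for i using that by (simp add: refl_tensor_def)
      have "l v = l (\<Sum>i\<le>n. etup i (v i))" using refl_expand[OF True] by simp
      also have "\<dots> = (\<Sum>i\<le>n. l (etup i (v i)))"
        using etup_YX vU by (intro lin_fun_sum[OF assms subspace_U]) auto
      also have "\<dots> = (\<Sum>i\<le>n. \<omega> (w i) (v i))"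
        using w proj_U[OF vU] by (intro sum.cong) (auto, metis)
      finally show ?thesis using True by (simp add: sum_fun_apply \<xi>_def)
    qed (use assms in \<open>simp add: sum_fun_apply \<xi>_def lin_funs_def\<close>)
  qed
  ultimately show ?thesis by blast
qed

text \<open>\<open>xw u i\<close> is a pure multiplication for \<open>u\<close> in \<open>W\<close>
  and minus a pure derivative for \<open>u\<close> in \<open>U\<close>, so both kinds of Weyl
  generators are reached.\<close>

lemma weyl_gens_span: "weyl_gens ts YX \<subseteq> A.span Q.W"
proof
  fix a assume "a \<in> weyl_gens ts YX"
  then consider l where "l \<in> Y.LF" "a = M l" | u where "u \<in> YX" "a = D u"
    by (auto simp: weyl_gens_def)
  then show "a \<in> A.span Q.W"
  proof cases
    case 1
    obtain w where w: "\<And>i. i \<le> n \<Longrightarrow> w i \<in> W" "l = (\<Sum>i\<le>n. \<xi> (w i) i)"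
      using lin_fun_expand[OF 1(1)] by blast
    have "etup i 0 = 0" for i by (simp add: etup_def fun_eq_iff)
    then have "M (\<xi> (w i) i) = xw (w i) i" if "i \<le> n" for i
      using proj_W[OF w(1)[OF that]] by (simp add: xw_def Y.deriv_op_zero)
    then have "a = (\<Sum>i\<le>n. xw (w i) i)" using 1 w(2) by (simp add: sum_M[symmetric])
    also have "\<dots> \<in> A.span Q.W" by (intro A.span_sum Q.x_span_W) simp
    finally show ?thesis .
  next
    case 2
    then have uU: "u i \<in> U" if "i \<le> n" for i using that by (simp add: refl_tensor_def)
    have "\<xi> 0 i = 0" for i by (simp add: \<xi>_def fun_eq_iff)
    then have "D (etup i (u i)) = - xw (u i) i" if "i \<le> n" for i
      using proj_U[OF uU[OF that]] by (simp add: xw_def Y.mult_op_zero)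
    moreover have "a = (\<Sum>i\<le>n. D (etup i (u i)))"
      using 2 refl_expand[OF 2(1)] etup_YX uU by (subst sum_D) auto
    ultimately have "a = (\<Sum>i\<le>n. - xw (u i) i)" by simp
    also have "\<dots> \<in> A.span Q.W" by (intro A.span_sum A.span_neg Q.x_span_W) simp
    finally show ?thesis .
  qed
qed

lemma W_span_weyl_gens: "Q.W \<subseteq> A.span (weyl_gens ts YX)"
proof -
  have "xw u i \<in> A.span (weyl_gens ts YX)" if "i \<le> n" for u i
    unfolding xw_def
    by (intro A.span_diff A.span_base) (use that xi_lin etup_YX proj in \<open>auto simp: weyl_gens_def\<close>)
  then show ?thesis by (auto simp: Q.W_def Q.w_def intro: A.span_diff)
qed

lemma bernstein_Fl: "bernstein ts YX k = Q.Fl k"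
  unfolding Y.bernstein_eq
  using A.word_filt_gens[OF Q.W_L weyl_gens_span] A.word_filt_gens[OF Y.weyl_gens_Lops W_span_weyl_gens]
  by blast

lemma weyl_Bt: "(\<Union>k. bernstein ts YX k) = Q.Bt"
  by (simp add: bernstein_Fl Q.Bt_def)

end

section \<open>Power series that are regular at 1\<close>

text \<open>\<open>F\<close> is the expansion of a rational function \<open>P / Q\<close> that is defined at \<open>1\<close> and has the value \<open>v\<close> there.\<close>

definition regular_at_1 :: "complex fps \<Rightarrow> complex \<Rightarrow> bool" where
  "regular_at_1 F v \<longleftrightarrow> (\<exists>P Q. poly Q 1 \<noteq> 0 \<and> fps_of_poly Q * F = fps_of_poly P \<and> v * poly Q 1 = poly P 1)"

lemma regular_at_1_unique:
  assumes "regular_at_1 F v" "regular_at_1 F w" shows "v = w"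
proof -
  obtain P Q where 1: "poly Q 1 \<noteq> 0" "fps_of_poly Q * F = fps_of_poly P" "v * poly Q 1 = poly P 1"
    using assms(1) by (auto simp: regular_at_1_def)
  obtain P' Q' where 2: "poly Q' 1 \<noteq> 0" "fps_of_poly Q' * F = fps_of_poly P'" "w * poly Q' 1 = poly P' 1"
    using assms(2) by (auto simp: regular_at_1_def)
  have "fps_of_poly (Q' * P) = fps_of_poly (Q * P')"
    unfolding fps_of_poly_mult 1(2)[symmetric] 2(2)[symmetric] by (simp add: mult_ac)
  then have "Q' * P = Q * P'" by (simp only: fps_of_poly_eq_iff)
  then have "poly Q' 1 * poly P 1 = poly Q 1 * poly P' 1" by (metis poly_mult)
  then have "poly Q' 1 * poly Q 1 * v = poly Q' 1 * poly Q 1 * w"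
    using 1(3) 2(3) by (metis mult.assoc mult.commute)
  then show ?thesis using 1(1) 2(1) by simp
qed

lemma regular_at_1_add:
  assumes "regular_at_1 F v" "regular_at_1 G w" shows "regular_at_1 (F + G) (v + w)"
proof -
  obtain P Q where 1: "poly Q 1 \<noteq> 0" "fps_of_poly Q * F = fps_of_poly P" "v * poly Q 1 = poly P 1"
    using assms(1) by (auto simp: regular_at_1_def)
  obtain P' Q' where 2: "poly Q' 1 \<noteq> 0" "fps_of_poly Q' * G = fps_of_poly P'" "w * poly Q' 1 = poly P' 1"
    using assms(2) by (auto simp: regular_at_1_def)
  have "fps_of_poly (Q * Q') * (F + G) = fps_of_poly (Q' * P + Q * P')"
    unfolding fps_of_poly_mult fps_of_poly_add 1(2)[symmetric] 2(2)[symmetric] by (simp add: algebra_simps)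
  moreover have "(v + w) * poly (Q * Q') 1 = poly (Q' * P + Q * P') 1"
    by (simp add: algebra_simps flip: 1(3) 2(3))
  ultimately show ?thesis using 1(1) 2(1) unfolding regular_at_1_def
    by (intro exI[of _ "Q' * P + Q * P'"] exI[of _ "Q * Q'"]) auto
qed

lemma regular_at_1_mult:
  assumes "regular_at_1 F v" shows "regular_at_1 (fps_of_poly R * F) (poly R 1 * v)"
proof -
  obtain P Q where 1: "poly Q 1 \<noteq> 0" "fps_of_poly Q * F = fps_of_poly P" "v * poly Q 1 = poly P 1"
    using assms(1) by (auto simp: regular_at_1_def)
  have "fps_of_poly Q * (fps_of_poly R * F) = fps_of_poly (R * P)"
    unfolding fps_of_poly_mult 1(2)[symmetric] by (simp add: mult_ac)
  then show ?thesis using 1 unfolding regular_at_1_def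
    by (intro exI[of _ "R * P"] exI[of _ Q]) (auto simp flip: 1(3))
qed

lemma regular_at_1_div:
  assumes "regular_at_1 (fps_of_poly R * F) v" "poly R 1 \<noteq> 0" shows "\<exists>w. regular_at_1 F w"
proof -
  obtain P Q where 1: "poly Q 1 \<noteq> 0" "fps_of_poly Q * (fps_of_poly R * F) = fps_of_poly P"
    using assms(1) by (auto simp: regular_at_1_def)
  then have "fps_of_poly (Q * R) * F = fps_of_poly P" by (simp add: fps_of_poly_mult mult_ac)
  then show ?thesis using 1 assms(2) unfolding regular_at_1_def
    by (intro exI[of _ "poly P 1 / poly (Q * R) 1"] exI[of _ P] exI[of _ "Q * R"]) auto
qed

lemma regular_at_1_scale: "regular_at_1 F v \<Longrightarrow> regular_at_1 (fps_const c * F) (c * v)"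
  using regular_at_1_mult[of F v "[:c:]"] by (simp add: fps_of_poly_const)

lemma regular_at_1_zero: "regular_at_1 0 0"
  unfolding regular_at_1_def by (intro exI[of _ 0] exI[of _ 1]) auto

lemma fps_of_poly_linear_factor: "fps_of_poly [:1, - c:] = 1 - fps_const c * fps_X" for c :: complex
  by (rule fps_ext) (auto simp: coeff_pCons fps_X_nth split: nat.splits)

lemma fps_nth_shift_mult:
  "fps_nth (fps_of_poly [:0, c:] * F) k = (case k of 0 \<Rightarrow> 0 | Suc k' \<Rightarrow> c * fps_nth F k')"
  for c :: complex
proof -
  have eq: "fps_of_poly [:0, c:] = fps_const c * fps_X"
    by (simp add: fps_of_poly_pCons fps_of_poly_const)
  show ?thesis unfolding eq mult.assoc by (cases k) simp_all
qed

section \<open>Multisets of fixed size\<close>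

definition msets :: "'i set \<Rightarrow> nat \<Rightarrow> 'i multiset set" where
  "msets I k = {\<beta>. set_mset \<beta> \<subseteq> I \<and> size \<beta> = k}"

lemma finite_msets: "finite I \<Longrightarrow> finite (msets I k)"
proof -
  assume "finite I"
  then have "finite (mset ` {xs. set xs \<subseteq> I \<and> length xs = k})"
    by (intro finite_imageI finite_lists_length_eq)
  moreover have "msets I k \<subseteq> mset ` {xs. set xs \<subseteq> I \<and> length xs = k}"
  proof
    fix \<beta> assume "\<beta> \<in> msets I k"
    moreover obtain xs where "mset xs = \<beta>" using ex_mset by blast
    ultimately show "\<beta> \<in> mset ` {xs. set xs \<subseteq> I \<and> length xs = k}"
      by (auto simp: msets_def)
  qed
  ultimately show ?thesis by (rule finite_subset[rotated])
qed

lemma msets_0 [simp]: "msets I 0 = {{#}}"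
  by (auto simp: msets_def)

text \<open>Removing one copy of \<open>m\<close> is a bijection from the multisets that contain it.
  The traces and the generating function below both shift the degree in this way.\<close>

lemma sum_msets_Suc:
  assumes "finite I" "m \<in> I" "\<And>\<beta>. \<beta> \<in> msets I (Suc k) \<Longrightarrow> m \<notin># \<beta> \<Longrightarrow> f \<beta> = 0"
  shows "(\<Sum>\<beta>\<in>msets I (Suc k). f \<beta>) = (\<Sum>\<beta>\<in>msets I k. f (add_mset m \<beta>))"
proof -
  have im: "add_mset m ` msets I k = {\<beta> \<in> msets I (Suc k). m \<in># \<beta>}"
  proof
    show "add_mset m ` msets I k \<subseteq> {\<beta> \<in> msets I (Suc k). m \<in># \<beta>}"
      using assms(2) by (auto simp: msets_def)
    show "{\<beta> \<in> msets I (Suc k). m \<in># \<beta>} \<subseteq> add_mset m ` msets I k"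
    proof
      fix \<beta> assume b: "\<beta> \<in> {\<beta> \<in> msets I (Suc k). m \<in># \<beta>}"
      then have "\<beta> = add_mset m (\<beta> - {#m#})" by simp
      moreover have "\<beta> - {#m#} \<in> msets I k"
        using b by (auto simp: msets_def size_Diff_singleton dest: in_diffD)
      ultimately show "\<beta> \<in> add_mset m ` msets I k" by blast
    qed
  qed
  have "(\<Sum>\<beta>\<in>msets I (Suc k). f \<beta>) = (\<Sum>\<beta>\<in>{\<beta> \<in> msets I (Suc k). m \<in># \<beta>}. f \<beta>)"
    using assms(3) finite_msets[OF assms(1)] by (intro sum.mono_neutral_right) auto
  also have "\<dots> = (\<Sum>\<beta>\<in>msets I k. f (add_mset m \<beta>))"
    unfolding im[symmetric] by (subst sum.reindex) (auto simp: inj_on_def)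
  finally show ?thesis .
qed

text \<open>The sums are the complete homogeneous symmetric polynomials. A multiset over
  \<open>insert m I\<close> either avoids \<open>m\<close> or contains a copy that can be removed,
  which accounts for the factor \<open>1 - lm m * t\<close>.\<close>

lemma sum_fps_msets:
  fixes lm :: "'i \<Rightarrow> complex"
  assumes "finite I"
  shows "(\<Prod>m\<in>I. 1 - fps_const (lm m) * fps_X) *
      Abs_fps (\<lambda>k. \<Sum>\<beta>\<in>msets I k. prod_mset (image_mset lm \<beta>)) = 1"
  using assms
proof (induction I rule: finite_induct)
  case empty
  have "msets ({} :: 'i set) k = (if k = 0 then {{#}} else {})" for k :: nat by (auto simp: msets_def)
  then show ?case by (auto simp: fps_eq_iff)
next
  case (insert m I)
  let ?F = "\<lambda>I. Abs_fps (\<lambda>k. \<Sum>\<beta>\<in>msets I k. prod_mset (image_mset lm \<beta>))"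
  have "(1 - fps_const (lm m) * fps_X) * ?F (insert m I) = ?F I"
  proof (rule fps_ext)
    fix k
    show "fps_nth ((1 - fps_const (lm m) * fps_X) * ?F (insert m I)) k = fps_nth (?F I) k"
    proof (cases k)
      case 0
      then show ?thesis by (simp add: left_diff_distrib mult.assoc)
    next
      case (Suc k')
      have split: "msets (insert m I) (Suc k') = msets I (Suc k') \<union> {\<beta> \<in> msets (insert m I) (Suc k'). m \<in># \<beta>}"
        by (auto simp: msets_def)
      have fin: "finite {\<beta> \<in> msets (insert m I) (Suc k'). m \<in># \<beta>}"
        using insert finite_msets[of "insert m I" "Suc k'"] by simp
      have "(\<Sum>\<beta>\<in>msets (insert m I) (Suc k'). prod_mset (image_mset lm \<beta>)) =
          (\<Sum>\<beta>\<in>msets I (Suc k'). prod_mset (image_mset lm \<beta>)) +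
          (\<Sum>\<beta>\<in>{\<beta> \<in> msets (insert m I) (Suc k'). m \<in># \<beta>}. prod_mset (image_mset lm \<beta>))"
        by (subst split, rule sum.union_disjoint)
          (use insert fin finite_msets[of I] in \<open>auto simp: msets_def\<close>)
      also have "(\<Sum>\<beta>\<in>{\<beta> \<in> msets (insert m I) (Suc k'). m \<in># \<beta>}. prod_mset (image_mset lm \<beta>)) =
         (\<Sum>\<beta>\<in>msets (insert m I) (Suc k'). if m \<in># \<beta> then prod_mset (image_mset lm \<beta>) else 0)"
        using insert finite_msets[of "insert m I"] by (subst sum.inter_filter) auto
      also have "\<dots> = (\<Sum>\<beta>\<in>msets (insert m I) k'. lm m * prod_mset (image_mset lm \<beta>))"
        by (subst sum_msets_Suc[where m = m]) (use insert in auto)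
      finally show ?thesis
        by (simp add: Suc left_diff_distrib mult.assoc sum_distrib_left)
    qed
  qed
  moreover have "(\<Prod>m\<in>insert m I. 1 - fps_const (lm m) * fps_X) * ?F (insert m I) =
      (\<Prod>m\<in>I. 1 - fps_const (lm m) * fps_X) * ((1 - fps_const (lm m) * fps_X) * ?F (insert m I))"
    using insert by (simp only: prod.insert not_False_eq_True mult.assoc mult.left_commute)
  ultimately show ?case using insert.IH by (simp only:)
qed

section \<open>Twisted traces\<close>

text \<open>Models conjugation by a linear map that is diagonal in the coordinates
  \<open>xc m\<close>. Derivatives carry the inverse eigenvalues, and
  \<open>lam m \<noteq> 1\<close> keeps the poles of the trace series away from
  \<open>1\<close>.\<close>

locale coord_space = fun_space s X
  for s :: "complex \<Rightarrow> 'x::ab_group_add \<Rightarrow> 'x" and X +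
  fixes I :: "'i set" and xc :: "'i \<Rightarrow> 'x \<Rightarrow> complex" and E :: "'i \<Rightarrow> 'x" and lam :: "'i \<Rightarrow> complex"
    and G :: "'x fun_op \<Rightarrow> 'x fun_op"
  assumes finite_I: "finite I"
    and xc: "m \<in> I \<Longrightarrow> xc m \<in> LF"
    and E: "m \<in> I \<Longrightarrow> E m \<in> X"
    and dual: "m \<in> I \<Longrightarrow> k \<in> I \<Longrightarrow> xc m (E k) = (if m = k then 1 else 0)"
    and lam: "m \<in> I \<Longrightarrow> lam m \<noteq> 0" "m \<in> I \<Longrightarrow> lam m \<noteq> 1"
    and G_add: "G (a + b) = G a + G b" and G_scale: "G (op_scale c a) = op_scale c (G a)"
    and G_comp: "G (a \<circ> b) = G a \<circ> G b" and G_id: "G id_op = id_op"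
    and G_xc: "m \<in> I \<Longrightarrow> G (mult_op s X (xc m)) = op_scale (lam m) (mult_op s X (xc m))"
    and G_E: "m \<in> I \<Longrightarrow> G (deriv_op s X (E m)) = op_scale (inverse (lam m)) (deriv_op s X (E m))"
begin

sublocale A: carrier_algebra op_scale Lops "(\<circ>)" id_op
  by (rule ops_algebra)

fun deriv_list :: "'i list \<Rightarrow> ('x \<Rightarrow> complex) \<Rightarrow> complex" where
  "deriv_list [] f = f 0"
| "deriv_list (m # ms) f = deriv_list ms (der (E m) f)"

lemma deriv_list_perm:
  "mset ms = mset ms' \<Longrightarrow> set ms \<subseteq> I \<Longrightarrow> f \<in> PF \<Longrightarrow> deriv_list ms f = deriv_list ms' f"
proof (induction ms arbitrary: ms' f)
  case (Cons m ms)
  have "m \<in> set ms'" using Cons.prems(1) by (metis list.set_intros(1) mset_eq_setD)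
  then obtain as bs where ms': "ms' = as @ m # bs" by (meson split_list)
  then have eq: "mset ms = mset (as @ bs)" using Cons.prems(1) by simp
  have sub: "set as \<subseteq> I" "m \<in> I" using Cons.prems mset_eq_setD[OF eq] by auto
  have swap: "deriv_list (as @ m # bs) f = deriv_list (m # as @ bs) f" if "f \<in> PF" "set as \<subseteq> I" for as f
    using that
  proof (induction as arbitrary: f)
    case (Cons a as)
    then have "deriv_list ((a # as) @ m # bs) f = deriv_list (as @ bs) (der (E m) (der (E a) f))"
      using E by simp
    also have "der (E m) (der (E a) f) = der (E a) (der (E m) f)"
      using Cons.prems E sub by (intro der_commute) auto
    finally show ?case by simp
  qed simp
  have "deriv_list (m # ms) f = deriv_list (as @ bs) (der (E m) f)"
    using Cons.IH[OF eq] Cons.prems E by simp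
  then show ?case using swap[OF Cons.prems(3) sub(1)] ms' by simp
qed simp

text \<open>An iterated derivative at the origin. For indices in \<open>I\<close> and functions in
  \<open>PF\<close>, the ordering picked by \<open>SOME\<close> does not matter by
  \<open>deriv_list_perm\<close>.\<close>

definition K :: "'i multiset \<Rightarrow> ('x \<Rightarrow> complex) \<Rightarrow> complex" where
  "K \<beta> f = deriv_list (SOME ms. mset ms = \<beta>) f"

lemma K_list: "set ms \<subseteq> I \<Longrightarrow> f \<in> PF \<Longrightarrow> K (mset ms) f = deriv_list ms f"
proof -
  assume "set ms \<subseteq> I" "f \<in> PF"
  moreover have "mset (SOME ms'. mset ms' = mset ms) = mset ms" by (rule someI) simp
  ultimately show ?thesis unfolding K_def by (metis deriv_list_perm mset_eq_setD)
qed

lemma K_empty [simp]: "f \<in> PF \<Longrightarrow> K {#} f = f 0"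
  using K_list[of "[]"] by simp

lemma K_add: "set_mset \<beta> \<subseteq> I \<Longrightarrow> m \<in> I \<Longrightarrow> f \<in> PF \<Longrightarrow> K (add_mset m \<beta>) f = K \<beta> (der (E m) f)"
proof -
  assume a: "set_mset \<beta> \<subseteq> I" "m \<in> I" "f \<in> PF"
  obtain ms where ms: "mset ms = \<beta>" using ex_mset by blast
  then have "set ms \<subseteq> I" using a by auto
  then show ?thesis using K_list[of "m # ms" f] K_list[of ms "der (E m) f"] a E ms by simp
qed

lemma K_linear:
  assumes "set_mset \<beta> \<subseteq> I" "f \<in> PF" "g \<in> PF"
  shows "K \<beta> (f + g) = K \<beta> f + K \<beta> g" "K \<beta> (fun_scale c f) = c * K \<beta> f"
  using assms
proof (induction \<beta> arbitrary: f g)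
  case empty
  { case 1
    then have "f + g \<in> PF" by simp
    then have "K {#} (f + g) = (f + g) 0" by (rule K_empty)
    also have "\<dots> = K {#} f + K {#} g" using 1 by simp
    finally show ?case .
  next
    case 2
    then have "fun_scale c f \<in> PF" by simp
    then have "K {#} (fun_scale c f) = fun_scale c f 0" by (rule K_empty)
    also have "\<dots> = c * K {#} f" using 2 by simp
    finally show ?case . }
next
  case (add m \<beta>)
  { case 1
    then have b: "set_mset \<beta> \<subseteq> I" "m \<in> I" "der (E m) f \<in> PF" "der (E m) g \<in> PF" using E by auto
    have "K (add_mset m \<beta>) (f + g) = K \<beta> (der (E m) f + der (E m) g)"
      using K_add[OF b(1,2) PF_add] der_add[OF E[OF b(2)]] 1 by metis
    also have "\<dots> = K \<beta> (der (E m) f) + K \<beta> (der (E m) g)" by (rule add.IH(1)[OF b(1,3,4)])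
    also have "\<dots> = K (add_mset m \<beta>) f + K (add_mset m \<beta>) g" using K_add[OF b(1,2)] 1 by metis
    finally show ?case .
  next
    case 2
    then have b: "set_mset \<beta> \<subseteq> I" "m \<in> I" "der (E m) f \<in> PF" using E by auto
    have "K (add_mset m \<beta>) (fun_scale c f) = K \<beta> (fun_scale c (der (E m) f))"
      using K_add[OF b(1,2) PF_scale] der_scale[OF _ E[OF b(2)]] 2 by metis
    also have "\<dots> = c * K \<beta> (der (E m) f)" by (rule add.IH(2)[OF b(1,3) PF_zero])
    also have "\<dots> = c * K (add_mset m \<beta>) f" using K_add[OF b(1,2)] 2 by metis
    finally show ?case . }
qed

lemma xc_PF: "m \<in> I \<Longrightarrow> xc m \<in> PF" by (rule PF_lin[OF xc])

lemma xc_0: "m \<in> I \<Longrightarrow> xc m 0 = 0"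
proof -
  assume "m \<in> I"
  then have "\<forall>c. \<forall>x\<in>X. xc m (s c x) = c * xc m x" using xc[of m] by (simp add: lin_funs_def)
  then have "xc m (s 0 0) = 0 * xc m 0" using X_closed(1) by blast
  then show ?thesis by simp
qed

lemma der_xc_mult:
  assumes "m \<in> I" "k \<in> I" "f \<in> PF"
  shows "der (E k) (xc m * f) = xc m * der (E k) f + fun_scale (if m = k then 1 else 0) f"
  using assms by (subst der_mult) (auto simp: E xc_PF der_lin xc dual fun_scale_PF)

text \<open>\<open>xc m\<close> is linear and vanishes at the origin, so exactly one of the
  derivatives has to fall on it, and of these only the ones along \<open>E m\<close>
  survive.\<close>

lemma K_xc:
  assumes "set_mset \<beta> \<subseteq> I" "m \<in> I" "f \<in> PF"
  shows "K \<beta> (xc m * f) = of_nat (count \<beta> m) * K (\<beta> - {#m#}) f"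
  using assms
proof (induction \<beta> arbitrary: f)
  case empty
  then have "xc m * f \<in> PF" using xc_PF by simp
  then have "K {#} (xc m * f) = (xc m * f) 0" by (rule K_empty)
  also have "\<dots> = of_nat (count {#} m) * K ({#} - {#m#}) f" using empty xc_0 by simp
  finally show ?case .
next
  case (add k \<beta>)
  have k: "k \<in> I" "set_mset \<beta> \<subseteq> I" using add.prems by auto
  have "K (add_mset k \<beta>) (xc m * f) = K \<beta> (xc m * der (E k) f + fun_scale (if m = k then 1 else 0) f)"
    using k add.prems xc_PF by (subst K_add) (auto simp: der_xc_mult)
  also have "\<dots> = K \<beta> (xc m * der (E k) f) + (if m = k then 1 else 0) * K \<beta> f"
    using k add.prems xc_PF E by (simp only: K_linear[of \<beta>] PF_mult PF_scale der_PF)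
  also have "K \<beta> (xc m * der (E k) f) = of_nat (count \<beta> m) * K (\<beta> - {#m#}) (der (E k) f)"
    using k add.prems E by (intro add.IH) auto
  also have "of_nat (count \<beta> m) * K (\<beta> - {#m#}) (der (E k) f) =
      of_nat (count \<beta> m) * K (add_mset k \<beta> - {#m#}) f"
  proof (cases "m \<in># \<beta>")
    case True
    then have "add_mset k \<beta> - {#m#} = add_mset k (\<beta> - {#m#})" by simp
    moreover have "set_mset (\<beta> - {#m#}) \<subseteq> I" using k by (meson in_diffD subset_eq)
    ultimately show ?thesis using K_add[of "\<beta> - {#m#}" k f] k add.prems by simp
  qed (simp add: not_in_iff)
  finally show ?case by (auto simp: algebra_simps)
qed

text \<open>The factor \<open>cst 1\<close> makes the empty monomial vanish outside
  \<open>X\<close>, as membership in \<open>PF\<close> demands.\<close>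

definition mon :: "'i multiset \<Rightarrow> 'x \<Rightarrow> complex" where
  "mon \<beta> = cst 1 * prod_mset (image_mset xc \<beta>)"

lemma mon_empty: "mon {#} = cst 1" by (simp add: mon_def)

lemma mon_add: "mon (add_mset m \<beta>) = xc m * mon \<beta>"
  by (simp add: mon_def mult.left_commute)

lemma mon_PF: "set_mset \<beta> \<subseteq> I \<Longrightarrow> mon \<beta> \<in> PF"
  by (induction \<beta>) (auto simp: mon_empty mon_add xc_PF simp del: times_fun_apply)

lemma der_mon:
  "set_mset \<beta> \<subseteq> I \<Longrightarrow> m \<in> I \<Longrightarrow> der (E m) (mon \<beta>) = fun_scale (of_nat (count \<beta> m)) (mon (\<beta> - {#m#}))"
proof (induction \<beta>)
  case empty
  then show ?case using E by (simp add: mon_empty fun_eq_iff)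
next
  case (add k \<beta>)
  have k: "k \<in> I" "set_mset \<beta> \<subseteq> I" using add.prems by auto
  have "der (E m) (mon (add_mset k \<beta>)) =
      xc k * der (E m) (mon \<beta>) + fun_scale (if k = m then 1 else 0) (mon \<beta>)"
    unfolding mon_add using k add.prems by (intro der_xc_mult mon_PF) auto
  also have "xc k * der (E m) (mon \<beta>) = fun_scale (of_nat (count \<beta> m)) (mon (add_mset k \<beta> - {#m#}))"
  proof (cases "m \<in># \<beta>")
    case True
    then have "add_mset k \<beta> - {#m#} = add_mset k (\<beta> - {#m#})" by simp
    then have "mon (add_mset k \<beta> - {#m#}) = xc k * mon (\<beta> - {#m#})" by (simp only: mon_add)
    then show ?thesis using add.IH k add.prems by (simp add: fun_eq_iff)
  qed (use add.IH k add.prems in \<open>simp add: not_in_iff fun_eq_iff\<close>)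
  finally show ?case by (auto simp: fun_eq_iff algebra_simps)
qed

definition mf :: "'i multiset \<Rightarrow> complex" where
  "mf \<beta> = (\<Prod>m\<in>I. fact (count \<beta> m))"

lemma mf_nz: "mf \<beta> \<noteq> 0" using finite_I by (simp add: mf_def)

lemma mf_add: "m \<in> I \<Longrightarrow> mf (add_mset m \<beta>) = of_nat (Suc (count \<beta> m)) * mf \<beta>"
proof -
  assume m: "m \<in> I"
  have "(\<Prod>k\<in>I - {m}. fact (count (add_mset m \<beta>) k)) = (\<Prod>k\<in>I - {m}. fact (count \<beta> k) :: complex)"
    by (intro prod.cong) auto
  then show ?thesis
    unfolding mf_def by (subst (1 2) prod.remove[OF finite_I m]) (simp add: algebra_simps)
qed

lemma K_mon: "set_mset \<beta> \<subseteq> I \<Longrightarrow> K \<beta> (mon \<beta>) = mf \<beta>"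
proof (induction \<beta>)
  case empty
  then show ?case using K_empty[OF PF_cst[of 1]] by (simp add: mon_empty mf_def const_fun_def)
next
  case (add m \<beta>)
  have b: "m \<in> I" "set_mset \<beta> \<subseteq> I" using add.prems by auto
  have "K (add_mset m \<beta>) (mon (add_mset m \<beta>)) = K \<beta> (fun_scale (of_nat (Suc (count \<beta> m))) (mon \<beta>))"
    using b mon_PF[OF add.prems] by (simp add: K_add der_mon add.prems del: of_nat_Suc)
  also have "\<dots> = of_nat (Suc (count \<beta> m)) * mf \<beta>"
    using add.IH b mon_PF by (simp add: K_linear(2)[of \<beta> _ 0] del: of_nat_Suc)
  finally show ?case using mf_add[OF b(1)] by simp
qed

text \<open>
  \<open>K \<beta> f / mf \<beta>\<close> is the coefficient of \<open>mon \<beta>\<close> in \<open>f\<close>, so \<open>Tc k a\<close> is the trace on the polynomials of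
  degree \<open>k\<close> of \<open>a\<close> composed with the diagonal operator of eigenvalues \<open>lam\<close>.
\<close>

definition Tc :: "nat \<Rightarrow> 'x fun_op \<Rightarrow> complex" where
  "Tc k a = (\<Sum>\<beta>\<in>msets I k. prod_mset (image_mset lam \<beta>) * K \<beta> (a (mon \<beta>)) / mf \<beta>)"

definition Tf :: "'x fun_op \<Rightarrow> complex fps" where "Tf a = Abs_fps (\<lambda>k. Tc k a)"

lemma msetsD: "\<beta> \<in> msets I k \<Longrightarrow> set_mset \<beta> \<subseteq> I" by (simp add: msets_def)

abbreviation Mx :: "'i \<Rightarrow> 'x fun_op" where "Mx m \<equiv> mult_op s X (xc m)"
abbreviation Dx :: "'i \<Rightarrow> 'x fun_op" where "Dx m \<equiv> deriv_op s X (E m)"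

lemma Mx_L: "m \<in> I \<Longrightarrow> Mx m \<in> Lops" by (rule mult_op_Lops[OF xc_PF])
lemma Dx_L: "m \<in> I \<Longrightarrow> Dx m \<in> Lops" by (rule deriv_op_Lops[OF E])

lemma Tf_add: "a \<in> Lops \<Longrightarrow> b \<in> Lops \<Longrightarrow> Tf (a + b) = Tf a + Tf b"
proof -
  assume ab: "a \<in> Lops" "b \<in> Lops"
  have "K \<beta> ((a + b) (mon \<beta>)) = K \<beta> (a (mon \<beta>)) + K \<beta> (b (mon \<beta>))" if "\<beta> \<in> msets I k" for \<beta> k
    using K_linear(1)[OF msetsD[OF that]] Lops_PF ab by (simp only: plus_fun_apply)
  then show ?thesis
    by (simp add: Tf_def fps_eq_iff Tc_def sum.distrib[symmetric] add_divide_distrib[symmetric]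
        distrib_left[symmetric] del: plus_fun_apply)
qed

lemma Tf_scale: "a \<in> Lops \<Longrightarrow> Tf (op_scale c a) = fps_const c * Tf a"
proof -
  assume a: "a \<in> Lops"
  have "K \<beta> (op_scale c a (mon \<beta>)) = c * K \<beta> (a (mon \<beta>))" if "\<beta> \<in> msets I k" for \<beta> k
    using K_linear(2)[OF msetsD[OF that] Lops_PF[OF a] PF_zero] by simp
  then show ?thesis
    by (simp add: Tf_def fps_eq_iff Tc_def sum_distrib_left mult_ac del: op_scale_apply)
qed

lemma Tf_diff: "a \<in> Lops \<Longrightarrow> b \<in> Lops \<Longrightarrow> Tf (a - b) = Tf a - Tf b"
  using Tf_add[of "a - b" b] by simp

text \<open>Cyclicity of the trace across degrees: the diagonal entries of
  \<open>Mx m \<circ> a\<close> in degree \<open>k + 1\<close> are those of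
  \<open>a \<circ> Mx m\<close> in degree \<open>k\<close>. The shift of degree is the factor
  \<open>t\<close>, and moving the diagonal operator past \<open>xc m\<close> yields
  \<open>lam m\<close>. The count from \<open>K_xc\<close> cancels against the quotient of the
  factors \<open>mf\<close>.\<close>

lemma Tf_Mx:
  assumes m: "m \<in> I" and a: "a \<in> Lops"
  shows "Tf (Mx m \<circ> a) = fps_of_poly [:0, lam m:] * Tf (a \<circ> Mx m)"
proof -
  have K1: "K \<beta> ((Mx m \<circ> a) (mon \<beta>)) = of_nat (count \<beta> m) * K (\<beta> - {#m#}) (a (mon \<beta>))"
    if "\<beta> \<in> msets I k" for \<beta> k
    using K_xc[OF msetsD[OF that] m Lops_PF[OF a]] Lops_PF[OF a] by (simp add: mult_op_def)
  have "Tc 0 (Mx m \<circ> a) = 0" using K1[of "{#}" 0] by (simp add: Tc_def)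
  moreover have "Tc (Suc k) (Mx m \<circ> a) = lam m * Tc k (a \<circ> Mx m)" for k
  proof -
    have "Tc (Suc k) (Mx m \<circ> a) = (\<Sum>\<beta>\<in>msets I k. prod_mset (image_mset lam (add_mset m \<beta>)) *
        K (add_mset m \<beta>) ((Mx m \<circ> a) (mon (add_mset m \<beta>))) / mf (add_mset m \<beta>))"
      unfolding Tc_def using finite_I m
      by (intro sum_msets_Suc) (auto simp: K1 not_in_iff simp del: comp_apply)
    also have "\<dots> = (\<Sum>\<beta>\<in>msets I k. lam m * (prod_mset (image_mset lam \<beta>) * K \<beta> ((a \<circ> Mx m) (mon \<beta>)) / mf \<beta>))"
    proof (rule sum.cong[OF refl])
      fix \<beta> assume b: "\<beta> \<in> msets I k"
      then have b': "add_mset m \<beta> \<in> msets I (Suc k)" using m by (simp add: msets_def)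
      have "(a \<circ> Mx m) (mon \<beta>) = a (mon (add_mset m \<beta>))"
        using mon_PF[OF msetsD[OF b]] by (simp add: mult_op_def mon_add)
      then show "prod_mset (image_mset lam (add_mset m \<beta>)) *
        K (add_mset m \<beta>) ((Mx m \<circ> a) (mon (add_mset m \<beta>))) / mf (add_mset m \<beta>) =
        lam m * (prod_mset (image_mset lam \<beta>) * K \<beta> ((a \<circ> Mx m) (mon \<beta>)) / mf \<beta>)"
        unfolding K1[OF b'] mf_add[OF m] using mf_nz[of \<beta>] by (simp add: field_simps del: of_nat_Suc comp_apply)
    qed
    finally show ?thesis by (simp add: Tc_def sum_distrib_left)
  qed
  ultimately show ?thesis
    by (simp add: Tf_def fps_eq_iff fps_nth_shift_mult split: nat.split)
qed

text \<open>The mirror image of \<open>Tf_Mx\<close>: here \<open>Dx m\<close> lowers the degree, so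
  the trace of \<open>a \<circ> Dx m\<close> in degree \<open>k + 1\<close> is matched with that of
  \<open>Dx m \<circ> a\<close> in degree \<open>k\<close>.\<close>

lemma Tf_Dx:
  assumes m: "m \<in> I" and a: "a \<in> Lops"
  shows "Tf (a \<circ> Dx m) = fps_of_poly [:0, lam m:] * Tf (Dx m \<circ> a)"
proof -
  have K1: "(a \<circ> Dx m) (mon \<beta>) = fun_scale (of_nat (count \<beta> m)) (a (mon (\<beta> - {#m#})))"
    if "\<beta> \<in> msets I k" for \<beta> k
  proof -
    have "set_mset (\<beta> - {#m#}) \<subseteq> I" using msetsD[OF that] by (meson in_diffD subset_eq)
    then show ?thesis
      using der_mon[OF msetsD[OF that] m] mon_PF[OF msetsD[OF that]] mon_PF LopsD(4)[OF a]
      by (simp add: deriv_op_def)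
  qed
  have K2: "K \<beta> ((a \<circ> Dx m) (mon \<beta>)) = of_nat (count \<beta> m) * K \<beta> (a (mon (\<beta> - {#m#})))"
    if "\<beta> \<in> msets I k" for \<beta> k
    unfolding K1[OF that] by (rule K_linear(2)[OF msetsD[OF that] Lops_PF[OF a] PF_zero])
  have "Tc 0 (a \<circ> Dx m) = 0" using K2[of "{#}" 0] by (simp add: Tc_def)
  moreover have "Tc (Suc k) (a \<circ> Dx m) = lam m * Tc k (Dx m \<circ> a)" for k
  proof -
    have "Tc (Suc k) (a \<circ> Dx m) = (\<Sum>\<beta>\<in>msets I k. prod_mset (image_mset lam (add_mset m \<beta>)) *
        K (add_mset m \<beta>) ((a \<circ> Dx m) (mon (add_mset m \<beta>))) / mf (add_mset m \<beta>))"
      unfolding Tc_def using finite_I m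
      by (intro sum_msets_Suc) (auto simp: K2 not_in_iff simp del: comp_apply)
    also have "\<dots> = (\<Sum>\<beta>\<in>msets I k. lam m * (prod_mset (image_mset lam \<beta>) * K \<beta> ((Dx m \<circ> a) (mon \<beta>)) / mf \<beta>))"
    proof (rule sum.cong[OF refl])
      fix \<beta> assume b: "\<beta> \<in> msets I k"
      then have b': "add_mset m \<beta> \<in> msets I (Suc k)" using m by (simp add: msets_def)
      have "K (add_mset m \<beta>) (a (mon \<beta>)) = K \<beta> ((Dx m \<circ> a) (mon \<beta>))"
        using K_add[OF msetsD[OF b] m Lops_PF[OF a]] Lops_PF[OF a] by (simp add: deriv_op_def)
      then show "prod_mset (image_mset lam (add_mset m \<beta>)) *
        K (add_mset m \<beta>) ((a \<circ> Dx m) (mon (add_mset m \<beta>))) / mf (add_mset m \<beta>) =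
        lam m * (prod_mset (image_mset lam \<beta>) * K \<beta> ((Dx m \<circ> a) (mon \<beta>)) / mf \<beta>)"
        unfolding K2[OF b'] mf_add[OF m] using mf_nz[of \<beta>] by (simp add: field_simps del: of_nat_Suc comp_apply)
    qed
    finally show ?thesis by (simp add: Tc_def sum_distrib_left)
  qed
  ultimately show ?thesis
    by (simp add: Tf_def fps_eq_iff fps_nth_shift_mult split: nat.split)
qed

text \<open>The traces of a diagonal map \<open>g\<close> on all symmetric powers sum to
  \<open>1 / det (1 - t g)\<close>.\<close>

lemma Tf_id: "(\<Prod>m\<in>I. 1 - fps_const (lam m) * fps_X) * Tf id_op = 1"
proof -
  have "Tc k id_op = (\<Sum>\<beta>\<in>msets I k. prod_mset (image_mset lam \<beta>))" for k
    unfolding Tc_def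
    by (intro sum.cong refl) (simp add: id_op_apply mon_PF[OF msetsD] K_mon[OF msetsD] mf_nz)
  then show ?thesis using sum_fps_msets[OF finite_I, of lam] by (simp add: Tf_def)
qed

definition Gen :: "'x fun_op set" where "Gen = Mx ` I \<union> Dx ` I"

lemma Gen_L: "Gen \<subseteq> Lops" using Mx_L Dx_L by (auto simp: Gen_def)

abbreviation Alg :: "'x fun_op set" where "Alg \<equiv> (\<Union>k. A.word_filt Gen k)"

lemma Alg_L: "a \<in> Alg \<Longrightarrow> a \<in> Lops"
  using A.word_filt_L[OF Gen_L] by blast

lemma Gen_commutator:
  assumes "a \<in> Gen" "b \<in> Gen" shows "\<exists>c. (a \<circ> b) - (b \<circ> a) = op_scale c id_op"
proof -
  have z: "op_scale 0 id_op = 0" by (simp add: fun_eq_iff)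
  have DM: "\<exists>c. (Dx k \<circ> Mx m) - (Mx m \<circ> Dx k) = op_scale c id_op" if "m \<in> I" "k \<in> I" for m k
    using deriv_mult_commutator[OF E xc] that by blast
  moreover have "\<exists>c. (Mx m \<circ> Dx k) - (Dx k \<circ> Mx m) = op_scale c id_op" if mk: "m \<in> I" "k \<in> I" for m k
  proof -
    obtain c where "(Dx k \<circ> Mx m) - (Mx m \<circ> Dx k) = op_scale c id_op" using DM[OF mk] by blast
    then have "(Mx m \<circ> Dx k) - (Dx k \<circ> Mx m) = - op_scale c id_op" by (metis minus_diff_eq)
    also have "\<dots> = op_scale (- c) id_op" by (simp only: A.scale_minus_left)
    finally show ?thesis by blast
  qed
  moreover have "(Mx m \<circ> Mx k) - (Mx k \<circ> Mx m) = op_scale 0 id_op" if "m \<in> I" "k \<in> I" for m k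
    unfolding z using mult_op_commute[OF xc_PF xc_PF, OF that] by simp
  moreover have "(Dx m \<circ> Dx k) - (Dx k \<circ> Dx m) = op_scale 0 id_op" if "m \<in> I" "k \<in> I" for m k
    unfolding z using deriv_op_commute[OF E E, OF that] by simp
  ultimately show ?thesis using assms unfolding Gen_def by blast
qed

text \<open>Commutators of generators are scalars, so this element is shorter than
  \<open>z \<circ> A.word gs\<close>; the recursion on the trace series rests on this.\<close>

lemma commutator_filt:
  assumes "z \<in> Gen" "set gs \<subseteq> Gen"
  shows "(z \<circ> A.word gs) - (A.word gs \<circ> z) \<in> A.word_filt Gen (length gs)"
  using assms(2)
proof (induction gs)
  case Nil
  have "z \<in> Lops" using assms(1) Gen_L by blast
  then have "(z \<circ> A.word []) - (A.word [] \<circ> z) = 0"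
    by (simp only: A.word_simps A.unit_left A.unit_right diff_self)
  then show ?case using A.subspace_0[OF A.subspace_word_filt] by (simp only:)
next
  case (Cons g gs)
  let ?w = "A.word gs"
  have L: "z \<in> Lops" "g \<in> Lops" "?w \<in> Lops" using Cons.prems assms Gen_L by auto
  obtain c where c: "(z \<circ> g) - (g \<circ> z) = op_scale c id_op" using Gen_commutator[of z g] assms Cons.prems by auto
  have "(z \<circ> (g \<circ> ?w)) - ((g \<circ> ?w) \<circ> z) = (((z \<circ> g) - (g \<circ> z)) \<circ> ?w) + (g \<circ> ((z \<circ> ?w) - (?w \<circ> z)))"
    using L by (simp add: A.mul_diff_left A.mul_diff_right comp_assoc)
  moreover have "g \<circ> ((z \<circ> ?w) - (?w \<circ> z)) \<in> A.word_filt Gen (1 + length gs)"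
    by (rule A.word_filt_mul[OF Gen_L A.gen_in_filt[OF Gen_L A.span_base] Cons.IH]) (use Cons.prems in auto)
  moreover have "((z \<circ> g) - (g \<circ> z)) \<circ> ?w \<in> A.word_filt Gen (1 + length gs)"
    unfolding c using L Cons.prems A.word_in_filt[of gs Gen]
    by (simp add: A.mul_scale_left A.subspace_scale)
  ultimately have "(z \<circ> (g \<circ> ?w)) - ((g \<circ> ?w) \<circ> z) \<in> A.word_filt Gen (1 + length gs)"
    using A.subspace_add[OF A.subspace_word_filt] by presburger
  then show ?case by (simp only: A.word_simps length_Cons plus_1_eq_Suc)
qed

lemma regular_subspace: "A.subspace {a. a \<in> Lops \<and> (\<exists>v. regular_at_1 (Tf a) v)}"
proof (rule A.subspaceI)
  have "Tf 0 = 0" using Tf_scale[of 0 0] by simp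
  then show "0 \<in> {a. a \<in> Lops \<and> (\<exists>v. regular_at_1 (Tf a) v)}"
    using regular_at_1_zero by auto
qed (auto simp: Tf_add Tf_scale intro: regular_at_1_add regular_at_1_scale simp del: plus_fun_apply)

text \<open>
  Moving a generator \<open>z\<close> around the trace multiplies it by \<open>lam m * t\<close> or its inverse, so \<open>1 - lam m * t\<close>
  times the trace of a word \<open>z \<circ> w\<close> is determined by that of the shorter \<open>z \<circ> w - w \<circ> z\<close>; as
  \<open>lam m \<noteq> 1\<close>, no pole at \<open>t = 1\<close> arises.
\<close>

lemma regular_filt: "a \<in> A.word_filt Gen k \<Longrightarrow> \<exists>v. regular_at_1 (Tf a) v"
proof (induction k arbitrary: a rule: less_induct)
  case (less k)
  from less.prems Gen_L show ?case
  proof (induction rule: A.word_filt_L_induct)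
    case subspace
    show ?case by (rule regular_subspace)
  next
    case (word gs)
    show ?case
    proof (cases gs)
      case Nil
      let ?Q = "\<Prod>m\<in>I. [:1, - lam m:]"
      have "fps_of_poly ?Q = (\<Prod>m\<in>I. 1 - fps_const (lam m) * fps_X)"
        by (simp only: fps_of_poly_prod fps_of_poly_linear_factor)
      then have "fps_of_poly ?Q * Tf id_op = fps_of_poly 1" using Tf_id by simp
      moreover have "poly ?Q 1 \<noteq> 0" using lam finite_I by (simp add: poly_prod)
      ultimately show ?thesis unfolding regular_at_1_def Nil
        by (intro exI[of _ "1 / poly ?Q 1"] exI[of _ 1] exI[of _ ?Q]) simp
    next
      case (Cons z hs)
      let ?w = "A.word hs"
      have zG: "z \<in> Gen" "set hs \<subseteq> Gen" using word Cons by auto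
      then have L: "z \<in> Lops" "?w \<in> Lops" using Gen_L by auto
      have len: "length hs < k" using word Cons by auto
      obtain v where v: "regular_at_1 (Tf ((z \<circ> ?w) - (?w \<circ> z))) v"
        using less.IH[OF len commutator_filt[OF zG]] by blast
      have Tdiff: "Tf ((z \<circ> ?w) - (?w \<circ> z)) = Tf (z \<circ> ?w) - Tf (?w \<circ> z)"
        using L comp_Lops by (intro Tf_diff) auto
      from zG(1) consider m where "m \<in> I" "z = Mx m" | m where "m \<in> I" "z = Dx m"
        by (auto simp: Gen_def)
      then have "\<exists>R v. regular_at_1 (fps_of_poly R * Tf (z \<circ> ?w)) v \<and> poly R 1 \<noteq> 0"
      proof cases
        case 1
        let ?R = "[:0, lam m:]"
        have T: "Tf (z \<circ> ?w) = fps_of_poly ?R * Tf (?w \<circ> z)" using Tf_Mx 1 L by simp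
        have "fps_of_poly (1 - ?R) * Tf (z \<circ> ?w) = fps_of_poly (- ?R) * (Tf (z \<circ> ?w) - Tf (?w \<circ> z))"
          unfolding fps_of_poly_diff fps_of_poly_uminus using T by (simp add: algebra_simps)
        then have "regular_at_1 (fps_of_poly (1 - ?R) * Tf (z \<circ> ?w)) (poly (- ?R) 1 * v)"
          using regular_at_1_mult[OF v, of "- ?R"] Tdiff by simp
        moreover have "poly (1 - ?R) 1 \<noteq> 0" using lam 1 by simp
        ultimately show ?thesis by blast
      next
        case 2
        let ?R = "[:0, lam m:]"
        have T: "Tf (?w \<circ> z) = fps_of_poly ?R * Tf (z \<circ> ?w)" using Tf_Dx 2 L by simp
        have "fps_of_poly (1 - ?R) * Tf (z \<circ> ?w) = Tf (z \<circ> ?w) - Tf (?w \<circ> z)"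
          unfolding fps_of_poly_diff T by (simp add: algebra_simps)
        then have "regular_at_1 (fps_of_poly (1 - ?R) * Tf (z \<circ> ?w)) v" using v Tdiff by simp
        moreover have "poly (1 - ?R) 1 \<noteq> 0" using lam 2 by simp
        ultimately show ?thesis by blast
      qed
      then have "\<exists>v. regular_at_1 (Tf (z \<circ> ?w)) v" using regular_at_1_div by blast
      then show ?thesis unfolding Cons A.word_simps .
    qed
  qed
qed

definition val :: "'x fun_op \<Rightarrow> complex" where "val a = (THE v. regular_at_1 (Tf a) v)"

lemma val_eq: "regular_at_1 (Tf a) v \<Longrightarrow> val a = v"
  unfolding val_def by (rule the_equality) (auto intro: regular_at_1_unique)

lemma val: "a \<in> Alg \<Longrightarrow> regular_at_1 (Tf a) (val a)"
  using regular_filt val_eq by blast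

lemma val_add: "a \<in> Alg \<Longrightarrow> b \<in> Alg \<Longrightarrow> val (a + b) = val a + val b"
  using regular_at_1_add[OF val val, of a b] Tf_add[of a b] Alg_L by (intro val_eq) simp

lemma val_scale: "a \<in> Alg \<Longrightarrow> val (op_scale c a) = c * val a"
  using regular_at_1_scale[OF val, of a c] Tf_scale[of a c] Alg_L by (intro val_eq) simp

lemma Alg_comp: "a \<in> Alg \<Longrightarrow> b \<in> Alg \<Longrightarrow> a \<circ> b \<in> Alg"
  using A.word_filt_mul[OF Gen_L] by blast

lemma Alg_Gen: "g \<in> Gen \<Longrightarrow> g \<in> Alg"
  using A.gen_in_filt[OF Gen_L A.span_base] by blast

lemma subspace_Alg: "A.subspace Alg"
proof (rule A.subspaceI)
  fix a b assume "a \<in> Alg" "b \<in> Alg"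
  then obtain i j where "a \<in> A.word_filt Gen i" "b \<in> A.word_filt Gen j" by blast
  then have "a \<in> A.word_filt Gen (max i j)" "b \<in> A.word_filt Gen (max i j)"
    using A.word_filt_mono[of i "max i j"] A.word_filt_mono[of j "max i j"] by auto
  then show "a + b \<in> Alg" using A.subspace_add[OF A.subspace_word_filt] by blast
next
  show "0 \<in> Alg" using A.subspace_0[OF A.subspace_word_filt] by blast
  show "op_scale c a \<in> Alg" if "a \<in> Alg" for c a
    using that A.subspace_scale[OF A.subspace_word_filt] by blast
qed

text \<open>At \<open>t = 1\<close> the shift of degree in \<open>Tf_Mx\<close> and
  \<open>Tf_Dx\<close> becomes invisible and only the eigenvalue is left, which is the action of
  \<open>G\<close> on the generator.\<close>

lemma val_gen:
  assumes z: "z \<in> Gen" and c: "c \<in> Alg"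
  shows "val (z \<circ> c) = val (c \<circ> G z)" "G z \<in> Alg"
proof -
  have cL: "c \<in> Lops" using c Alg_L by blast
  from z consider m where "m \<in> I" "z = Mx m" | m where "m \<in> I" "z = Dx m"
    by (auto simp: Gen_def)
  then have "val (z \<circ> c) = val (c \<circ> G z) \<and> G z \<in> Alg"
  proof cases
    case 1
    have "regular_at_1 (Tf (z \<circ> c)) (lam m * val (c \<circ> z))"
      using regular_at_1_mult[OF val[OF Alg_comp[OF c Alg_Gen[OF z]]], of "[:0, lam m:]"] 1 cL
      by (simp add: Tf_Mx)
    then have "val (z \<circ> c) = lam m * val (c \<circ> z)" by (rule val_eq)
    also have "\<dots> = val (op_scale (lam m) (c \<circ> z))"
      using val_scale[OF Alg_comp[OF c Alg_Gen[OF z]]] by simp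
    also have "op_scale (lam m) (c \<circ> z) = c \<circ> G z"
      using 1 cL Mx_L by (simp add: G_xc A.mul_scale_right)
    finally have "val (z \<circ> c) = val (c \<circ> G z)" .
    moreover have "G z \<in> Alg"
      unfolding 1(2) G_xc[OF 1(1)] using z[unfolded 1(2)] by (intro A.subspace_scale[OF subspace_Alg] Alg_Gen)
    ultimately show ?thesis ..
  next
    case 2
    have "regular_at_1 (Tf (c \<circ> z)) (lam m * val (z \<circ> c))"
      using regular_at_1_mult[OF val[OF Alg_comp[OF Alg_Gen[OF z] c]], of "[:0, lam m:]"] 2 cL
      by (simp add: Tf_Dx)
    then have "val (c \<circ> z) = lam m * val (z \<circ> c)" by (rule val_eq)
    then have "val (z \<circ> c) = inverse (lam m) * val (c \<circ> z)" using lam 2 by simp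
    also have "\<dots> = val (op_scale (inverse (lam m)) (c \<circ> z))"
      using val_scale[OF Alg_comp[OF c Alg_Gen[OF z]]] by simp
    also have "op_scale (inverse (lam m)) (c \<circ> z) = c \<circ> G z"
      using 2 cL Dx_L by (simp add: G_E A.mul_scale_right)
    finally have "val (z \<circ> c) = val (c \<circ> G z)" .
    moreover have "G z \<in> Alg"
      unfolding 2(2) G_E[OF 2(1)] using z[unfolded 2(2)] by (intro A.subspace_scale[OF subspace_Alg] Alg_Gen)
    ultimately show ?thesis ..
  qed
  then show "val (z \<circ> c) = val (c \<circ> G z)" "G z \<in> Alg" by auto
qed

lemma val_word:
  assumes "set gs \<subseteq> Gen"
  shows "G (A.word gs) \<in> Alg \<and> (\<forall>c\<in>Alg. val (A.word gs \<circ> c) = val (c \<circ> G (A.word gs)))"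
proof -
  let ?P = "\<lambda>gs. G (A.word gs) \<in> Alg \<and> (\<forall>c\<in>Alg. val (A.word gs \<circ> c) = val (c \<circ> G (A.word gs)))"
  have id: "id_op \<in> Alg" using A.unit_in_filt by blast
  have Nil: "?P []"
  proof (intro conjI ballI)
    show "G (A.word []) \<in> Alg" unfolding A.word_simps G_id by (rule id)
    fix c assume "c \<in> Alg"
    then have "c \<in> Lops" by (rule Alg_L)
    then show "val (A.word [] \<circ> c) = val (c \<circ> G (A.word []))"
      unfolding A.word_simps G_id by (simp only: A.unit_left A.unit_right)
  qed
  have Cons: "?P (g # gs)" if IH: "?P gs" and g: "g \<in> Gen" and gs: "set gs \<subseteq> Gen" for g gs
  proof (intro conjI ballI)
    let ?w = "A.word gs"
    have Gg: "G g \<in> Alg" by (rule val_gen(2)[OF g id])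
    have w: "?w \<in> Alg" using A.word_in_filt[OF gs order.refl] by blast
    have Gword: "G (A.word (g # gs)) = G g \<circ> G ?w" by (simp only: A.word_simps G_comp)
    show "G (A.word (g # gs)) \<in> Alg" unfolding Gword by (rule Alg_comp[OF Gg conjunct1[OF IH]])
    fix c assume c: "c \<in> Alg"
    have "val (A.word (g # gs) \<circ> c) = val (g \<circ> (?w \<circ> c))" by (simp only: A.word_simps comp_assoc)
    also have "\<dots> = val ((?w \<circ> c) \<circ> G g)" by (rule val_gen(1)[OF g Alg_comp[OF w c]])
    also have "\<dots> = val (?w \<circ> (c \<circ> G g))" by (simp only: comp_assoc)
    also have "\<dots> = val ((c \<circ> G g) \<circ> G ?w)" by (rule bspec[OF conjunct2[OF IH] Alg_comp[OF c Gg]])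
    finally show "val (A.word (g # gs) \<circ> c) = val (c \<circ> G (A.word (g # gs)))"
      by (simp only: Gword comp_assoc)
  qed
  have "set gs \<subseteq> Gen \<longrightarrow> ?P gs" for gs
  proof (rule list.induct[of "\<lambda>gs. set gs \<subseteq> Gen \<longrightarrow> ?P gs"])
    fix g gs assume IH: "set gs \<subseteq> Gen \<longrightarrow> ?P gs"
    show "set (g # gs) \<subseteq> Gen \<longrightarrow> ?P (g # gs)"
    proof
      assume "set (g # gs) \<subseteq> Gen"
      then have "g \<in> Gen" "set gs \<subseteq> Gen" by auto
      then show "?P (g # gs)" using IH by (intro Cons) iprover+
    qed
  qed (rule impI, rule Nil)
  then show ?thesis using assms by iprover
qed

lemma val_twisted:
  assumes "b \<in> Alg" "c \<in> Alg" shows "val (b \<circ> c) = val (c \<circ> G b)"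
proof -
  have "G 0 = 0" using G_scale[of 0 0] by simp
  have cL: "c \<in> Lops" using assms Alg_L by blast
  have id: "id_op \<in> Alg" using A.unit_in_filt by blast
  let ?S = "{b. b \<in> Alg \<and> G b \<in> Alg \<and> val (b \<circ> c) = val (c \<circ> G b)}"
  have "A.subspace ?S"
  proof (rule A.subspaceI)
    show "0 \<in> ?S" using A.subspace_0[OF subspace_Alg] cL \<open>G 0 = 0\<close> by simp
  next
    fix a b assume a: "a \<in> ?S" and b: "b \<in> ?S"
    have "(a + b) \<circ> c = (a \<circ> c) + (b \<circ> c)" "c \<circ> G (a + b) = (c \<circ> G a) + (c \<circ> G b)"
      using a b cL Alg_L by (simp_all only: G_add A.mul_add_left A.mul_add_right mem_Collect_eq)
    then show "a + b \<in> ?S"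
      using a b A.subspace_add[OF subspace_Alg] Alg_comp assms(2) by (simp add: val_add G_add)
  next
    fix a k assume a: "a \<in> ?S"
    have "op_scale k a \<circ> c = op_scale k (a \<circ> c)" "c \<circ> G (op_scale k a) = op_scale k (c \<circ> G a)"
      using a cL Alg_L by (simp_all only: G_scale A.mul_scale_left A.mul_scale_right mem_Collect_eq)
    then show "op_scale k a \<in> ?S"
      using a A.subspace_scale[OF subspace_Alg] Alg_comp assms(2) by (simp add: val_scale G_scale)
  qed
  moreover have "A.word gs \<in> ?S" if "set gs \<subseteq> Gen" for gs
    using val_word[OF that] assms(2) A.word_in_filt[OF that order.refl] by blast
  ultimately have "A.word_filt Gen k \<subseteq> ?S" for k
    unfolding A.word_filt_def by (intro A.span_minimal) auto
  then show ?thesis using assms(1) by blast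
qed

text \<open>For \<open>a\<close> fixed by \<open>G\<close>, twisted cyclicity is ordinary cyclicity,
  so \<open>val\<close> vanishes on the span, whereas \<open>val id_op\<close> is the reciprocal of
  the product of the numbers \<open>1 - lam m\<close>.\<close>

theorem id_not_commutator:
  "id_op \<notin> A.span {(a \<circ> b) - (b \<circ> a) | a b. a \<in> Alg \<and> b \<in> Alg \<and> G a = a}"
proof
  let ?C = "{(a \<circ> b) - (b \<circ> a) | a b. a \<in> Alg \<and> b \<in> Alg \<and> G a = a}"
  assume id: "id_op \<in> A.span ?C"
  have "A.subspace {a. a \<in> Alg \<and> val a = 0}"
  proof (rule A.subspaceI)
    have "val (op_scale 0 0) = 0 * val 0" using A.subspace_0[OF subspace_Alg] by (intro val_scale)
    then show "0 \<in> {a. a \<in> Alg \<and> val a = 0}" using A.subspace_0[OF subspace_Alg] by simp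
  qed (use A.subspace_add[OF subspace_Alg] A.subspace_scale[OF subspace_Alg] in \<open>simp_all add: val_add val_scale\<close>)
  moreover have "(a \<circ> b) - (b \<circ> a) \<in> {a. a \<in> Alg \<and> val a = 0}" if "a \<in> Alg" "b \<in> Alg" "G a = a" for a b
  proof -
    have ab: "a \<circ> b \<in> Alg" "b \<circ> a \<in> Alg" using that Alg_comp by auto
    then have d: "(a \<circ> b) - (b \<circ> a) \<in> Alg" by (rule A.subspace_diff[OF subspace_Alg])
    have "val (a \<circ> b) = val ((a \<circ> b) - (b \<circ> a)) + val (b \<circ> a)"
      using val_add[OF d ab(2)] by simp
    then show ?thesis using d val_twisted[OF that(1,2)] that(3) by simp
  qed
  ultimately have "A.span ?C \<subseteq> {a. a \<in> Alg \<and> val a = 0}"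
    by (intro A.span_minimal) blast+
  then have v0: "val id_op = 0" using id by blast
  have "id_op \<in> Alg" using A.unit_in_filt by blast
  then obtain P Q where PQ: "poly Q 1 \<noteq> 0" "fps_of_poly Q * Tf id_op = fps_of_poly P" "0 * poly Q 1 = poly P 1"
    using val[of id_op] v0 unfolding regular_at_1_def by auto
  \<comment> \<open>\<open>?R\<close> is inverse to \<open>Tf id_op\<close>, so a vanishing value
    would give \<open>Q = ?R * P\<close> with \<open>P\<close> zero at \<open>1\<close>, and then
    \<open>Q\<close> zero at \<open>1\<close>.\<close>
  let ?R = "\<Prod>m\<in>I. [:1, - lam m:]"
  have "fps_of_poly ?R = (\<Prod>m\<in>I. 1 - fps_const (lam m) * fps_X)"
    by (simp only: fps_of_poly_prod fps_of_poly_linear_factor)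
  then have "fps_of_poly Q = fps_of_poly Q * (fps_of_poly ?R * Tf id_op)" using Tf_id by simp
  also have "\<dots> = fps_of_poly (?R * P)"
    unfolding fps_of_poly_mult PQ(2)[symmetric] by (simp add: mult_ac)
  finally have "Q = ?R * P" by (simp only: fps_of_poly_eq_iff)
  then show False using PQ by simp
qed

end

section \<open>The cyclic permutation\<close>

text \<open>The shift \<open>i \<mapsto> i - 1\<close> modulo \<open>n + 1\<close>. As it acts on
  functions by \<open>f (v \<circ> cyc n)\<close>, this direction gives frequency \<open>j\<close>
  the eigenvalue \<open>zt n ^ j\<close> rather than its inverse.\<close>

definition cyc :: "nat \<Rightarrow> nat \<Rightarrow> nat" where
  "cyc n i = (if i = 0 then n else if i \<le> n then i - 1 else i)"

lemma cyc_permutes: "cyc n permutes {..n}"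
proof (rule bij_imp_permutes)
  have "inj_on (cyc n) {..n}" by (auto simp: inj_on_def cyc_def split: if_splits)
  moreover have "cyc n ` {..n} \<subseteq> {..n}" by (auto simp: cyc_def)
  ultimately show "bij_betw (cyc n) {..n} {..n}"
    by (simp add: bij_betw_def endo_inj_surj)
qed (auto simp: cyc_def)

definition zt :: "nat \<Rightarrow> complex" where "zt n = cis (2 * pi / real (Suc n))"

lemma zt_nz [simp]: "zt n \<noteq> 0" by (simp add: zt_def)

lemma zt_pow: "zt n ^ Suc n = 1"
  unfolding zt_def Complex.DeMoivre by simp

lemma zt_inj: "i \<le> n \<Longrightarrow> j \<le> n \<Longrightarrow> zt n ^ i = zt n ^ j \<Longrightarrow> i = j"
proof -
  assume ij: "i \<le> n" "j \<le> n" and eq: "zt n ^ i = zt n ^ j"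
  have "inj_on (\<lambda>k. cis (2 * pi * real k / real (Suc n))) {..<Suc n}"
    using Complex.bij_betw_roots_unity[of "Suc n"] by (simp add: bij_betw_def)
  moreover have "zt n ^ k = cis (2 * pi * real k / real (Suc n))" for k
    unfolding zt_def Complex.DeMoivre by (simp add: mult.commute del: of_nat_Suc)
  ultimately show "i = j" using ij eq by (auto dest!: inj_onD)
qed

text \<open>A geometric sum: the quotient of two distinct powers is an \<open>(n + 1)\<close>-st
  root of unity other than \<open>1\<close>.\<close>

lemma zt_orthogonal:
  assumes "a \<le> n" "b \<le> n"
  shows "(\<Sum>i\<le>n. zt n ^ (a * i) * inverse (zt n) ^ (b * i)) = (if a = b then of_nat (Suc n) else 0)"
proof -
  define w where "w = zt n ^ a * inverse (zt n) ^ b"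
  have sum: "(\<Sum>i\<le>n. zt n ^ (a * i) * inverse (zt n) ^ (b * i)) = (\<Sum>i<Suc n. w ^ i)"
    unfolding lessThan_Suc_atMost
    by (intro sum.cong refl) (simp add: w_def power_mult power_mult_distrib)
  show ?thesis
  proof (cases "a = b")
    case True
    then have "w = 1" by (simp add: w_def power_inverse)
    then show ?thesis using True sum by simp
  next
    case False
    then have "zt n ^ a \<noteq> zt n ^ b" using zt_inj assms by blast
    then have "w \<noteq> 1" by (auto simp: w_def power_inverse field_simps)
    moreover have "w ^ Suc n = 1"
    proof -
      have "w ^ Suc n = (zt n ^ Suc n) ^ a * inverse ((zt n ^ Suc n) ^ b)"
        by (simp only: w_def power_mult_distrib power_inverse power_mult[symmetric] mult.commute)
      then show ?thesis by (simp only: zt_pow power_one inverse_1 mult_1)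
    qed
    ultimately have "(\<Sum>i<Suc n. w ^ i) = 0" using geometric_sum[of w "Suc n"] by simp
    then show ?thesis using False sum by simp
  qed
qed

context weyl_setup
begin

text \<open>
  The discrete Fourier transform diagonalizes the cyclic permutation; its eigenvalue \<open>1\<close> does not occur on
  tuples with sum \<open>0\<close>.
\<close>

lemma id_not_inv_commutator: "Y.id_op \<notin> Q.inv_brackets"
proof -
  obtain B0 where "finite_dimensional_vector_space s B0" using sympl by (auto simp: symplectic_space_def)
  then interpret F: finite_dimensional_vector_space s B0 .
  obtain B where B: "B \<subseteq> U" "V.independent B" "U \<subseteq> V.span B"
    using V.maximal_independent_subset[of U] by blast
  have finB: "finite B" using B(2) by (rule F.finiteI_independent)
  have spanB: "V.span B = U" using B(1,3) V.span_minimal[OF B(1) subspace_U] by blast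
  define N :: complex where "N = of_nat (Suc n)"
  have N: "N \<noteq> 0" unfolding N_def by (simp del: of_nat_Suc)
  define rep where "rep = V.representation B"
  have rep_add: "rep (u + v) b = rep u b + rep v b" if "u \<in> U" "v \<in> U" for u v b
    unfolding rep_def using that spanB by (subst V.representation_add[OF B(2)]) auto
  have rep_scale: "rep (s c u) b = c * rep u b" if "u \<in> U" for u c b
    unfolding rep_def using that spanB by (subst V.representation_scale[OF B(2)]) auto
  have rep_basis: "rep b b' = (if b = b' then 1 else 0)" if "b \<in> B" for b b'
    unfolding rep_def using V.representation_basis[OF B(2) that] by simp
  have rep_eq: "u = (\<Sum>b\<in>B. s (rep u b) b)" if "u \<in> U" for u
    unfolding rep_def using V.sum_representation_eq[OF B(2), of u B] that spanB finB by simp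
  have rep_0: "rep 0 b = 0" for b unfolding rep_def by (simp add: V.representation_zero)
  have rep_sum: "rep (\<Sum>i\<le>k. v i) b = (\<Sum>i\<le>k. rep (v i) b)" if "\<And>i. i \<le> k \<Longrightarrow> v i \<in> U" for v :: "nat \<Rightarrow> 'v" and k b
    using that
  proof (induction k)
    case (Suc k)
    then have "(\<Sum>i\<le>k. v i) \<in> U" by (intro V.subspace_sum[OF subspace_U]) auto
    then show ?case using Suc by (simp add: rep_add)
  qed simp
  have YU: "v i \<in> U" if "v \<in> YX" "i \<le> n" for v i using that by (simp add: refl_tensor_def)
  define I where "I = {1..n} \<times> B"
  \<comment> \<open>\<open>xc (j, b)\<close> is the Fourier coefficient of frequency
    \<open>j\<close> of the \<open>b\<close>-coordinates of a tuple; \<open>E (j, b)\<close> is the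
    dual vector, given by the inverse transform, whence the division by \<open>N\<close>.\<close>
  define xc where "xc m = (\<lambda>v. if v \<in> YX then \<Sum>i\<le>n. zt n ^ (fst m * i) * rep (v i) (snd m) else 0)" for m
  define E where "E m = (\<lambda>i. if i \<le> n then s (inverse (zt n) ^ (fst m * i) / N) (snd m) else 0)" for m :: "nat \<times> 'v"
  define lam where "lam m = zt n ^ fst m" for m :: "nat \<times> 'v"
  have I: "1 \<le> fst m" "fst m \<le> n" "snd m \<in> B" "snd m \<in> U" if "m \<in> I" for m
    using that B(1) by (auto simp: I_def)
  have E_Y: "E m \<in> YX" if m: "m \<in> I" for m
  proof -
    have "(\<Sum>i\<le>n. inverse (zt n) ^ (fst m * i)) = 0"
      using zt_orthogonal[of 0 n "fst m"] I[OF m] by simp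
    moreover have "(\<Sum>i\<le>n. E m i) = s ((\<Sum>i\<le>n. inverse (zt n) ^ (fst m * i)) / N) (snd m)"
      by (simp add: E_def V.scale_sum_left sum_divide_distrib)
    ultimately show ?thesis using V.subspace_scale[OF subspace_U I(4)[OF m]]
      by (simp add: refl_tensor_def E_def)
  qed
  have xc_lin: "xc m \<in> Y.LF" for m
  proof -
    have "(\<Sum>i\<le>n. zt n ^ (fst m * i) * rep (ts c v i) (snd m)) = c * (\<Sum>i\<le>n. zt n ^ (fst m * i) * rep (v i) (snd m))"
      if v: "v \<in> YX" for c v
      unfolding sum_distrib_left using YU[OF v] by (intro sum.cong) (auto simp: tuple_scale_def rep_scale)
    moreover have "(\<Sum>i\<le>n. zt n ^ (fst m * i) * rep ((u + v) i) (snd m)) =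
        (\<Sum>i\<le>n. zt n ^ (fst m * i) * rep (u i) (snd m)) + (\<Sum>i\<le>n. zt n ^ (fst m * i) * rep (v i) (snd m))"
      if u: "u \<in> YX" and v: "v \<in> YX" for u v
      unfolding sum.distrib[symmetric] using YU[OF u] YU[OF v]
      by (intro sum.cong) (auto simp: rep_add algebra_simps)
    ultimately show ?thesis unfolding lin_funs_def xc_def using Y.X_closed by (simp del: plus_fun_apply)
  qed
  have dual: "xc m (E k) = (if m = k then 1 else 0)" if m: "m \<in> I" and k: "k \<in> I" for m k
  proof -
    have "xc m (E k) = (\<Sum>i\<le>n. zt n ^ (fst m * i) * inverse (zt n) ^ (fst k * i)) / N * rep (snd k) (snd m)"
      unfolding sum_divide_distrib sum_distrib_right xc_def using E_Y[OF k] I[OF k]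
      by (simp add: E_def rep_scale mult.assoc)
    then show ?thesis
      unfolding zt_orthogonal[OF I(2)[OF m] I(2)[OF k]] rep_basis[OF I(3)[OF k]] using N
      by (cases m; cases k) (auto simp: N_def simp del: of_nat_Suc)
  qed
  have expand: "v = (\<Sum>m\<in>I. ts (xc m v) (E m))" if v: "v \<in> YX" for v
  proof
    fix i
    show "v i = (\<Sum>m\<in>I. ts (xc m v) (E m)) i"
    proof (cases "i \<le> n")
      case True
      have sum0: "(\<Sum>k\<le>n. rep (v k) b) = 0" for b
        using rep_sum[of n v b] YU[OF v] v rep_0 by (simp add: refl_tensor_def)
      have coeff: "(\<Sum>j\<in>{1..n}. xc (j, b) v * (inverse (zt n) ^ (j * i) / N)) = rep (v i) b" for b
      proof -
        \<comment> \<open>Frequency \<open>0\<close> may be added to the sum, because its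
          coefficient is the sum of the \<open>b\<close>-coordinates, which is zero; then
          orthogonality applies to all frequencies.\<close>
        have "(\<Sum>j\<in>{1..n}. xc (j, b) v * (inverse (zt n) ^ (j * i) / N)) =
            (\<Sum>j\<le>n. (\<Sum>k\<le>n. zt n ^ (j * k) * rep (v k) b) * (inverse (zt n) ^ (j * i) / N))"
          using v sum0 by (intro sum.mono_neutral_cong_left) (auto simp: xc_def not_less_eq_eq)
        also have "\<dots> = (\<Sum>j\<le>n. \<Sum>k\<le>n. rep (v k) b / N * (zt n ^ (k * j) * inverse (zt n) ^ (i * j)))"
          unfolding sum_distrib_right by (intro sum.cong refl) (simp add: mult_ac)
        also have "\<dots> = (\<Sum>k\<le>n. \<Sum>j\<le>n. rep (v k) b / N * (zt n ^ (k * j) * inverse (zt n) ^ (i * j)))"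
          by (rule sum.swap)
        also have "\<dots> = (\<Sum>k\<le>n. if k = i then rep (v k) b else 0)"
          unfolding sum_distrib_left[symmetric]
          using True N by (intro sum.cong) (auto simp: zt_orthogonal N_def simp del: of_nat_Suc)
        finally show ?thesis using True by simp
      qed
      have "(\<Sum>m\<in>I. ts (xc m v) (E m)) i = (\<Sum>m\<in>I. s (xc m v * (inverse (zt n) ^ (fst m * i) / N)) (snd m))"
        using True by (simp add: sum_fun_apply tuple_scale_def E_def)
      also have "\<dots> = (\<Sum>j\<in>{1..n}. \<Sum>b\<in>B. s (xc (j, b) v * (inverse (zt n) ^ (j * i) / N)) b)"
        unfolding I_def by (subst sum.cartesian_product) (simp add: split_beta)
      also have "\<dots> = (\<Sum>b\<in>B. s (\<Sum>j\<in>{1..n}. xc (j, b) v * (inverse (zt n) ^ (j * i) / N)) b)"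
        by (subst sum.swap) (simp add: V.scale_sum_left)
      also have "\<dots> = v i" unfolding coeff using rep_eq[OF YU[OF v True]] by simp
      finally show ?thesis by simp
    qed (use v in \<open>simp add: sum_fun_apply tuple_scale_def E_def refl_tensor_def\<close>)
  qed
  have zcyc: "zt n ^ (j * i) = zt n ^ j * zt n ^ (j * cyc n i)" if "i \<le> n" for i j
  proof (cases "i = 0")
    case True
    \<comment> \<open>The cycle takes slot \<open>0\<close> to slot \<open>n\<close>; this is where
      the order of the root of unity enters.\<close>
    have "zt n ^ j * zt n ^ (j * n) = (zt n ^ Suc n) ^ j"
      by (simp add: power_mult_distrib power_mult[symmetric] mult.commute)
    then have "zt n ^ j * zt n ^ (j * n) = 1" by (simp only: zt_pow power_one)
    then show ?thesis using True by (simp add: cyc_def)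
  next
    case False
    then have "j * i = j + j * cyc n i" using that by (cases i) (auto simp: cyc_def)
    then show ?thesis by (simp add: power_add)
  qed
  have G_xc: "perm_op (cyc n) (M (xc m)) = op_scale (lam m) (M (xc m))" for m
  proof -
    have "perm_fun (cyc n) (xc m) = fun_scale (lam m) (xc m)"
    proof
      fix v
      show "perm_fun (cyc n) (xc m) v = fun_scale (lam m) (xc m) v"
      proof (cases "v \<in> YX")
        case True
        have "perm_fun (cyc n) (xc m) v = (\<Sum>i\<le>n. zt n ^ (fst m * i) * rep (v (cyc n i)) (snd m))"
          using True by (simp add: perm_fun_def xc_def refl_comp_perm[OF cyc_permutes])
        also have "\<dots> = (\<Sum>i\<le>n. lam m * (zt n ^ (fst m * cyc n i) * rep (v (cyc n i)) (snd m)))"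
        proof (rule sum.cong[OF refl])
          fix i assume "i \<in> {..n}"
          then have "i \<le> n" by simp
          show "zt n ^ (fst m * i) * rep (v (cyc n i)) (snd m) =
              lam m * (zt n ^ (fst m * cyc n i) * rep (v (cyc n i)) (snd m))"
            by (simp only: zcyc[OF \<open>i \<le> n\<close>, of "fst m"] lam_def mult.assoc)
        qed
        also have "\<dots> = (\<Sum>i\<le>n. lam m * (zt n ^ (fst m * i) * rep (v i) (snd m)))"
          using sum.permute[OF cyc_permutes, of "\<lambda>i. lam m * (zt n ^ (fst m * i) * rep (v i) (snd m))" n]
          by (simp add: comp_def)
        finally show ?thesis using True by (simp add: xc_def sum_distrib_left)
      qed (simp add: perm_fun_def xc_def refl_comp_perm[OF cyc_permutes])
    qed
    then show ?thesis by (simp only: perm_op_mult_op[OF cyc_permutes] Y.mult_op_scale)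
  qed
  have G_E: "perm_op (cyc n) (D (E m)) = op_scale (inverse (lam m)) (D (E m))" if m: "m \<in> I" for m
  proof -
    have E_cyc: "E m k = s (inverse (lam m)) (E m (cyc n k))" for k
    proof (cases "k \<le> n")
      case True
      have "inverse (zt n) ^ (fst m * k) = inverse (lam m) * inverse (zt n) ^ (fst m * cyc n k)"
        using arg_cong[OF zcyc[OF True, of "fst m"], of inverse] by (simp add: lam_def power_inverse)
      moreover have "cyc n k \<le> n" using True by (auto simp: cyc_def)
      ultimately show ?thesis using True by (simp add: E_def)
    qed (simp add: E_def cyc_def)
    have "E m \<circ> inv_into UNIV (cyc n) = ts (inverse (lam m)) (E m)"
    proof
      fix i
      show "(E m \<circ> inv_into UNIV (cyc n)) i = ts (inverse (lam m)) (E m) i"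
        using E_cyc[of "inv_into UNIV (cyc n) i"] permutes_inverses(1)[OF cyc_permutes, of n i]
        by (simp add: tuple_scale_def)
    qed
    then show ?thesis by (simp only: perm_op_deriv_op[OF cyc_permutes] Y.deriv_op_scale[OF E_Y[OF m]])
  qed
  interpret C: coord_space ts YX I xc E lam "perm_op (cyc n)"
  proof (unfold_locales, goal_cases)
    case 1 show ?case using finB by (simp add: I_def)
  next
    case 2 show ?case by (rule xc_lin)
  next
    case 3 then show ?case by (rule E_Y)
  next
    case 4 then show ?case by (rule dual)
  next
    case 5 show ?case by (simp add: lam_def)
  next
    case (6 m)
    then show ?case using zt_inj[of "fst m" n 0] I[OF 6] by (auto simp: lam_def)
  next
    case 7 show ?case by (rule perm_op_add)
  next
    case 8 show ?case by (rule perm_op_scale)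
  next
    case 9 show ?case by (rule perm_op_mul[OF cyc_permutes])
  next
    case 10 show ?case by (simp add: perm_op_mult_op[OF cyc_permutes] perm_fun_const[OF cyc_permutes])
  next
    case 11 show ?case by (rule G_xc)
  next
    case 12 then show ?case by (rule G_E)
  qed
  \<comment> \<open>The eigencoordinates generate the whole Weyl algebra, so the twisted trace is
    defined on all invariants.\<close>
  have "weyl_gens ts YX \<subseteq> A.span C.Gen"
  proof
    fix a assume "a \<in> weyl_gens ts YX"
    then consider l where "l \<in> Y.LF" "a = M l" | u where "u \<in> YX" "a = D u"
      by (auto simp: weyl_gens_def)
    then show "a \<in> A.span C.Gen"
    proof cases
      case 1
      have "l = (\<Sum>m\<in>I. fun_scale (l (E m)) (xc m))"
      proof
        fix v
        show "l v = (\<Sum>m\<in>I. fun_scale (l (E m)) (xc m)) v"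
        proof (cases "v \<in> YX")
          case True
          have "l v = l (\<Sum>m\<in>I. ts (xc m v) (E m))" using expand[OF True] by simp
          also have "\<dots> = (\<Sum>m\<in>I. l (ts (xc m v) (E m)))"
            using E_Y by (intro lin_fun_sum[OF 1(1) subspace_U] Y.X_closed(3))
          also have "\<dots> = (\<Sum>m\<in>I. xc m v * l (E m))"
            using E_Y 1(1) by (intro sum.cong) (auto simp: lin_funs_def)
          finally show ?thesis by (simp add: sum_fun_apply mult.commute)
        qed (use 1 in \<open>simp add: sum_fun_apply xc_def lin_funs_def\<close>)
      qed
      then have "a = M (\<Sum>m\<in>I. fun_scale (l (E m)) (xc m))" using 1 by simp
      also have "\<dots> = (\<Sum>m\<in>I. op_scale (l (E m)) (M (xc m)))"
        using finB by (subst sum_M[symmetric]) (auto simp: I_def Y.mult_op_scale)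
      also have "\<dots> \<in> A.span C.Gen"
        by (intro A.span_sum A.span_scale A.span_base) (auto simp: C.Gen_def)
      finally show ?thesis .
    next
      case 2
      then have "a = D (\<Sum>m\<in>I. ts (xc m u) (E m))" using expand by simp
      also have "\<dots> = (\<Sum>m\<in>I. D (ts (xc m u) (E m)))"
        using finB E_Y by (intro sum_D[symmetric] Y.X_closed(3)) (auto simp: I_def)
      also have "\<dots> = (\<Sum>m\<in>I. op_scale (xc m u) (D (E m)))"
        using E_Y by (intro sum.cong refl Y.deriv_op_scale)
      also have "\<dots> \<in> A.span C.Gen"
        by (intro A.span_sum A.span_scale A.span_base) (auto simp: C.Gen_def)
      finally show ?thesis .
    qed
  qed
  then have "A.word_filt (weyl_gens ts YX) k \<subseteq> A.word_filt C.Gen k" for k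
    by (rule A.word_filt_gens[OF C.Gen_L])
  then have "Q.Bt \<subseteq> (\<Union>k. A.word_filt C.Gen k)"
    unfolding weyl_Bt[symmetric] Y.bernstein_eq by blast
  then have Alg: "a \<in> (\<Union>k. A.word_filt C.Gen k)" if "a \<in> Q.inv_elems" for a
    using that Q.inv_elems_def by blast
  have fixed: "perm_op (cyc n) a = a" if "a \<in> Q.inv_elems" for a
    using that cyc_permutes by (simp add: Q.inv_elems_def)
  have "{cm a b | a b. a \<in> Q.inv_elems \<and> b \<in> Q.inv_elems} \<subseteq>
      {(a \<circ> b) - (b \<circ> a) | a b. a \<in> (\<Union>k. A.word_filt C.Gen k) \<and> b \<in> (\<Union>k. A.word_filt C.Gen k) \<and>
        perm_op (cyc n) a = a}" (is "_ \<subseteq> ?C")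
  proof
    fix c assume "c \<in> {cm a b | a b. a \<in> Q.inv_elems \<and> b \<in> Q.inv_elems}"
    then obtain a b where c: "c = cm a b" and ab: "a \<in> Q.inv_elems" "b \<in> Q.inv_elems" by blast
    show "c \<in> ?C"
      unfolding c cm_def by (rule CollectI) (rule exI[of _ a], rule exI[of _ b], intro conjI refl Alg fixed ab)
  qed
  then have "Q.inv_brackets \<subseteq> A.span {(a \<circ> b) - (b \<circ> a) | a b. a \<in> (\<Union>k. A.word_filt C.Gen k) \<and>
      b \<in> (\<Union>k. A.word_filt C.Gen k) \<and> perm_op (cyc n) a = a}"
    unfolding Q.inv_brackets_def by (rule A.span_mono)
  then show ?thesis using C.id_not_commutator by blast
qed

end

section \<open>Quotients by subspaces of codimension one\<close>

lemma module_iso_from_line: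
  assumes f: "bij_betw f UNIV (carrier N)"
    and add: "\<And>c d. f (c + d) = f c \<oplus>\<^bsub>N\<^esub> f d" and smult: "\<And>c d. f (c * d) = c \<odot>\<^bsub>N\<^esub> f d"
  shows "module_iso complex_field N complex_field (inv_into UNIV f)"
  unfolding module_iso_def
proof (intro conjI ballI)
  have inv: "inv_into UNIV f (f c) = c" for c
    using f by (simp add: bij_betw_def inv_into_f_f)
  have ex: "\<exists>c. x = f c" if "x \<in> carrier N" for x using f that by (auto simp: bij_betw_def)
  show "bij_betw (inv_into UNIV f) (carrier N) (carrier complex_field)"
    using bij_betw_inv_into[OF f] by (simp add: complex_field_def)
  fix x assume x: "x \<in> carrier N"
  show "inv_into UNIV f (x \<oplus>\<^bsub>N\<^esub> y) = inv_into UNIV f x \<oplus>\<^bsub>complex_field\<^esub> inv_into UNIV f y"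
    if "y \<in> carrier N" for y
    using ex[OF x] ex[OF that] by (auto simp: complex_field_def inv add[symmetric])
next
  have inv: "inv_into UNIV f (f c) = c" for c
    using f by (simp add: bij_betw_def inv_into_f_f)
  fix c x assume "x \<in> carrier N"
  then obtain d where "x = f d" using f by (auto simp: bij_betw_def)
  then show "inv_into UNIV f (c \<odot>\<^bsub>N\<^esub> x) = c \<odot>\<^bsub>complex_field\<^esub> inv_into UNIV f x"
    by (simp add: complex_field_def inv smult[symmetric])
qed

lemma module_iso_between_lines:
  assumes f: "bij_betw f UNIV (carrier N)"
    "\<And>c d. f (c + d) = f c \<oplus>\<^bsub>N\<^esub> f d" "\<And>c d. f (c * d) = c \<odot>\<^bsub>N\<^esub> f d"
    and g: "bij_betw g UNIV (carrier N')"
    "\<And>c d. g (c + d) = g c \<oplus>\<^bsub>N'\<^esub> g d" "\<And>c d. g (c * d) = c \<odot>\<^bsub>N'\<^esub> g d"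
    and \<phi>: "\<And>c. \<phi> (f c) = g c"
  shows "module_iso complex_field N N' \<phi>"
  unfolding module_iso_def
proof (intro conjI ballI)
  have ex: "\<exists>c. x = f c" if "x \<in> carrier N" for x using f(1) that by (auto simp: bij_betw_def)
  have "bij_betw (\<phi> \<circ> f) UNIV (carrier N')" using g(1) \<phi> by (simp add: comp_def)
  then show "bij_betw \<phi> (carrier N) (carrier N')" using bij_betw_comp_iff[OF f(1)] by blast
  fix x y assume x: "x \<in> carrier N" and y: "y \<in> carrier N"
  obtain c d where "x = f c" "y = f d" using ex[OF x] ex[OF y] by blast
  then show "\<phi> (x \<oplus>\<^bsub>N\<^esub> y) = \<phi> x \<oplus>\<^bsub>N'\<^esub> \<phi> y" by (simp add: f(2)[symmetric] \<phi> g(2))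
next
  fix c x assume "x \<in> carrier N"
  then obtain d where "x = f d" using f(1) by (auto simp: bij_betw_def)
  then show "\<phi> (c \<odot>\<^bsub>N\<^esub> x) = c \<odot>\<^bsub>N'\<^esub> \<phi> x" by (simp add: f(3)[symmetric] \<phi> g(3))
qed

lemma quot_ops:
  "carrier (quot_module N L) = a_rcosets\<^bsub>N\<^esub> L"
  "\<zero>\<^bsub>quot_module N L\<^esub> = L"
  "X \<oplus>\<^bsub>quot_module N L\<^esub> Y = X <+>\<^bsub>N\<^esub> Y"
  "c \<odot>\<^bsub>quot_module N L\<^esub> X = (\<Union>x\<in>X. L +>\<^bsub>N\<^esub> (c \<odot>\<^bsub>N\<^esub> x))"
  by (simp_all add: quot_module_def)

locale line_quotient = vector_space sc
  for sc :: "complex \<Rightarrow> 'b::ab_group_add \<Rightarrow> 'b" +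
  fixes M :: "(complex, 'b, 'm) module_scheme" and K :: "'b set" and e :: 'b
  assumes M: "subspace (carrier M)" "add M = (+)" "zero M = 0" "smult M = sc"
    and K: "subspace K" "K \<subseteq> carrier M"
    and e: "e \<in> carrier M" "e \<notin> K" and line: "a \<in> carrier M \<Longrightarrow> \<exists>c. a - sc c e \<in> K"
begin

definition cl :: "complex \<Rightarrow> 'b set" where "cl c = K +>\<^bsub>M\<^esub> sc c e"

lemma coset_eq: "K +>\<^bsub>M\<^esub> a = (\<lambda>k. k + a) ` K"
  by (auto simp: a_r_coset_def' M)

lemma coset_mem: "b \<in> K +>\<^bsub>M\<^esub> a \<longleftrightarrow> b - a \<in> K"
  unfolding coset_eq by (auto simp: image_iff) (metis diff_add_cancel)

lemma coset_cong: "K +>\<^bsub>M\<^esub> a = K +>\<^bsub>M\<^esub> b \<longleftrightarrow> a - b \<in> K"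
proof
  assume "K +>\<^bsub>M\<^esub> a = K +>\<^bsub>M\<^esub> b"
  moreover have "a \<in> K +>\<^bsub>M\<^esub> a" using subspace_0[OF K(1)] by (simp add: coset_mem)
  ultimately show "a - b \<in> K" by (simp add: coset_mem)
next
  assume ab: "a - b \<in> K"
  have "c - a \<in> K \<longleftrightarrow> c - b \<in> K" for c
    using subspace_add[OF K(1) _ ab, of "c - a"] subspace_diff[OF K(1) _ ab, of "c - b"] by auto
  then show "K +>\<^bsub>M\<^esub> a = K +>\<^bsub>M\<^esub> b" by (auto simp: coset_mem)
qed

lemma coset_cl: "a \<in> carrier M \<Longrightarrow> \<exists>c. K +>\<^bsub>M\<^esub> a = cl c"
  using line unfolding cl_def coset_cong by blast

lemma sc_e: "sc c e \<in> carrier M" using subspace_scale[OF M(1) e(1)] .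

lemma cl_mem: "b \<in> cl c \<longleftrightarrow> b - sc c e \<in> K"
  by (simp add: cl_def coset_mem)

lemma cl_inj: "cl c = cl d \<longleftrightarrow> c = d"
proof
  assume "cl c = cl d"
  then have "sc (c - d) e \<in> K" by (simp add: cl_def coset_cong scale_left_diff_distrib)
  then show "c = d" using subspace_scale[OF K(1), of "sc (c - d) e" "inverse (c - d)"] e(2)
    by (cases "c = d") auto
qed simp

lemma cl_0: "cl 0 = K" using coset_eq[of 0] by (simp add: cl_def)

lemma carrier_quot: "carrier (quot_module M K) = range cl"
proof -
  have "carrier (quot_module M K) = (\<Union>a\<in>carrier M. {K +>\<^bsub>M\<^esub> a})"
    by (simp add: quot_module_def A_RCOSETS_def')
  also have "\<dots> = range cl"
  proof (intro equalityI subsetI)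
    fix Z assume "Z \<in> (\<Union>a\<in>carrier M. {K +>\<^bsub>M\<^esub> a})"
    then obtain a where "a \<in> carrier M" and Z: "Z = K +>\<^bsub>M\<^esub> a" by (elim UN_E singletonE)
    then obtain c where "K +>\<^bsub>M\<^esub> a = cl c" using coset_cl by (elim exE[OF coset_cl])
    then show "Z \<in> range cl" unfolding Z by (simp only: rangeI)
  next
    fix Z assume "Z \<in> range cl"
    then obtain c where Z: "Z = cl c" by (elim rangeE)
    show "Z \<in> (\<Union>a\<in>carrier M. {K +>\<^bsub>M\<^esub> a})"
      unfolding Z cl_def using sc_e by (rule UN_I) (rule singletonI)
  qed
  finally show ?thesis .
qed

lemma quot_add: "cl c \<oplus>\<^bsub>quot_module M K\<^esub> cl d = cl (c + d)"
proof -
  have "cl c \<oplus>\<^bsub>quot_module M K\<^esub> cl d = {a + b | a b. a \<in> cl c \<and> b \<in> cl d}"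
    by (auto simp: quot_module_def set_add_def' M)
  also have "\<dots> = cl (c + d)"
  proof (intro equalityI subsetI)
    fix z assume "z \<in> {a + b | a b. a \<in> cl c \<and> b \<in> cl d}"
    then obtain a b where "z = a + b" "a - sc c e \<in> K" "b - sc d e \<in> K" by (auto simp: cl_mem)
    then have "(a - sc c e) + (b - sc d e) \<in> K" using subspace_add[OF K(1)] by blast
    then show "z \<in> cl (c + d)" using \<open>z = a + b\<close> by (simp add: cl_mem scale_left_distrib algebra_simps)
  next
    fix z assume z: "z \<in> cl (c + d)"
    have "sc d e \<in> cl d" using subspace_0[OF K(1)] by (simp add: cl_mem)
    moreover have "z - sc d e \<in> cl c" using z by (simp add: cl_mem scale_left_distrib algebra_simps)
    ultimately show "z \<in> {a + b | a b. a \<in> cl c \<and> b \<in> cl d}"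
      by (intro CollectI exI[of _ "z - sc d e"] exI[of _ "sc d e"]) simp
  qed
  finally show ?thesis .
qed

lemma quot_smult: "c \<odot>\<^bsub>quot_module M K\<^esub> cl d = cl (c * d)"
proof -
  have "K +>\<^bsub>M\<^esub> sc c x = cl (c * d)" if "x \<in> cl d" for x
  proof -
    have "sc c (x - sc d e) \<in> K" using that subspace_scale[OF K(1)] by (simp add: cl_mem)
    then show ?thesis by (simp add: cl_def coset_cong scale_right_diff_distrib)
  qed
  moreover have "sc d e \<in> cl d" using subspace_0[OF K(1)] by (simp add: cl_mem)
  ultimately show ?thesis by (auto simp: quot_module_def M)
qed

lemma bij_cl: "bij_betw cl UNIV (carrier (quot_module M K))"
  unfolding carrier_quot by (auto simp: bij_betw_def inj_on_def cl_inj)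

text \<open>
  If already \<open>F 0\<close> is the whole quotient, then the associated graded space is concentrated in degree \<open>0\<close>,
  and every other component consists of the single class \<open>range cl\<close>.
\<close>

definition gcl :: "complex \<Rightarrow> nat \<Rightarrow> 'b set set" where
  "gcl c k = (case k of 0 \<Rightarrow> {cl c} | Suc _ \<Rightarrow> range cl)"

lemma zero_quot: "\<zero>\<^bsub>quot_module M K\<^esub> = cl 0" by (simp add: quot_module_def cl_0)

context
  fixes F :: "nat \<Rightarrow> 'b set set"
  assumes F: "\<And>k. F k = range cl"
begin

abbreviation "gp \<equiv> gr_piece (quot_module M K) F"

lemma below: "filt_below (quot_module M K) F k = (case k of 0 \<Rightarrow> {cl 0} | Suc _ \<Rightarrow> range cl)"
  by (simp add: filt_below_def zero_quot F split: nat.split)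

lemma piece_coset: "filt_below (quot_module M K) F k +>\<^bsub>quot_module M K\<^esub> cl c = gcl c k"
proof (cases k)
  case 0
  then show ?thesis by (simp add: below a_r_coset_def' quot_add gcl_def)
next
  case (Suc j)
  have "cl d \<in> (\<Union>x. {cl (x + c)})" for d
    by (rule UN_I[of "d - c"]) auto
  then show ?thesis using Suc by (auto simp: below a_r_coset_def' quot_add gcl_def)
qed

text \<open>Forming a coset does not consult the carrier, so restricting it to \<open>F k\<close>,
  as \<open>gr_piece\<close> does, changes nothing.\<close>

lemma piece_coset': "filt_below (quot_module M K) F k +>\<^bsub>(quot_module M K)\<lparr>carrier := F k\<rparr>\<^esub> cl c = gcl c k"
  using piece_coset[of k c] by (simp add: a_r_coset_def')

lemma gp_carrier: "carrier (gp k) = range (\<lambda>c. gcl c k)"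
proof -
  have "carrier (gp k) = (\<Union>a\<in>F k. {filt_below (quot_module M K) F k +>\<^bsub>(quot_module M K)\<lparr>carrier := F k\<rparr>\<^esub> a})"
    unfolding gr_piece_def quot_ops(1)[of "(quot_module M K)\<lparr>carrier := F k\<rparr>"] A_RCOSETS_def' by simp
  also have "\<dots> = (\<lambda>a. filt_below (quot_module M K) F k +>\<^bsub>(quot_module M K)\<lparr>carrier := F k\<rparr>\<^esub> a) ` F k"
    by blast
  also have "\<dots> = (\<lambda>a. filt_below (quot_module M K) F k +>\<^bsub>(quot_module M K)\<lparr>carrier := F k\<rparr>\<^esub> a) ` range cl"
    by (simp only: F)
  also have "\<dots> = range (\<lambda>c. gcl c k)" by (simp only: image_image piece_coset')
  finally show ?thesis .
qed

lemma gp_zero: "\<zero>\<^bsub>gp k\<^esub> = gcl 0 k"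
  unfolding gr_piece_def quot_ops(2)[of "(quot_module M K)\<lparr>carrier := F k\<rparr>"] below by (cases k) (simp_all add: gcl_def)

lemma gp_add: "gcl c k \<oplus>\<^bsub>gp k\<^esub> gcl d k = gcl (c + d) k"
proof -
  have "gcl c k \<oplus>\<^bsub>gp k\<^esub> gcl d k = {a \<oplus>\<^bsub>quot_module M K\<^esub> b | a b. a \<in> gcl c k \<and> b \<in> gcl d k}"
    unfolding gr_piece_def quot_ops(3)[of "(quot_module M K)\<lparr>carrier := F k\<rparr>"] set_add_def' by auto
  also have "\<dots> = gcl (c + d) k"
  proof (cases k)
    case (Suc j)
    have "cl x \<in> {a \<oplus>\<^bsub>quot_module M K\<^esub> b | a b. a \<in> range cl \<and> b \<in> range cl}" for x
      by (intro CollectI exI[of _ "cl x"] exI[of _ "cl 0"]) (simp add: quot_add)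
    then show ?thesis using Suc by (auto simp: gcl_def quot_add)
  qed (auto simp: gcl_def quot_add)
  finally show ?thesis .
qed

lemma gp_smult: "c \<odot>\<^bsub>gp k\<^esub> gcl d k = gcl (c * d) k"
proof -
  have "c \<odot>\<^bsub>gp k\<^esub> gcl d k = (\<Union>x\<in>gcl d k. filt_below (quot_module M K) F k
      +>\<^bsub>(quot_module M K)\<lparr>carrier := F k\<rparr>\<^esub> (c \<odot>\<^bsub>quot_module M K\<^esub> x))"
    unfolding gr_piece_def quot_ops(4)[of "(quot_module M K)\<lparr>carrier := F k\<rparr>"] by simp
  also have "\<dots> = gcl (c * d) k"
  proof (cases k)
    case 0
    have "gcl d k = {cl d}" using 0 by (simp add: gcl_def)
    then show ?thesis by (simp add: quot_smult piece_coset')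
  next
    case (Suc j)
    have "gcl x k = range cl" for x using Suc by (simp add: gcl_def)
    then show ?thesis by (simp add: quot_smult piece_coset')
  qed
  finally show ?thesis .
qed

lemma gr_line:
  "bij_betw gcl UNIV (carrier (gr_module (quot_module M K) F))"
  "gcl (c + d) = gcl c \<oplus>\<^bsub>gr_module (quot_module M K) F\<^esub> gcl d"
  "gcl (c * d) = c \<odot>\<^bsub>gr_module (quot_module M K) F\<^esub> gcl d"
proof -
  have "carrier (gr_module (quot_module M K) F) = range gcl"
  proof (intro equalityI subsetI)
    fix g assume "g \<in> carrier (gr_module (quot_module M K) F)"
    then have g: "\<And>k. g k \<in> range (\<lambda>c. gcl c k)" by (simp add: gr_module_def gp_carrier)
    then obtain c where c: "g 0 = gcl c 0" by blast
    have "g k = gcl c k" for k using g[of k] c by (cases k) (auto simp: gcl_def)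
    then show "g \<in> range gcl" by blast
  next
    fix g assume "g \<in> range gcl"
    then obtain c where c: "g = gcl c" by blast
    have "k = 0" if "gcl c k \<noteq> gcl 0 k" for k using that by (cases k) (simp_all add: gcl_def)
    then have "{k. gcl c k \<noteq> gcl 0 k} \<subseteq> {0}" by blast
    then have "finite {k. gcl c k \<noteq> gcl 0 k}" by (rule finite_subset) simp
    then show "g \<in> carrier (gr_module (quot_module M K) F)"
      by (simp add: gr_module_def gp_carrier gp_zero c)
  qed
  moreover have "inj gcl"
  proof (rule injI)
    fix c d assume "gcl c = gcl d"
    then have "gcl c 0 = gcl d 0" by simp
    then show "c = d" by (simp add: gcl_def cl_inj)
  qed
  ultimately show "bij_betw gcl UNIV (carrier (gr_module (quot_module M K) F))"
    by (simp add: bij_betw_def)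
  show "gcl (c + d) = gcl c \<oplus>\<^bsub>gr_module (quot_module M K) F\<^esub> gcl d"
    by (rule ext) (simp add: gr_module_def gp_add)
  show "gcl (c * d) = c \<odot>\<^bsub>gr_module (quot_module M K) F\<^esub> gcl d"
    by (rule ext) (simp add: gr_module_def gp_smult)
qed

end

end

section \<open>Symbols and the natural map\<close>

text \<open>The rules other than \<open>scalar\<close> and \<open>add\<close> produce positive
  degrees. The degree is generalized to a variable \<open>k\<close> to make the induction go
  through.\<close>

lemma has_symbol_0:
  assumes "has_symbol s X \<Omega> Y \<pi> 0 a f"
  shows "\<exists>c. a = mult_op s Y (const_fun Y c) \<and> f = const_fun X c"
proof -
  have "has_symbol s X \<Omega> Y \<pi> k a f \<Longrightarrow> k = 0 \<Longrightarrow>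
      \<exists>c. a = mult_op s Y (const_fun Y c) \<and> f = const_fun X c" for k
  proof (induction rule: has_symbol.induct)
    case (add k a f b g)
    then obtain c d where "a = mult_op s Y (const_fun Y c)" "f = const_fun X c"
      "b = mult_op s Y (const_fun Y d)" "g = const_fun X d" by auto
    then have "a + b = mult_op s Y (const_fun Y (c + d))" "f + g = const_fun X (c + d)"
      by (auto simp: mult_op_def const_fun_def fun_eq_iff algebra_simps)
    then show ?case by blast
  qed auto
  then show ?thesis using assms by blast
qed

lemma homog_part_0: "homog_part s X 0 f = const_fun X (f 0)" if "\<And>x. s 0 x = 0"
  by (auto simp: homog_part_def const_fun_def that)

lemma homog_part_const:
  assumes "\<And>c x. x \<in> X \<Longrightarrow> s c x \<in> X" shows "homog_part s X (Suc k) (const_fun X c) = 0"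
proof
  fix x
  have "(deriv ^^ Suc k) (\<lambda>t::complex. c) = (\<lambda>t. 0)" for k
    by (induction k) auto
  moreover have "(\<lambda>t. const_fun X c (s t x)) = (\<lambda>t. c)" if "x \<in> X"
    using assms that by (simp add: const_fun_def)
  ultimately show "homog_part s X (Suc k) (const_fun X c) x = 0 x"
    by (simp only: homog_part_def) simp
qed

context weyl_setup
begin

lemma inv_poly_simps:
  "carrier (inv_poly s \<omega> n) = P.inv_elems" "add (inv_poly s \<omega> n) = (+)" "zero (inv_poly s \<omega> n) = 0"
  "smult (inv_poly s \<omega> n) = fun_scale" "bracket (inv_poly s \<omega> n) = X.pb"
  by (auto simp: inv_poly_def poly_algebra_def inv_poly_elems fun_scale_def fun_eq_iff Let_def)

lemma poisson_commutators_eq: "poisson_commutators (inv_poly s \<omega> n) = P.inv_brackets"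
  unfolding poisson_commutators_def P.inv_brackets_def inv_poly_simps
  by (rule lin_span_eq[OF vector_space_fun_scale])
    (use P.subspace_inv P.br_inv in \<open>auto simp: inv_poly_simps\<close>)

lemma inv_weyl_simps:
  "carrier (inv_weyl s U n) = Q.inv_elems" "add (inv_weyl s U n) = (+)" "zero (inv_weyl s U n) = 0"
  "smult (inv_weyl s U n) = op_scale" "mult (inv_weyl s U n) = (\<circ>)"
  by (auto simp: inv_weyl_def weyl_algebra_def op_algebra_def op_scale_def fun_scale_def fun_eq_iff
      invariants_def Q.inv_elems_def weyl_Bt)

lemma commutators_eq: "commutators (inv_weyl s U n) = Q.inv_brackets"
proof -
  have minus: "a \<ominus>\<^bsub>inv_weyl s U n\<^esub> b = a - b" if "b \<in> Q.inv_elems" for a b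
    unfolding a_minus_def a_inv_def using that Q.subspace_inv
    by (subst A.a_inv_eq) (simp_all add: inv_weyl_simps)
  have cm: "(a \<otimes>\<^bsub>inv_weyl s U n\<^esub> b) \<ominus>\<^bsub>inv_weyl s U n\<^esub> (b \<otimes>\<^bsub>inv_weyl s U n\<^esub> a) = cm a b"
    if "a \<in> Q.inv_elems" "b \<in> Q.inv_elems" for a b
    unfolding inv_weyl_simps cm_def by (rule minus[OF Q.mul_inv[OF that(2,1)]])
  have gens: "{(a \<otimes>\<^bsub>inv_weyl s U n\<^esub> b) \<ominus>\<^bsub>inv_weyl s U n\<^esub> (b \<otimes>\<^bsub>inv_weyl s U n\<^esub> a) | a b.
      a \<in> carrier (inv_weyl s U n) \<and> b \<in> carrier (inv_weyl s U n)} =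
    {cm a b | a b. a \<in> Q.inv_elems \<and> b \<in> Q.inv_elems}"
    unfolding inv_weyl_simps(1) by (intro Collect_cong ex_cong1) (auto simp: cm)
  show ?thesis
    unfolding commutators_def gens Q.inv_brackets_def
    by (rule lin_span_eq[OF vector_space_op_scale])
      (use Q.subspace_inv Q.br_inv in \<open>auto simp: inv_weyl_simps\<close>)
qed

sublocale LP: line_quotient fun_scale "inv_poly s \<omega> n" "P.inv_brackets" "X.cst 1"
proof -
  interpret F: vector_space fun_scale by (rule vector_space_fun_scale)
  have "X.cst 1 \<notin> P.inv_brackets"
    using inv_brackets_vanish[of "X.cst 1"] by (auto simp: const_fun_def)
  moreover have "F.subspace P.inv_brackets" unfolding P.inv_brackets_def by (rule F.subspace_span)
  ultimately show "line_quotient fun_scale (inv_poly s \<omega> n) P.inv_brackets (X.cst 1)"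
    by (unfold_locales, unfold inv_poly_simps)
      (assumption | rule refl P.subspace_inv P.inv_brackets_inv P.unit_inv P.inv_elems_mod_brackets)+
qed

sublocale LQ: line_quotient op_scale "inv_weyl s U n" "Q.inv_brackets" Y.id_op
proof -
  have "A.subspace Q.inv_brackets" unfolding Q.inv_brackets_def by (rule A.subspace_span)
  then show "line_quotient op_scale (inv_weyl s U n) Q.inv_brackets Y.id_op"
    by (unfold_locales, unfold inv_weyl_simps)
      (assumption | rule refl Q.subspace_inv Q.inv_brackets_inv Q.unit_inv id_not_inv_commutator
        Q.inv_elems_mod_brackets)+
qed

lemma HP0_eq: "HP0 (inv_poly s \<omega> n) = quot_module (inv_poly s \<omega> n) P.inv_brackets"
  by (simp add: HP0_def poisson_commutators_eq)

lemma HH0_eq: "HH0 (inv_weyl s U n) = quot_module (inv_weyl s U n) Q.inv_brackets"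
  by (simp add: HH0_def commutators_eq)

lemma inv_bernstein_eq: "inv_bernstein s U n k = {a \<in> Q.inv_elems. a \<in> Q.Fl k}"
  by (auto simp: inv_bernstein_def invariants_def bernstein_Fl Q.inv_elems_def Q.Bt_def)

lemma scalar_in_filt: "op_scale c Y.id_op \<in> inv_bernstein s U n k"
  using A.subspace_scale[OF Q.subspace_inv Q.unit_inv] A.subspace_scale[OF A.subspace_word_filt A.unit_in_filt]
  by (simp add: inv_bernstein_eq)

lemma HH0_class_eq: "HH0_class (inv_weyl s U n) a = Q.inv_brackets +>\<^bsub>inv_weyl s U n\<^esub> a"
  by (simp add: HH0_class_def commutators_eq)

text \<open>Scalars lie in every step of the filtration and represent all classes, so the filtration
  on the quotient is constant and the graded space sits in degree \<open>0\<close>.\<close>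

lemma HH0_filt_eq: "HH0_filt (inv_weyl s U n) (inv_bernstein s U n) k = range LQ.cl"
proof (intro equalityI subsetI)
  fix Z assume "Z \<in> HH0_filt (inv_weyl s U n) (inv_bernstein s U n) k"
  then obtain a where a: "a \<in> inv_bernstein s U n k" and Z: "Z = HH0_class (inv_weyl s U n) a"
    unfolding HH0_filt_def by (elim imageE)
  have "a \<in> carrier (inv_weyl s U n)" using a by (simp add: inv_bernstein_eq inv_weyl_simps)
  then show "Z \<in> range LQ.cl" unfolding Z HH0_class_eq by (elim exE[OF LQ.coset_cl]) (simp only: rangeI)
next
  fix Z assume "Z \<in> range LQ.cl"
  then obtain c where "Z = LQ.cl c" by (elim rangeE)
  then have "Z = HH0_class (inv_weyl s U n) (op_scale c Y.id_op)" by (simp only: HH0_class_eq LQ.cl_def)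
  then show "Z \<in> HH0_filt (inv_weyl s U n) (inv_bernstein s U n) k"
    unfolding HH0_filt_def using scalar_in_filt by (rule image_eqI)
qed

lemma gr_HH0_eq: "gr_HH0 (inv_weyl s U n) (inv_bernstein s U n) =
    gr_module (quot_module (inv_weyl s U n) Q.inv_brackets) (HH0_filt (inv_weyl s U n) (inv_bernstein s U n))"
  by (simp add: gr_HH0_def HH0_eq)

lemma gr_HH0_class_eq:
  "gr_HH0_class (inv_weyl s U n) (inv_bernstein s U n) k (op_scale c Y.id_op) = LQ.gcl c k"
  using LQ.piece_coset[where F = "HH0_filt (inv_weyl s U n) (inv_bernstein s U n)" and k = k, OF HH0_filt_eq, where c = c]
  by (simp add: gr_HH0_class_def HH0_eq HH0_class_eq LQ.cl_def)

lemma M_cst: "M (Y.cst c) = op_scale c Y.id_op"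
  by (auto simp: mult_op_def const_fun_def fun_eq_iff)

text \<open>The definition by \<open>THE\<close> requires a class that depends neither on the
  representative nor on the operator chosen. Both lines are parametrized by scalars, and in these
  parameters the map is the identity.\<close>

lemma natural_map_eq: "natural_map s \<omega> U W n (LP.cl c) = LQ.gcl c"
proof
  fix k
  let ?symb = "has_symbol ts VX Om YX (\<lambda>v i. \<pi> (v i))"
  let ?hom = "homog_part ts VX"
  let ?class = "gr_HH0_class (inv_weyl s U n) (inv_bernstein s U n) k"
  have ts0: "ts 0 v = 0" for v by (simp add: tuple_scale_def fun_eq_iff)
  have cst_cl: "X.cst c \<in> LP.cl c"
  proof -
    have "X.cst c - fun_scale c (X.cst 1) = 0" by (auto simp: const_fun_def fun_eq_iff)
    then show ?thesis using LP.K(1) by (simp only: LP.cl_mem P.subspace_0)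
  qed
  have "(THE Y. \<exists>f\<in>LP.cl c. \<exists>a\<in>inv_bernstein s U n k. ?symb k a (?hom k f) \<and> Y = ?class a) = LQ.gcl c k"
  proof (cases k)
    case 0
    \<comment> \<open>Brackets of invariants vanish at the origin, where the component of degree
      \<open>0\<close> is read off, so all representatives give the same constant.\<close>
    have val: "f 0 = c" if "f \<in> LP.cl c" for f
    proof -
      have "(f - fun_scale c (X.cst 1)) 0 = 0"
        using that inv_brackets_vanish unfolding LP.cl_mem by blast
      then show ?thesis by (simp add: const_fun_def)
    qed
    show ?thesis
    proof (rule the_equality)
      have "?symb 0 (M (Y.cst c)) (X.cst c)" by (rule has_symbol.scalar)
      then have "?symb k (op_scale c Y.id_op) (?hom k (X.cst c))"
        using 0 val[OF cst_cl] by (simp add: M_cst[of c] homog_part_0[of ts, OF ts0])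
      then show "\<exists>f\<in>LP.cl c. \<exists>a\<in>inv_bernstein s U n k. ?symb k a (?hom k f) \<and> LQ.gcl c k = ?class a"
        by (intro bexI[OF _ cst_cl] bexI[OF _ scalar_in_filt[of c]] conjI) (simp_all only: gr_HH0_class_eq)
    next
      fix Z assume "\<exists>f\<in>LP.cl c. \<exists>a\<in>inv_bernstein s U n k. ?symb k a (?hom k f) \<and> Z = ?class a"
      then obtain f a where fa: "f \<in> LP.cl c" "?symb 0 a (?hom 0 f)" "Z = ?class a" using 0 by auto
      then obtain d where d: "a = M (Y.cst d)" "?hom 0 f = X.cst d" using has_symbol_0 by blast
      then have "X.cst c = X.cst d" using val[OF fa(1)] by (simp add: homog_part_0[of ts, OF ts0])
      then have "X.cst c 0 = X.cst d 0" by simp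
      then have "c = d" by (simp add: const_fun_def)
      then show "Z = LQ.gcl c k" using fa(3) d(1) by (simp add: M_cst[of d] gr_HH0_class_eq)
    qed
  next
    case (Suc j)
    have cls: "?class a = LQ.gcl c k" if a: "a \<in> inv_bernstein s U n k" for a
    proof -
      obtain d where "HH0_class (inv_weyl s U n) a = LQ.cl d"
        using LQ.coset_cl a by (auto simp: HH0_class_eq inv_bernstein_eq inv_weyl_simps)
      then have "?class a = LQ.gcl d k"
        using LQ.piece_coset[where F = "HH0_filt (inv_weyl s U n) (inv_bernstein s U n)" and k = k, OF HH0_filt_eq, where c = d] by (simp add: gr_HH0_class_def HH0_eq)
      then show ?thesis by (simp add: Suc LQ.gcl_def)
    qed
    show ?thesis
    proof (rule the_equality)
      \<comment> \<open>In positive degree all classes coincide by \<open>cls\<close>, so it remains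
        to exhibit one pair: the constant function has component \<open>0\<close>, which is a symbol
        of the operator \<open>0\<close>.\<close>
      have "(0 :: (nat \<Rightarrow> 'v) fun_op) \<in> bernstein ts YX j"
        unfolding bernstein_Fl by (rule A.subspace_0[OF A.subspace_word_filt])
      then have "?symb k 0 0" unfolding Suc by (rule has_symbol.lower)
      moreover have "?hom k (X.cst c) = 0"
        unfolding Suc by (rule homog_part_const) (rule X.X_closed(3))
      moreover have "0 \<in> inv_bernstein s U n k"
        using A.subspace_0[OF A.subspace_word_filt] A.subspace_0[OF Q.subspace_inv] by (simp add: inv_bernstein_eq)
      ultimately show "\<exists>f\<in>LP.cl c. \<exists>a\<in>inv_bernstein s U n k. ?symb k a (?hom k f) \<and> LQ.gcl c k = ?class a"
        by (intro bexI[OF _ cst_cl] bexI[of _ 0] conjI) (simp_all only: cls)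
    next
      fix Z assume "\<exists>f\<in>LP.cl c. \<exists>a\<in>inv_bernstein s U n k. ?symb k a (?hom k f) \<and> Z = ?class a"
      then obtain a where "a \<in> inv_bernstein s U n k" "Z = ?class a" by (elim bexE conjE)
      then show "Z = LQ.gcl c k" by (simp only: cls)
    qed
  qed
  then show "natural_map s \<omega> U W n (LP.cl c) k = LQ.gcl c k"
    by (simp add: natural_map_def quantization_map_def)
qed

lemma HP0_line: "\<exists>\<phi>. module_iso complex_field (HP0 (inv_poly s \<omega> n)) complex_field \<phi>"
  unfolding HP0_eq
  by (rule exI, rule module_iso_from_line, rule LP.bij_cl, rule LP.quot_add[symmetric],
      rule LP.quot_smult[symmetric])

lemma gr_HH0_line:
  "\<exists>\<psi>. module_iso complex_field (gr_HH0 (inv_weyl s U n) (inv_bernstein s U n)) complex_field \<psi>"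
  unfolding gr_HH0_eq
  by (rule exI, rule module_iso_from_line, rule LQ.gr_line(1)[OF HH0_filt_eq],
      rule LQ.gr_line(2)[OF HH0_filt_eq], rule LQ.gr_line(3)[OF HH0_filt_eq])

lemma natural_map_iso:
  "module_iso complex_field (HP0 (inv_poly s \<omega> n)) (gr_HH0 (inv_weyl s U n) (inv_bernstein s U n))
     (natural_map s \<omega> U W n)"
  unfolding HP0_eq gr_HH0_eq
  by (rule module_iso_between_lines[where f = LP.cl], rule LP.bij_cl, rule LP.quot_add[symmetric],
      rule LP.quot_smult[symmetric], rule LQ.gr_line(1)[OF HH0_filt_eq],
      rule LQ.gr_line(2)[OF HH0_filt_eq], rule LQ.gr_line(3)[OF HH0_filt_eq], rule natural_map_eq)

end

theorem corollary1p1p10: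
  fixes s :: "complex \<Rightarrow> 'v::ab_group_add \<Rightarrow> 'v"
    and \<omega> :: "'v \<Rightarrow> 'v \<Rightarrow> complex"
    and U :: "'v set"
    and n :: nat
  assumes "symplectic_space s \<omega>"
    and "lagrangian s \<omega> U"
    and "n \<ge> 1"
  shows "(\<forall>W. lagrangian_complement s \<omega> U W \<longrightarrow>
            module_iso complex_field
              (HP0 (inv_poly s \<omega> n))
              (gr_HH0 (inv_weyl s U n) (inv_bernstein s U n))
              (natural_map s \<omega> U W n)) \<and>
         (\<exists>\<phi>. module_iso complex_field (HP0 (inv_poly s \<omega> n)) complex_field \<phi>) \<and>
         (\<exists>\<psi>. module_iso complex_field
              (gr_HH0 (inv_weyl s U n) (inv_bernstein s U n)) complex_field \<psi>)"
proof -
  have ws: "weyl_setup s \<omega> U W" if "lagrangian_complement s \<omega> U W" for W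
    using that assms by (simp add: weyl_setup_def symplectic_vs_def weyl_setup_axioms_def)
  \<comment> \<open>The last two claims do not mention \<open>W\<close>, but \<open>xw\<close>, and
    with it the model of the Weyl algebra, is built from a complement.\<close>
  obtain W where "lagrangian_complement s \<omega> U W"
    using lagrangian_complement_exists[OF assms(1,2)] by blast
  then show ?thesis
    using weyl_setup.natural_map_iso[OF ws] weyl_setup.HP0_line[OF ws] weyl_setup.gr_HH0_line[OF ws] by blast
qed

end
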